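(* In the setting and under the standing assumptions of the context, define $\tilde P=(\tilde P_{i'}^n)\in\mathbb R^{m_u}\otimes\mathbb R^{m_s}$ by $$\tilde P_{i'}^n:=\sum_{0\le k\le m_s}(\lambda_{i'}-\gamma_k)^{-1}H_{i'}^iG_{i,k}^n .$$ If $\alpha\in\mathcal B^{0,1}_{\rho,P}$, then $\mathrm{Lip}(\Psi[\alpha])_{i'}^n\le\tilde P_{i'}^n$ for all $i'\in I'$, $n\in I$. If $\tilde P_{j'}^j\le P_{j'}^j$ for all $j\in I$, $j'\in I'$, then $\Psi:\mathcal B^{0,1}_{\rho,P}\to\mathcal B^{0,1}_{\rho,P}$ is well defined.
   Context: Setting. $X$ is a Banach space with norm $|\cdot|$; $\dot{\mathrm x}=\tilde\Lambda\mathrm x+\tilde{\mathcal N}(\mathrm x)$ with $\tilde\Lambda$ a densely defined linear operator on $X$ with bounded inverse, $\tilde{\mathcal N}\in C^2_{\mathrm{loc}}(X,X)$, and $\tilde h\in X$ a hyperbolic equilibrium. Put $\Lambda=\tilde\Lambda$, $L=D\tilde{\mathcal N}(\tilde h)$, $\hat{\mathcal N}(\mathrm x)=\tilde{\mathcal N}(\tilde h+\mathrm x)-\tilde{\mathcal N}(\tilde h)-D\tilde{\mathcal N}(\tilde h)\mathrm x$. The change of variables $\mathrm x\to\mathrm x+\tilde h$ gives $\dot{\mathrm x}=\Lambda\mathrm x+L\mathrm x+\hat{\mathcal N}(\mathrm x)$, with $\hat{\mathcal N}(0)=0$, $D\hat{\mathcal N}(0)=0$. Indices: $I=\{1,\dots,m_s\}$,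 $I'=\{1',\dots,m_u'\}$, $\mathbf I=I\cup I'$. Unprimed letters range over $I$, primed over $I'$, bold over $\mathbf I$. Repeated unprimed (primed) indices in a product are summed over $I$ ($I'$). $X=X_s\times X_u$ is the splitting into stable and unstable eigenspaces of $\Lambda$, with $X_s=\prod_{i\in I}X_i$, $X_u=\prod_{i'\in I'}X_{i'}$, all closed subspaces; $\pi_{\mathbf i},\pi_s,\pi_u$ are the projections, $\mathrm x_{\mathbf i}=\pi_{\mathbf i}\mathrm x$, etc., and $\|\pi_{\mathbf i}\|\le p_{\mathbf i}<\infty$. $\Lambda$ maps each $X_{\mathbf i}$ into itself (restriction $\Lambda_{\mathbf i}$; $\Lambda_s,\Lambda_u$ are the restrictions to $X_s,X_u$), and there are $\lambda_i<0<\lambda_{i'}$ with $|e^{\Lambda_it}\mathrm x_i|\le e^{\lambda_it}|\mathrm x_i|$ for $t\ge0$ and $|e^{\Lambda_{i'}t}\mathrm x_{i'}|\le e^{\lambda_{i'}t}|\mathrm x_{i'}|$ for $t\le0$. $L_{\mathbf i}^{\mathbf j}=\pi_{\mathbf i}L|_{X_{\mathbf j}}$, $L_s^s=\pi_sL|_{X_s}$, $L_s^u=\pi_sL|_{X_u}$, $L_u^u=\pi_uL|_{X_u}$. There are constants $C_s,C_u$, $\lambda_s<0<\lambda_u$ with $|e^{(\Lambda_s+L_s^s)t}\mathrm x_s|\le C_se^{\lambda_st}|\mathrm x_s|$ for $t\ge0$ and $|e^{(\Lambda_u+L_u^u)t}\mathrm x_u|\le C_ue^{\lambda_ut}|\mathrm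 x_u|$ for $t\le0$. $\mathcal N(\mathrm x)=L\mathrm x+\hat{\mathcal N}(\mathrm x)$, $\mathcal N_{\mathbf i}=\pi_{\mathbf i}\mathcal N$, $\mathcal N_s=\pi_s\mathcal N$, $\mathcal N_u=\pi_u\mathcal N$ (similarly for $\hat{\mathcal N}$), viewed as functions of $(\mathrm x_s,\mathrm x_u)$; $\mathcal N_{\mathbf j}^{\mathbf i}=\partial\mathcal N_{\mathbf j}/\partial\mathrm x_{\mathbf i}$. Charts. Fix positive $\rho\in\mathbb R^{m_s}$ and $P=(P_{i'}^i)$. $B_s(\rho)=\{\mathrm x_s\in X_s:|\mathrm x_i|\le\rho_i,\ i\in I\}$. For $\alpha:B_s(\rho)\to X_u$, $\mathrm{Lip}(\alpha)_{i'}^i=\sup|\alpha_{i'}(\xi+\zeta_i)-\alpha_{i'}(\xi)|/|\zeta_i|$ over $\xi,\xi+\zeta_i\in B_s(\rho)$, $0\ne\zeta_i\in X_i$. $\mathcal B^{0,1}_{\rho,P}$ is the set of Lipschitz $\alpha:B_s(\rho)\to X_u$ with $\alpha(0)=0$, $\mathrm{Lip}(\alpha)_{i'}^i\le P_{i'}^i$. Let $r_{i'}=P_{i'}^i\rho_i$ and $B_u(r_u)=\{\mathrm x_u:|\mathrm x_{i'}|\le r_{i'}\}$. Nonnegative constants $C_{\mathbf j}^{\mathbf i}$ are fixed with $\|\mathcal N_{\mathbf j}^{\mathbf i}\|\le C_{\mathbf j}^{\mathbf i}$ on $B_s(\rho)\times B_u(r_u)$. Put $H_{\mathbf j}^i=C_{\mathbf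 j}^i+C_{\mathbf j}^{i'}P_{i'}^i$ and $\hat{\mathcal H}=\sup_{\alpha\in\mathcal B^{0,1}_{\rho,P}}\sup_{\mathrm x_s\in B_s(\rho)}\|\tfrac{\partial}{\partial\mathrm x_s}(L_s^u\alpha(\mathrm x_s)+\hat{\mathcal N}_s(\mathrm x_s,\alpha(\mathrm x_s)))\|$ (for nondifferentiable $\alpha$ the inner supremum is read as the Lipschitz constant on $B_s(\rho)$). For $\alpha\in\mathcal B^{0,1}_{\rho,P}$ and $\xi\in B_s(\rho)$, $x(t,\xi,\alpha)$ is the solution of $\dot{\mathrm x}_s=\Lambda_s\mathrm x_s+\mathcal N_s(\mathrm x_s,\alpha(\mathrm x_s))$ with $x(0,\xi,\alpha)=\xi$, and $x_j=\pi_jx$. Rates and tensor $G$. $\gamma_0=\lambda_s+C_s\hat{\mathcal H}$, $\gamma_k=\lambda_k+H_k^k$ (no sum) for $1\le k\le m_s$; assume $\gamma_0>\gamma_1>\dots>\gamma_{m_s}$ and $\gamma_0<0$. For tensors $G=(G_{i,k}^n)$, $i,n\in I$, $0\le k\le m_s$, and $j\in I$ define: $[\mathcal Q_j(G)]_{i,k}^n=0$ if $k=j$; $G_{i,k}^n+G_{i,j}^n$ if $k=j-1$ and $G_{i,j}^n>0$, or $k=j+1$ and $G_{i,j}^n<0$; $G_{i,k}^n$ otherwise. And $[\mathcal T_j(G)]_k^n=\sum_{i\ne j}(\gamma_k-\gamma_j)^{-1}H_j^iG_{i,k}^n$ if $k\ne j$, $[\mathcal T_j(G)]_j^n=\delta_j^n-\sum_{i\ne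 j}\sum_{0\le m\le m_s,m\ne j}(\gamma_m-\gamma_j)^{-1}H_j^iG_{i,m}^n$. Bootstrap algorithm: start with $G_{j,0}^n=p_jC_s$, $G_{j,k}^n=0$ for $k\ne0$; repeat $N_{\mathrm{bootstrap}}$ times: for $j=1,\dots,m_s$ in order, replace $G_{j,k}^n$ by $[\mathcal T_j(\mathcal Q_j(G))]_k^n$ for all $k,n$. $G$ is the output of this algorithm with some $N_{\mathrm{bootstrap}}\ge1$. Assume $\rho_j\ge\sum_{n\in I,\,0\le k\le m_s}e^{\gamma_kt}G_{j,k}^n\rho_n$ for all $t\ge0$, $j\in I$. Then all solutions $x(t,\xi,\alpha)$ stay in $B_s(\rho)$ and $|x_j(t,\xi,\alpha)-x_j(t,\zeta,\alpha)|\le\sum_{n,k}e^{\gamma_kt}G_{j,k}^n|\xi_n-\zeta_n|$ for all $t\ge0$. Lyapunov–Perron operator: for $\alpha\in\mathcal B^{0,1}_{\rho,P}$, $\Psi[\alpha](\xi)=-\int_0^\infty e^{-\Lambda_ut}\mathcal N_u(x(t,\xi,\alpha),\alpha(x(t,\xi,\alpha)))\,dt$, $\xi\in B_s(\rho)$. *)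

theory Defs
  imports "HOL-Analysis.Analysis"
begin

section \<open>Unbounded operators and strongly continuous semigroups\<close>

text \<open>
  An unbounded operator on a closed subspace \<open>Y\<close> is a pair of a domain \<open>D \<subseteq> Y\<close> and a
  function that is only meaningful on \<open>D\<close>.
\<close>

definition linear_op_on :: "'a::real_vector set \<Rightarrow> ('a \<Rightarrow> 'a) \<Rightarrow> bool" where
  "linear_op_on D A \<longleftrightarrow> subspace D \<and>
     (\<forall>x\<in>D. \<forall>y\<in>D. A (x + y) = A x + A y) \<and> (\<forall>c. \<forall>x\<in>D. A (c *\<^sub>R x) = c *\<^sub>R A x)"

definition has_bounded_inverse :: "'a::real_normed_vector set \<Rightarrow> ('a \<Rightarrow> 'a) \<Rightarrow> bool" where
  "has_bounded_inverse D A \<longleftrightarrow>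
     (\<exists>R. bounded_linear R \<and> (\<forall>y. R y \<in> D \<and> A (R y) = y) \<and> (\<forall>x\<in>D. R (A x) = x))"

text \<open>
  The spectrum of \<open>A\<close> does not meet the imaginary axis. The space is real, so the spectrum is
  that of the complexification: \<open>(A - i\<beta>)(x + iy) = (Ax + \<beta>y) + i(Ay - \<beta>x)\<close>.
\<close>

definition hyperbolic_op :: "'a::real_normed_vector set \<Rightarrow> ('a \<Rightarrow> 'a) \<Rightarrow> bool" where
  "hyperbolic_op D A \<longleftrightarrow>
     (\<forall>\<beta>::real. has_bounded_inverse (D \<times> D) (\<lambda>(x, y). (A x + \<beta> *\<^sub>R y, A y - \<beta> *\<^sub>R x)))"

definition C0_semigroup_on :: "'a::real_normed_vector set \<Rightarrow> (real \<Rightarrow> 'a \<Rightarrow> 'a) \<Rightarrow> bool" where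
  "C0_semigroup_on Y T \<longleftrightarrow>
     (\<forall>t\<ge>0. linear_op_on Y (T t) \<and> T t ` Y \<subseteq> Y \<and> (\<exists>K. \<forall>x\<in>Y. norm (T t x) \<le> K * norm x)) \<and>
     (\<forall>x\<in>Y. T 0 x = x) \<and>
     (\<forall>s\<ge>0. \<forall>t\<ge>0. \<forall>x\<in>Y. T (s + t) x = T s (T t x)) \<and>
     (\<forall>x\<in>Y. continuous_on {0..} (\<lambda>t. T t x))"

definition generates_on ::
  "'a::real_normed_vector set \<Rightarrow> 'a set \<Rightarrow> ('a \<Rightarrow> 'a) \<Rightarrow> (real \<Rightarrow> 'a \<Rightarrow> 'a) \<Rightarrow> bool" where
  "generates_on Y D A T \<longleftrightarrow> C0_semigroup_on Y T \<and>
     D = {x \<in> Y. \<exists>y. ((\<lambda>h. (T h x - x) /\<^sub>R h) \<longlongrightarrow> y) (at_right 0)} \<and>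
     (\<forall>x\<in>D. ((\<lambda>h. (T h x - x) /\<^sub>R h) \<longlongrightarrow> A x) (at_right 0))"

text \<open>
  \<open>op_exp Y D A t\<close> is \<open>e\<^sup>A\<^sup>t\<close> for \<open>t \<ge> 0\<close>, acting on \<open>Y\<close>. A generator determines its semigroup, so
  for \<open>t \<ge> 0\<close> and on \<open>Y\<close> the choice does not matter. For \<open>t \<le> 0\<close>, \<open>e\<^sup>A\<^sup>t\<close> is read as the semigroup
  generated by \<open>-A\<close> at time \<open>-t\<close>.
\<close>

definition op_exp :: "'a::real_normed_vector set \<Rightarrow> 'a set \<Rightarrow> ('a \<Rightarrow> 'a) \<Rightarrow> real \<Rightarrow> 'a \<Rightarrow> 'a" where
  "op_exp Y D A = (SOME T. generates_on Y D A T)"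

definition exp_bound_on ::
  "'a::real_normed_vector set \<Rightarrow> 'a set \<Rightarrow> ('a \<Rightarrow> 'a) \<Rightarrow> real \<Rightarrow> real \<Rightarrow> bool" where
  "exp_bound_on Y D A K \<mu> \<longleftrightarrow> (\<exists>T. generates_on Y D A T) \<and>
     (\<forall>t\<ge>0. \<forall>x\<in>Y. norm (op_exp Y D A t x) \<le> K * exp (\<mu> * t) * norm x)"

definition C2_map :: "('a::real_normed_vector \<Rightarrow> 'a) \<Rightarrow> bool" where
  "C2_map f \<longleftrightarrow> (\<exists>(D1 :: 'a \<Rightarrow> 'a \<Rightarrow>\<^sub>L 'a) (D2 :: 'a \<Rightarrow> 'a \<Rightarrow>\<^sub>L ('a \<Rightarrow>\<^sub>L 'a)).
     (\<forall>x. (f has_derivative blinfun_apply (D1 x)) (at x)) \<and>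
     (\<forall>x. (D1 has_derivative blinfun_apply (D2 x)) (at x)) \<and>
     continuous_on UNIV D2)"


section \<open>The data\<close>

text \<open>\<open>Stb i\<close> is the unprimed index \<open>i\<close>, \<open>Unst i\<close> the primed index \<open>i'\<close>.\<close>

datatype idx = Stb nat | Unst nat

record 'a lp_data =
  ms :: nat
  mu :: nat
  domL :: "'a set"              \<comment> \<open>domain of \<open>\<Lambda>\<close>\<close>
  Lam :: "'a \<Rightarrow> 'a"
  Nt :: "'a \<Rightarrow> 'a"              \<comment> \<open>the nonlinearity before translation to the equilibrium\<close>
  eqm :: "'a"
  proj :: "idx \<Rightarrow> 'a \<Rightarrow> 'a"
  pn :: "idx \<Rightarrow> real"           \<comment> \<open>bounds for the norms of the projections\<close>
  lam :: "idx \<Rightarrow> real"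
  lam_s :: real
  lam_u :: real
  C_s :: real
  C_u :: real
  rho :: "nat \<Rightarrow> real"
  Pc :: "nat \<Rightarrow> nat \<Rightarrow> real"      \<comment> \<open>\<open>Pc S i' i\<close>, primed index first\<close>
  Cc :: "idx \<Rightarrow> idx \<Rightarrow> real"     \<comment> \<open>\<open>Cc S j i\<close> bounds the derivative of the \<open>j\<close>-th component in direction \<open>i\<close>\<close>
  Nboot :: nat

definition Is :: "('a, 'z) lp_data_scheme \<Rightarrow> nat set" where "Is S = {1..ms S}"
definition Iu :: "('a, 'z) lp_data_scheme \<Rightarrow> nat set" where "Iu S = {1..mu S}"
definition Iall :: "('a, 'z) lp_data_scheme \<Rightarrow> idx set" where
  "Iall S = Stb ` Is S \<union> Unst ` Iu S"

definition Xc :: "('a, 'z) lp_data_scheme \<Rightarrow> idx \<Rightarrow> 'a set" where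
  "Xc S i = range (proj S i)"

definition proj_s :: "('a::banach, 'z) lp_data_scheme \<Rightarrow> 'a \<Rightarrow> 'a" where
  "proj_s S x = (\<Sum>i\<in>Is S. proj S (Stb i) x)"
definition proj_u :: "('a::banach, 'z) lp_data_scheme \<Rightarrow> 'a \<Rightarrow> 'a" where
  "proj_u S x = (\<Sum>i\<in>Iu S. proj S (Unst i) x)"

definition Xs :: "('a::banach, 'z) lp_data_scheme \<Rightarrow> 'a set" where "Xs S = range (proj_s S)"
definition Xu :: "('a::banach, 'z) lp_data_scheme \<Rightarrow> 'a set" where "Xu S = range (proj_u S)"

text \<open>
  The splitting is the internal direct sum of the ranges of complementary bounded projections
  (these ranges are closed), and it decomposes \<open>\<Lambda>\<close> including its domain. The pair
  \<open>(x\<^sub>s, x\<^sub>u)\<close> is represented by \<open>x\<^sub>s + x\<^sub>u\<close> throughout.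
\<close>

definition splitting :: "('a::banach, 'z) lp_data_scheme \<Rightarrow> bool" where
  "splitting S \<longleftrightarrow>
     (\<forall>i\<in>Iall S. bounded_linear (proj S i) \<and> onorm (proj S i) \<le> pn S i) \<and>
     (\<forall>i\<in>Iall S. \<forall>j\<in>Iall S. \<forall>x. proj S i (proj S j x) = (if i = j then proj S j x else 0)) \<and>
     (\<forall>x. (\<Sum>i\<in>Iall S. proj S i x) = x) \<and>
     (\<forall>i\<in>Iall S. proj S i ` domL S \<subseteq> domL S \<and> Lam S ` (domL S \<inter> Xc S i) \<subseteq> Xc S i)"

definition Lop :: "('a::banach, 'z) lp_data_scheme \<Rightarrow> 'a \<Rightarrow> 'a" where
  "Lop S = frechet_derivative (Nt S) (at (eqm S))"

definition hyperbolic_equilibrium :: "('a::banach, 'z) lp_data_scheme \<Rightarrow> bool" where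
  "hyperbolic_equilibrium S \<longleftrightarrow> eqm S \<in> domL S \<and> Lam S (eqm S) + Nt S (eqm S) = 0 \<and>
     hyperbolic_op (domL S) (\<lambda>x. Lam S x + Lop S x)"

definition Nhat :: "('a::banach, 'z) lp_data_scheme \<Rightarrow> 'a \<Rightarrow> 'a" where
  "Nhat S x = Nt S (eqm S + x) - Nt S (eqm S) - Lop S x"

definition Nfull :: "('a::banach, 'z) lp_data_scheme \<Rightarrow> 'a \<Rightarrow> 'a" where
  "Nfull S x = Lop S x + Nhat S x"

text \<open>
  \<open>Npartial S j i x\<close>, restricted to \<open>Xc S i\<close>, is the partial derivative of the \<open>j\<close>-th component
  of \<open>Nfull S\<close> with respect to the \<open>i\<close>-th variable at \<open>x\<close>.
\<close>

definition Npartial ::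
  "('a::banach, 'z) lp_data_scheme \<Rightarrow> idx \<Rightarrow> idx \<Rightarrow> 'a \<Rightarrow> 'a \<Rightarrow> 'a" where
  "Npartial S j i x v =
     (if v \<in> Xc S i then proj S j (frechet_derivative (Nfull S) (at x) v) else 0)"


section \<open>Charts\<close>

definition Bs :: "('a::banach, 'z) lp_data_scheme \<Rightarrow> 'a set" where
  "Bs S = {x \<in> Xs S. \<forall>i\<in>Is S. norm (proj S (Stb i) x) \<le> rho S i}"

definition ru :: "('a, 'z) lp_data_scheme \<Rightarrow> nat \<Rightarrow> real" where
  "ru S i' = (\<Sum>i\<in>Is S. Pc S i' i * rho S i)"

definition Bu :: "('a::banach, 'z) lp_data_scheme \<Rightarrow> 'a set" where
  "Bu S = {x \<in> Xu S. \<forall>i'\<in>Iu S. norm (proj S (Unst i') x) \<le> ru S i'}"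

text \<open>The supremum over an empty set (when \<open>Xc S (Stb i) = {0}\<close>) is \<open>0\<close>.\<close>

definition Lip :: "('a::banach, 'z) lp_data_scheme \<Rightarrow> ('a \<Rightarrow> 'a) \<Rightarrow> nat \<Rightarrow> nat \<Rightarrow> ereal" where
  "Lip S \<alpha> i' i = Sup (insert 0
     {ereal (norm (proj S (Unst i') (\<alpha> (\<xi> + \<zeta>)) - proj S (Unst i') (\<alpha> \<xi>)) / norm \<zeta>) | \<xi> \<zeta>.
        \<xi> \<in> Bs S \<and> \<xi> + \<zeta> \<in> Bs S \<and> \<zeta> \<in> Xc S (Stb i) \<and> \<zeta> \<noteq> 0})"

text \<open>A chart is a function on the ambient type of which only the values on \<open>Bs S\<close> matter.\<close>

definition charts :: "('a::banach, 'z) lp_data_scheme \<Rightarrow> ('a \<Rightarrow> 'a) set" where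
  "charts S = {\<alpha>. \<alpha> ` Bs S \<subseteq> Xu S \<and> (\<exists>K. K-lipschitz_on (Bs S) \<alpha>) \<and> \<alpha> 0 = 0 \<and>
     (\<forall>i'\<in>Iu S. \<forall>i\<in>Is S. Lip S \<alpha> i' i \<le> ereal (Pc S i' i))}"

definition Hc :: "('a, 'z) lp_data_scheme \<Rightarrow> idx \<Rightarrow> nat \<Rightarrow> real" where
  "Hc S j i = Cc S j (Stb i) + (\<Sum>i'\<in>Iu S. Cc S j (Unst i') * Pc S i' i)"

definition rem_s :: "('a::banach, 'z) lp_data_scheme \<Rightarrow> ('a \<Rightarrow> 'a) \<Rightarrow> 'a \<Rightarrow> 'a" where
  "rem_s S \<alpha> x = proj_s S (Lop S (\<alpha> x)) + proj_s S (Nhat S (x + \<alpha> x))"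

text \<open>
  The operator norm is that of \<open>Xs S\<close>. Derivatives relative to \<open>Bs S\<close> are uniquely determined on
  \<open>Xs S\<close>, because \<open>Bs S\<close> is convex with nonempty interior in \<open>Xs S\<close>.
\<close>

definition Hhat_at :: "('a::banach, 'z) lp_data_scheme \<Rightarrow> ('a \<Rightarrow> 'a) \<Rightarrow> real" where
  "Hhat_at S \<alpha> =
     (if \<alpha> differentiable_on Bs S
      then (SUP x\<in>Bs S. SUP v\<in>{v \<in> Xs S. norm v \<le> 1}.
              norm (frechet_derivative (rem_s S \<alpha>) (at x within Bs S) v))
      else Inf {K. K-lipschitz_on (Bs S) (rem_s S \<alpha>)})"

definition Hhat :: "('a::banach, 'z) lp_data_scheme \<Rightarrow> real" where
  "Hhat S = (SUP \<alpha>\<in>charts S. Hhat_at S \<alpha>)"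


section \<open>Trajectories on a chart\<close>

definition expLs :: "('a::banach, 'z) lp_data_scheme \<Rightarrow> real \<Rightarrow> 'a \<Rightarrow> 'a" where
  "expLs S = op_exp (Xs S) (domL S \<inter> Xs S) (Lam S)"

text \<open>\<open>exp_minus_Lu S t\<close> is \<open>e\<^sup>-\<^sup>\<Lambda>\<^sup>t\<close> on \<open>Xu S\<close>, for \<open>t \<ge> 0\<close>.\<close>

definition exp_minus_Lu :: "('a::banach, 'z) lp_data_scheme \<Rightarrow> real \<Rightarrow> 'a \<Rightarrow> 'a" where
  "exp_minus_Lu S = op_exp (Xu S) (domL S \<inter> Xu S) (\<lambda>x. - Lam S x)"

text \<open>
  Solutions are mild solutions (\<open>\<Lambda>\<close> is unbounded and \<open>\<alpha>\<close> only Lipschitz). Since \<open>\<alpha>\<close> is only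
  defined on \<open>Bs S\<close>, a solution takes values in \<open>Bs S\<close>.
\<close>

definition is_sol ::
  "('a::banach, 'z) lp_data_scheme \<Rightarrow> ('a \<Rightarrow> 'a) \<Rightarrow> 'a \<Rightarrow> (real \<Rightarrow> 'a) \<Rightarrow> bool" where
  "is_sol S \<alpha> \<xi> x \<longleftrightarrow> continuous_on {0..} x \<and> (\<forall>t\<ge>0. x t \<in> Bs S) \<and>
     (\<forall>t\<ge>0. ((\<lambda>\<tau>. expLs S (t - \<tau>) (proj_s S (Nfull S (x \<tau> + \<alpha> (x \<tau>)))))
                has_integral (x t - expLs S t \<xi>)) {0..t})"

definition traj :: "('a::banach, 'z) lp_data_scheme \<Rightarrow> ('a \<Rightarrow> 'a) \<Rightarrow> real \<Rightarrow> 'a \<Rightarrow> 'a" where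
  "traj S \<alpha> t \<xi> = (SOME x. is_sol S \<alpha> \<xi> x) t"


section \<open>Rates and the bootstrap algorithm\<close>

definition gam :: "('a::banach, 'z) lp_data_scheme \<Rightarrow> nat \<Rightarrow> real" where
  "gam S k = (if k = 0 then lam_s S + C_s S * Hhat S else lam S (Stb k) + Hc S (Stb k) k)"

text \<open>A tensor is a function \<open>G i k n\<close> with \<open>i, n \<in> Is S\<close> and \<open>0 \<le> k \<le> ms S\<close>.\<close>

type_synonym tensor = "nat \<Rightarrow> nat \<Rightarrow> nat \<Rightarrow> real"

definition Qop :: "nat \<Rightarrow> tensor \<Rightarrow> tensor" where
  "Qop j G i k n =
     (if k = j then 0
      else if (k + 1 = j \<and> G i j n > 0) \<or> (k = j + 1 \<and> G i j n < 0) then G i k n + G i j n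
      else G i k n)"

definition Top :: "('a::banach, 'z) lp_data_scheme \<Rightarrow> nat \<Rightarrow> tensor \<Rightarrow> nat \<Rightarrow> nat \<Rightarrow> real" where
  "Top S j G k n =
     (if k \<noteq> j
      then (\<Sum>i\<in>Is S - {j}. inverse (gam S k - gam S j) * Hc S (Stb j) i * G i k n)
      else (if n = j then 1 else 0)
         - (\<Sum>i\<in>Is S - {j}. \<Sum>m\<in>{0..ms S} - {j}.
              inverse (gam S m - gam S j) * Hc S (Stb j) i * G i m n))"

definition boot_row :: "('a::banach, 'z) lp_data_scheme \<Rightarrow> nat \<Rightarrow> tensor \<Rightarrow> tensor" where
  "boot_row S j G = G(j := Top S j (Qop j G))"

definition boot_sweep :: "('a::banach, 'z) lp_data_scheme \<Rightarrow> tensor \<Rightarrow> tensor" where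
  "boot_sweep S G = fold (boot_row S) [1..<ms S + 1] G"

definition G_init :: "('a::banach, 'z) lp_data_scheme \<Rightarrow> tensor" where
  "G_init S j k n = (if k = 0 then pn S (Stb j) * C_s S else 0)"

definition Gout :: "('a::banach, 'z) lp_data_scheme \<Rightarrow> tensor" where
  "Gout S = (boot_sweep S ^^ Nboot S) (G_init S)"


section \<open>The Lyapunov--Perron operator\<close>

definition lp_integrand ::
  "('a::banach, 'z) lp_data_scheme \<Rightarrow> ('a \<Rightarrow> 'a) \<Rightarrow> 'a \<Rightarrow> real \<Rightarrow> 'a" where
  "lp_integrand S \<alpha> \<xi> t =
     exp_minus_Lu S t (proj_u S (Nfull S (traj S \<alpha> t \<xi> + \<alpha> (traj S \<alpha> t \<xi>))))"

text \<open>
  The Bochner integral of the library needs a second countable codomain, so the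
  Henstock--Kurzweil integral is used; \<open>Psi_defined\<close> asks in addition for absolute convergence.
\<close>

definition Psi :: "('a::banach, 'z) lp_data_scheme \<Rightarrow> ('a \<Rightarrow> 'a) \<Rightarrow> 'a \<Rightarrow> 'a" where
  "Psi S \<alpha> \<xi> = - integral {0..} (lp_integrand S \<alpha> \<xi>)"

definition Psi_defined :: "('a::banach, 'z) lp_data_scheme \<Rightarrow> ('a \<Rightarrow> 'a) \<Rightarrow> bool" where
  "Psi_defined S \<alpha> \<longleftrightarrow> (\<forall>\<xi>\<in>Bs S.
     (\<exists>x. is_sol S \<alpha> \<xi> x) \<and>
     (\<forall>x y. is_sol S \<alpha> \<xi> x \<longrightarrow> is_sol S \<alpha> \<xi> y \<longrightarrow> (\<forall>t\<ge>0. x t = y t)) \<and>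
     lp_integrand S \<alpha> \<xi> integrable_on {0..} \<and>
     (\<lambda>t. norm (lp_integrand S \<alpha> \<xi> t)) integrable_on {0..})"

definition Ptilde :: "('a::banach, 'z) lp_data_scheme \<Rightarrow> nat \<Rightarrow> nat \<Rightarrow> real" where
  "Ptilde S i' n = (\<Sum>k\<in>{0..ms S}. \<Sum>i\<in>Is S.
     inverse (lam S (Unst i') - gam S k) * Hc S (Unst i') i * Gout S i k n)"

end

theory Submission
  imports Defs
begin

text \<open>
  By the variation of constants formula, the difference of two trajectories on a chart decays like
  \<open>e\<^bsup>\<gamma>\<^sub>0t\<^esup>\<close> (using the semigroup generated by \<open>\<Lambda>\<^sub>s + L\<^sub>s\<^sup>s\<close>), and its \<open>j\<close>-th component satisfies a
  scalar integral inequality driven by the other components. Each bootstrap step replaces the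
  current bound of the \<open>j\<close>-th component by the solution of the corresponding scalar equation, so
  that the comparison form of Gronwall's inequality keeps the tensor a valid bound. These a priori
  bounds keep trajectories in the box, hence give global existence, and integrating them against
  \<open>e\<^bsup>-\<lambda>t\<^esup>\<close> bounds the Lipschitz constants of \<open>\<Psi>\<close>.

  Mild solutions are not differentiable in general. Everything about them is deduced from one form
  of Duhamel's principle: if \<open>(w (s + k) - T k (w s)) / k\<close> tends to \<open>p s\<close> as \<open>k\<close> decreases to \<open>0\<close>, then
  \<open>w t = T t (w 0) + \<integral>T (t - s) (p s) ds\<close>, because \<open>T (t - s) (w s)\<close> has right derivative \<open>T (t - s) (p s)\<close>.
\<close>

section \<open>One-sided derivatives, Gronwall comparison, improper integrals\<close>

text \<open>Two obstacles shape the argument. A chart lives only on the box, so an a priori bound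
  speaks about a trajectory only while it is known to stay there. The field is therefore composed
  with a retraction onto the box, which makes it globally Lipschitz, and leaving the box is excluded
  by a first exit argument. That argument needs a margin, so initial values are shrunk by a factor
  below 1. Secondly, the bootstrap can create negative tensor entries, so nothing can be estimated
  entrywise. What stays nonnegative is the function of time \<open>tensor_sum\<close>, and every
  invariant is stated for it. Two objects must also be shown to mean what they should.
  \<open>op_exp\<close> is a choice, and only uniqueness of the semigroup with a given generator
  identifies it with the sum of the component exponentials, from which the componentwise decay is
  inherited. \<open>Hhat\<close> is a real supremum, so it bounds anything only after a bound that
  is uniform over all charts and all points of the box, including its boundary.\<close>

lemma right_derivative_zero:
  fixes d :: "real \<Rightarrow> 'a::real_normed_vector"
  assumes cont: "continuous_on {a..b} d"
    and deriv: "\<And>s. a \<le> s \<Longrightarrow> s < b \<Longrightarrow> ((\<lambda>k. (d (s + k) - d s) /\<^sub>R k) \<longlongrightarrow> 0) (at_right 0)"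
    and t: "a \<le> t" "t \<le> b"
  shows "d t = d a"
proof -
  have bound: "norm (d t - d a) \<le> e * (t - a)" if e: "e > 0" for e
  proof (rule ccontr)
    assume neg: "\<not> norm (d t - d a) \<le> e * (t - a)"
    define B where "B = {x \<in> {a..b}. norm (d x - d a) > e * (x - a)}"
    \<comment> \<open>The slope bound holds before \<open>s\<close> by minimality and at
      \<open>s\<close> by continuity. The right derivative at \<open>s\<close> carries it a little
      beyond, so no points of \<open>B\<close> can accumulate at \<open>s\<close> from the
      right.\<close>
    define s where "s = Inf B"
    have tB: "t \<in> B" using neg t by (auto simp: B_def)
    have bdd: "bdd_below B" by (auto simp: B_def bdd_below_def)
    have as: "a \<le> s" unfolding s_def using tB by (intro cInf_greatest) (auto simp: B_def)
    have st: "s \<le> t" unfolding s_def using tB bdd by (intro cInf_lower)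
    have below: "norm (d x - d a) \<le> e * (x - a)" if "a \<le> x" "x < s" for x
    proof (rule ccontr)
      assume "\<not> norm (d x - d a) \<le> e * (x - a)"
      then have "x \<in> B" using that st t by (auto simp: B_def)
      then have "s \<le> x" unfolding s_def using bdd by (intro cInf_lower)
      with that show False by simp
    qed
    have at_s: "norm (d s - d a) \<le> e * (s - a)"
    proof (cases "a = s")
      case False
      then have "a < s" using as by simp
      have "s \<in> closure {a<..<s}" using \<open>a < s\<close> by simp
      moreover have "continuous_on (closure {a<..<s}) (\<lambda>x. norm (d x - d a) - e * (x - a))"
        using \<open>a < s\<close> st t
        by (intro continuous_intros continuous_on_subset[OF cont]) auto
      ultimately have "norm (d s - d a) - e * (s - a) \<le> 0"
        by (intro continuous_le_on_closure[of "{a<..<s}" "\<lambda>x. norm (d x - d a) - e * (x - a)" s 0])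
          (simp_all add: below)
      then show ?thesis by simp
    qed simp
    have "s \<noteq> t" using at_s neg by auto
    then have "s < b" using st t by simp
    from tendstoD[OF deriv[OF as this] e]
    have "\<forall>\<^sub>F k in at_right 0. norm ((d (s + k) - d s) /\<^sub>R k) < e"
      by (simp add: dist_norm)
    then obtain \<delta> where \<delta>: "\<delta> > 0" "\<And>k. 0 < k \<Longrightarrow> k < \<delta> \<Longrightarrow> norm ((d (s + k) - d s) /\<^sub>R k) < e"
      unfolding eventually_at_right_field by blast
    obtain x where x: "x \<in> B" "x < s + \<delta>"
      using cInf_lessD[of B "s + \<delta>"] tB \<delta>(1) unfolding s_def by auto
    have "s \<le> x" unfolding s_def using x bdd by (intro cInf_lower)
    moreover have "x \<noteq> s" using x at_s by (auto simp: B_def)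
    ultimately have sx: "s < x" by simp
    have "norm (d x - d s) \<le> e * (x - s)"
    proof -
      have "norm (d x - d s) / (x - s) < e"
        using \<delta>(2)[of "x - s"] x sx by (simp add: divide_inverse mult.commute)
      then show ?thesis using sx by (simp add: pos_divide_less_eq)
    qed
    then have "norm (d x - d a) \<le> e * (x - a)"
    proof -
      have "norm (d x - d a) \<le> norm (d x - d s) + norm (d s - d a)"
        using norm_triangle_ineq[of "d x - d s" "d s - d a"] by simp
      also have "\<dots> \<le> e * (x - s) + e * (s - a)"
        by (intro add_mono \<open>norm (d x - d s) \<le> e * (x - s)\<close> at_s)
      finally show ?thesis by (simp add: right_diff_distrib)
    qed
    then show False using x by (simp add: B_def)
  qed
  have "norm (d t - d a) \<le> 0"
  proof (rule field_le_epsilon)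
    fix e :: real assume "e > 0"
    have "norm (d t - d a) \<le> e / (t - a + 1) * (t - a)"
      using bound[of "e / (t - a + 1)"] \<open>e > 0\<close> t by simp
    also have "\<dots> = e * ((t - a) / (t - a + 1))" by simp
    also have "\<dots> \<le> e" using \<open>e > 0\<close> t by (intro mult_left_le) auto
    finally show "norm (d t - d a) \<le> 0 + e" by simp
  qed
  then show ?thesis by simp
qed

text \<open>Subtracting the indefinite integral of \<psi> leaves a continuous function with
  vanishing right derivative, hence a constant. The one-sided form is needed because a semigroup can
  only be advanced in time.\<close>

lemma fundamental_theorem_of_calculus_right:
  fixes \<phi> :: "real \<Rightarrow> 'a::banach"
  assumes ab: "a \<le> b" and cont: "continuous_on {a..b} \<phi>" and cont': "continuous_on {a..b} \<psi>"
    and deriv: "\<And>s. a \<le> s \<Longrightarrow> s < b \<Longrightarrow> ((\<lambda>k. (\<phi> (s + k) - \<phi> s) /\<^sub>R k) \<longlongrightarrow> \<psi> s) (at_right 0)"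
  shows "(\<psi> has_integral \<phi> b - \<phi> a) {a..b}"
proof -
  define d where "d t = \<phi> t - integral {a..t} \<psi>" for t
  have int: "\<psi> integrable_on {a..b}" by (rule integrable_continuous_real[OF cont'])
  have "d b = d a"
  proof (rule right_derivative_zero)
    show "continuous_on {a..b} d"
      unfolding d_def by (intro continuous_intros cont indefinite_integral_continuous_1 int)
    show "a \<le> b" "b \<le> b" using ab by auto
    fix s assume s: "a \<le> s" "s < b"
    have "((\<lambda>u. integral {a..u} \<psi>) has_vector_derivative \<psi> s) (at s within {a..b})"
      by (rule integral_has_vector_derivative[OF cont']) (use s in auto)
    then have "((\<lambda>u. integral {a..u} \<psi>) has_vector_derivative \<psi> s) (at s within {s..b})"
      by (rule has_vector_derivative_within_subset) (use s in auto)
    then have *: "((\<lambda>u. (1 / norm (u - s)) *\<^sub>R (integral {a..u} \<psi> - (integral {a..s} \<psi> + (u - s) *\<^sub>R \<psi> s))) \<longlongrightarrow> 0) (at_right s)"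
      using s by (simp add: has_vector_derivative_def has_derivative_within at_within_Icc_at_right)
    have "((\<lambda>u. (integral {a..u} \<psi> - integral {a..s} \<psi>) /\<^sub>R (u - s) - \<psi> s) \<longlongrightarrow> 0) (at_right s)"
      by (rule Lim_transform_eventually[OF *], rule eventually_mono[OF eventually_at_right_less])
        (simp add: scaleR_diff_right scaleR_add_right divide_inverse)
    then have "((\<lambda>u. (integral {a..u} \<psi> - integral {a..s} \<psi>) /\<^sub>R (u - s)) \<longlongrightarrow> \<psi> s) (at_right s)"
      by (simp add: LIM_zero_iff)
    then have lim: "((\<lambda>k. (integral {a..s + k} \<psi> - integral {a..s} \<psi>) /\<^sub>R k) \<longlongrightarrow> \<psi> s) (at_right 0)"
      by (simp add: at_right_to_0[of s] filterlim_filtermap add.commute)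
    show "((\<lambda>k. (d (s + k) - d s) /\<^sub>R k) \<longlongrightarrow> 0) (at_right 0)"
      using tendsto_diff[OF deriv[OF s] lim] by (simp add: d_def algebra_simps)
  qed
  then have "\<phi> b - \<phi> a = integral {a..b} \<psi>" by (simp add: d_def algebra_simps)
  then show ?thesis using int by (simp add: integrable_integral)
qed

text \<open>The function \<open>E\<close>, an integral with integrating factor, has derivative
  \<open>exp (- H * s) * (d s - H * integral {0..s} d)\<close>, which the hypothesis makes
  nonpositive. So the integral of \<open>d\<close> is nonpositive, and the hypothesis then gives the
  same for \<open>d\<close>.\<close>

lemma gronwall_nonpos:
  fixes d :: "real \<Rightarrow> real"
  assumes cont: "continuous_on {0..T} d" and H: "H \<ge> 0"
    and le: "\<And>t. 0 \<le> t \<Longrightarrow> t \<le> T \<Longrightarrow> d t \<le> H * integral {0..t} d"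
    and t: "0 \<le> t" "t \<le> T"
  shows "d t \<le> 0"
proof -
  define E where "E s = exp (- H * s) * integral {0..s} d" for s
  have "E t \<le> E 0"
  proof (rule DERIV_nonpos_imp_decreasing_open[OF t(1)])
    show "continuous_on {0..t} E"
      unfolding E_def using t
      by (intro continuous_intros indefinite_integral_continuous_1 integrable_continuous_real
          continuous_on_subset[OF cont]) auto
    fix s assume s: "0 < s" "s < t"
    have "((\<lambda>x. integral {0..x} d) has_real_derivative d s) (at s within {0..T})"
      by (rule integral_has_real_derivative[OF cont]) (use s t in auto)
    then have "((\<lambda>x. integral {0..x} d) has_real_derivative d s) (at s)"
      using s t by (simp add: at_within_Icc_at)
    then have "(E has_real_derivative exp (- H * s) * (d s - H * integral {0..s} d)) (at s)"
      unfolding E_def by (auto intro!: derivative_eq_intros simp: algebra_simps)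
    then show "\<exists>y. (E has_real_derivative y) (at s) \<and> y \<le> 0"
      using le[of s] s t by (intro exI conjI) (auto simp: mult_le_0_iff)
  qed
  then have "integral {0..t} d \<le> 0" by (simp add: E_def mult_le_0_iff)
  then show ?thesis using le[OF t] H mult_nonneg_nonpos[OF H] by force
qed

text \<open>Multiplication by \<open>exp (- l * t)\<close> frees the kernel from the upper limit of
  integration. The function \<open>w\<close> satisfies with equality the integral relation that
  bounds \<open>u\<close>, with \<open>c\<close> in place of \<open>b\<close>, so the weighted
  difference falls under \<open>gronwall_nonpos\<close>.\<close>

lemma gronwall_compare:
  fixes u b c w :: "real \<Rightarrow> real"
  assumes cu: "continuous_on {0..T} u" and cb: "continuous_on {0..T} b" and cc: "continuous_on UNIV c"
    and H: "H \<ge> 0" and aw: "a \<le> w 0"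
    and w: "\<And>t. (w has_real_derivative (l + H) * w t + c t) (at t)"
    and bc: "\<And>t. 0 \<le> t \<Longrightarrow> t \<le> T \<Longrightarrow> b t \<le> c t"
    and u: "\<And>t. 0 \<le> t \<Longrightarrow> t \<le> T \<Longrightarrow>
       u t \<le> exp (l * t) * a + integral {0..t} (\<lambda>s. exp (l * (t - s)) * (H * u s + b s))"
    and t: "0 \<le> t" "t \<le> T"
  shows "u t \<le> w t"
proof -
  define d where "d s = exp (- l * s) * (u s - w s)" for s
  have cw: "continuous_on A w" for A
    by (intro continuous_at_imp_continuous_on ballI DERIV_isCont[OF w])
  have "d t \<le> 0"
  proof (rule gronwall_nonpos[OF _ H _ t])
    show "continuous_on {0..T} d" unfolding d_def by (intro continuous_intros cu cw)
    fix r assume r: "0 \<le> r" "r \<le> T"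
    have sub: "continuous_on {0..r} u" "continuous_on {0..r} b" "continuous_on {0..r} c" "continuous_on {0..r} w"
      using r by (auto intro: continuous_on_subset[OF cu] continuous_on_subset[OF cb] continuous_on_subset[OF cc] cw)
    have 1: "((\<lambda>s. exp (- l * s) * (H * w s + c s)) has_integral exp (- l * r) * w r - exp (- l * 0) * w 0) {0..r}"
      using r(1)
    proof (rule fundamental_theorem_of_calculus)
      fix x assume "x \<in> {0..r}"
      have "((\<lambda>s. exp (- l * s) * w s) has_real_derivative exp (- l * x) * (H * w x + c x)) (at x)"
        using w[of x] by (auto intro!: derivative_eq_intros simp: algebra_simps)
      then show "((\<lambda>s. exp (- l * s) * w s) has_vector_derivative exp (- l * x) * (H * w x + c x)) (at x within {0..r})"
        by (simp add: has_real_derivative_iff_has_vector_derivative[symmetric] has_field_derivative_at_within)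
    qed
    have i1: "(\<lambda>s. exp (- l * s) * (H * u s + b s)) integrable_on {0..r}"
      by (intro integrable_continuous_real continuous_intros sub)
    have "exp (- l * r) * u r \<le> exp (- l * r) * (exp (l * r) * a + integral {0..r} (\<lambda>s. exp (l * (r - s)) * (H * u s + b s)))"
      using u[OF r] by simp
    also have "\<dots> = a + integral {0..r} (\<lambda>s. exp (- l * s) * (H * u s + b s))"
    proof -
      have e: "exp (- l * r) * exp (l * (r - s)) = exp (- l * s)" for s
        by (simp add: algebra_simps flip: exp_add)
      have "exp (- l * r) * integral {0..r} (\<lambda>s. exp (l * (r - s)) * (H * u s + b s))
        = integral {0..r} (\<lambda>s. exp (- l * s) * (H * u s + b s))"
        by (simp only: e mult.assoc[symmetric] flip: integral_mult_right)
      moreover have "exp (- l * r) * (exp (l * r) * a) = a" by (simp flip: mult.assoc exp_add)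
      ultimately show ?thesis by (simp only: distrib_left)
    qed
    also have "\<dots> \<le> a + integral {0..r} (\<lambda>s. exp (- l * s) * (H * u s + c s))"
      using r bc by (intro add_left_mono integral_le i1 integrable_continuous_real continuous_intros sub) auto
    finally have 2: "exp (- l * r) * u r \<le> a + integral {0..r} (\<lambda>s. exp (- l * s) * (H * u s + c s))" .
    have i2: "(\<lambda>s. exp (- l * s) * (H * u s + c s)) integrable_on {0..r}"
      by (intro integrable_continuous_real continuous_intros sub)
    have "d r \<le> a - w 0 + (integral {0..r} (\<lambda>s. exp (- l * s) * (H * u s + c s))
                - integral {0..r} (\<lambda>s. exp (- l * s) * (H * w s + c s)))"
      using 2 integral_unique[OF 1] by (simp add: d_def algebra_simps)
    also have "\<dots> \<le> integral {0..r} (\<lambda>s. exp (- l * s) * (H * u s + c s) - exp (- l * s) * (H * w s + c s))"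
      using aw by (subst integral_diff[OF i2 has_integral_integrable[OF 1]]) simp
    also have "(\<lambda>s. exp (- l * s) * (H * u s + c s) - exp (- l * s) * (H * w s + c s)) = (\<lambda>s. H * d s)"
      by (auto simp: d_def algebra_simps)
    finally show "d r \<le> H * integral {0..r} d" by simp
  qed
  then show ?thesis by (simp add: d_def mult_le_0_iff)
qed

text \<open>The Cauchy criterion for the improper integral passes from \<open>h\<close> to
  \<open>f\<close>: integrals over nested intervals differ by two outer pieces, and on each of them
  the integral of \<open>h\<close> dominates.\<close>

lemma integrable_on_halfline_dominated:
  fixes f :: "real \<Rightarrow> 'a::banach"
  assumes cont: "continuous_on {0..} f" and h: "h integrable_on {0..}"
    and bound: "\<And>t. 0 \<le> t \<Longrightarrow> norm (f t) \<le> h t"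
  shows "f integrable_on {0..}"
proof -
  let ?f = "\<lambda>x. if x \<in> {0..} then f x else 0"
  let ?h = "\<lambda>x. if x \<in> {0..} then h x else 0"
  have intf: "?f integrable_on cbox a b" for a b
  proof -
    have "f integrable_on {max 0 a..b}"
      by (intro integrable_continuous_real continuous_on_subset[OF cont]) auto
    moreover have "{0..} \<inter> {a..b} = {max 0 a..b}" by auto
    ultimately have "f integrable_on ({0..} \<inter> {a..b})" by simp
    then show ?thesis by (simp only: integrable_restrict_Int box_real)
  qed
  have inth: "?h integrable_on cbox a b" for a b
    using conjunct1[OF iffD1[OF integrable_alt_subset h]] by simp
  have hf: "norm (?f x) \<le> ?h x" for x using bound[of x] by auto
  show ?thesis
  proof (rule iffD2[OF integrable_alt_subset], intro conjI allI impI intf)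
    fix e :: real assume "e > 0"
    from conjunct2[OF iffD1[OF integrable_alt_subset h], rule_format, OF this]
    obtain B where B: "B > 0" "\<forall>a b c d. ball 0 B \<subseteq> cbox a b \<and> cbox a b \<subseteq> cbox c d \<longrightarrow>
        norm (integral (cbox a b) ?h - integral (cbox c d) ?h) < e"
      by (elim exE conjE) (rule that)
    show "\<exists>B>0. \<forall>a b c d. ball 0 B \<subseteq> cbox a b \<and> cbox a b \<subseteq> cbox c d \<longrightarrow>
        norm (integral (cbox a b) ?f - integral (cbox c d) ?f) < e"
    proof (intro exI[of _ B] conjI B(1) allI impI)
      fix a b c d :: real
      assume sub: "ball 0 B \<subseteq> cbox a b \<and> cbox a b \<subseteq> cbox c d"
      moreover have "0 \<in> ball (0::real) B" using B(1) by simp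
      ultimately have "0 \<in> cbox a b" "cbox a b \<subseteq> cbox c d" by blast+
      then have ord: "c \<le> a" "a \<le> b" "b \<le> d" by auto
      have split: "integral {c..d} g = integral {c..a} g + integral {a..b} g + integral {b..d} g"
        if "\<And>a b. g integrable_on cbox a b" for g :: "real \<Rightarrow> 'c::banach"
      proof -
        have "integral {c..d} g = integral {c..a} g + integral {a..d} g"
          using ord that[of c d] by (intro Henstock_Kurzweil_Integration.integral_combine[symmetric]) auto
        moreover have "integral {a..d} g = integral {a..b} g + integral {b..d} g"
          using ord that[of a d] by (intro Henstock_Kurzweil_Integration.integral_combine[symmetric]) auto
        ultimately show ?thesis by simp
      qed
      have "norm (integral (cbox a b) ?f - integral (cbox c d) ?f)
        = norm (integral (cbox c a) ?f + integral (cbox b d) ?f)"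
        unfolding box_real split[of ?f, OF intf] by (subst norm_minus_commute) (simp add: algebra_simps)
      also have "\<dots> \<le> integral (cbox c a) ?h + integral (cbox b d) ?h"
        by (rule norm_triangle_mono[OF integral_norm_bound_integral[OF intf inth hf] integral_norm_bound_integral[OF intf inth hf]])
      also have "\<dots> \<le> norm (integral (cbox a b) ?h - integral (cbox c d) ?h)"
        unfolding box_real split[of ?h, OF inth] by simp
      also have "\<dots> < e" using B(2)[rule_format, OF sub] .
      finally show "norm (integral (cbox a b) ?f - integral (cbox c d) ?f) < e" .
    qed
  qed
qed

lemma continuous_on_halfline:
  fixes f :: "real \<Rightarrow> 'b::topological_space"
  assumes "\<And>b. 0 \<le> b \<Longrightarrow> continuous_on {0..b} f"
  shows "continuous_on {0..} f"
  unfolding continuous_on_def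
proof
  fix t :: real assume t: "t \<in> {0..}"
  have "(f \<longlongrightarrow> f t) (at t within {0..t + 1})"
    using assms[of "t + 1"] t by (auto simp: continuous_on_def)
  moreover have "at t within {0..} = at t within {0..t + 1}"
    by (rule at_within_nhd[of t "{..<t + 1}"]) auto
  ultimately show "(f \<longlongrightarrow> f t) (at t within {0..})" by simp
qed

section \<open>Strongly continuous semigroups\<close>

lemma generates_onD:
  assumes "generates_on Y D A T"
  shows "C0_semigroup_on Y T" "D \<subseteq> Y"
    "x \<in> D \<Longrightarrow> ((\<lambda>h. (T h x - x) /\<^sub>R h) \<longlongrightarrow> A x) (at_right 0)"
    "x \<in> Y \<Longrightarrow> ((\<lambda>h. (T h x - x) /\<^sub>R h) \<longlongrightarrow> y) (at_right 0) \<Longrightarrow> x \<in> D \<and> A x = y"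
proof -
  have D: "D = {x \<in> Y. \<exists>y. ((\<lambda>h. (T h x - x) /\<^sub>R h) \<longlongrightarrow> y) (at_right 0)}"
    and A: "\<And>x. x \<in> D \<Longrightarrow> ((\<lambda>h. (T h x - x) /\<^sub>R h) \<longlongrightarrow> A x) (at_right 0)"
    using assms by (simp_all add: generates_on_def)
  show "C0_semigroup_on Y T" using assms by (simp add: generates_on_def)
  show "D \<subseteq> Y" using D by blast
  show "((\<lambda>h. (T h x - x) /\<^sub>R h) \<longlongrightarrow> A x) (at_right 0)" if "x \<in> D" using A that .
  assume x: "x \<in> Y" "((\<lambda>h. (T h x - x) /\<^sub>R h) \<longlongrightarrow> y) (at_right 0)"
  then have "x \<in> D" using D by blast
  then show "x \<in> D \<and> A x = y" using tendsto_unique[OF _ A x(2)] by simp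
qed

lemma C0_semigroup_onD:
  assumes "C0_semigroup_on Y T"
  shows "0 \<le> t \<Longrightarrow> linear_op_on Y (T t)"
    and "0 \<le> t \<Longrightarrow> T t ` Y \<subseteq> Y"
    and "0 \<le> t \<Longrightarrow> \<exists>K. \<forall>x\<in>Y. norm (T t x) \<le> K * norm x"
    and "x \<in> Y \<Longrightarrow> T 0 x = x"
    and "0 \<le> s \<Longrightarrow> 0 \<le> t \<Longrightarrow> x \<in> Y \<Longrightarrow> T (s + t) x = T s (T t x)"
    and "x \<in> Y \<Longrightarrow> continuous_on {0..} (\<lambda>t. T t x)"
  using assms by (simp_all add: C0_semigroup_on_def)

text \<open>The subspace is presented as the range of a bounded projection. This makes it closed,
  and it turns each \<open>T t\<close> into the bounded operator
  \<open>\<lambda>x. T t (Pr x)\<close> on the whole space, to which facts on limits and integrals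
  apply.\<close>

locale c0_semigroup =
  fixes Pr :: "'a::banach \<Rightarrow> 'a" and T :: "real \<Rightarrow> 'a \<Rightarrow> 'a"
  assumes Pr: "bounded_linear Pr" and Pr_idem: "\<And>x. Pr (Pr x) = Pr x"
    and C0: "C0_semigroup_on (range Pr) T"
begin

lemma Pr_eq: "x \<in> range Pr \<longleftrightarrow> Pr x = x"
  using Pr_idem by (metis rangeE rangeI)

lemma closed_range: "closed (range Pr)"
proof -
  have "range Pr = {x. Pr x = x}" by (intro set_eqI) (simp only: Pr_eq mem_Collect_eq)
  then show ?thesis
    using closed_Collect_eq[OF linear_continuous_on[OF Pr] continuous_on_id] by (simp only:)
qed

lemma subspace_range: "subspace (range Pr)"
  by (intro linear_subspace_image subspace_UNIV bounded_linear.linear[OF Pr])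

lemma T_in: "0 \<le> t \<Longrightarrow> x \<in> range Pr \<Longrightarrow> T t x \<in> range Pr"
  using C0_semigroup_onD(2)[OF C0] by blast

lemma T_linear: "0 \<le> t \<Longrightarrow> linear_op_on (range Pr) (T t)"
  by (rule C0_semigroup_onD(1)[OF C0])

lemma T_add: "0 \<le> t \<Longrightarrow> x \<in> range Pr \<Longrightarrow> y \<in> range Pr \<Longrightarrow> T t (x + y) = T t x + T t y"
  using T_linear[of t] by (auto simp: linear_op_on_def)

lemma T_scaleR: "0 \<le> t \<Longrightarrow> x \<in> range Pr \<Longrightarrow> T t (c *\<^sub>R x) = c *\<^sub>R T t x"
  using T_linear[of t] by (auto simp: linear_op_on_def)

lemma T_diff: "0 \<le> t \<Longrightarrow> x \<in> range Pr \<Longrightarrow> y \<in> range Pr \<Longrightarrow> T t (x - y) = T t x - T t y"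
  using T_add[of t x "(-1) *\<^sub>R y"] T_scaleR[of t y "-1"] subspace_scale[OF subspace_range, of y "-1"] by simp

lemma T_zero: "0 \<le> t \<Longrightarrow> T t 0 = 0"
  using T_scaleR[of t 0 0] subspace_0[OF subspace_range] by simp

lemmas T_0 = C0_semigroup_onD(4)[OF C0]
  and T_plus = C0_semigroup_onD(5)[OF C0]
  and T_cont = C0_semigroup_onD(6)[OF C0]

lemma bounded_linear_T: "0 \<le> t \<Longrightarrow> bounded_linear (\<lambda>x. T t (Pr x))"
proof -
  assume t: "0 \<le> t"
  obtain K where K: "\<And>x. x \<in> range Pr \<Longrightarrow> norm (T t x) \<le> K * norm x"
    using C0_semigroup_onD(3)[OF C0 t] by blast
  show ?thesis
  proof (rule bounded_linear_intro)
    show "norm (T t (Pr x)) \<le> norm x * (\<bar>K\<bar> * onorm Pr)" for x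
    proof -
      have "norm (T t (Pr x)) \<le> K * norm (Pr x)" using K by blast
      also have "\<dots> \<le> \<bar>K\<bar> * (onorm Pr * norm x)"
        by (intro mult_mono onorm[OF Pr]) auto
      finally show ?thesis by (simp add: algebra_simps)
    qed
  qed (use t in \<open>simp_all add: T_add T_scaleR bounded_linear.linear[OF Pr] linear_add linear_scale\<close>)
qed

lemma tendsto_T_fixed:
  assumes t: "0 \<le> t" and q: "(q \<longlongrightarrow> q0) F" "\<forall>\<^sub>F k in F. q k \<in> range Pr" "q0 \<in> range Pr"
  shows "((\<lambda>k. T t (q k)) \<longlongrightarrow> T t q0) F"
proof -
  have "((\<lambda>k. T t (Pr (q k))) \<longlongrightarrow> T t (Pr q0)) F"
    by (rule bounded_linear.tendsto[OF bounded_linear_T[OF t] q(1)])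
  moreover have "\<forall>\<^sub>F k in F. T t (Pr (q k)) = T t (q k)"
    using q(2) by eventually_elim (simp add: Pr_eq)
  ultimately show ?thesis using q(3) by (simp add: Pr_eq Lim_transform_eventually)
qed

text \<open>\<open>Pr\<close> commutes with the integral and fixes the integrand, hence it fixes the
  value.\<close>

lemma integral_in_range:
  assumes f: "(f has_integral I) A" and fY: "\<And>x. x \<in> A \<Longrightarrow> f x \<in> range Pr"
  shows "I \<in> range Pr"
proof -
  have "((\<lambda>x. Pr (f x)) has_integral Pr I) A"
    using has_integral_linear[OF f Pr] by (simp add: o_def)
  then have "(f has_integral Pr I) A"
    using fY Pr_eq by (intro has_integral_eq[of A "\<lambda>x. Pr (f x)" f]) simp_all
  then have "Pr I = I" using f by (rule has_integral_unique)
  then show ?thesis by (simp only: Pr_eq)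
qed

lemma generator_in:
  assumes gen: "generates_on (range Pr) D A T" and x: "x \<in> D"
  shows "A x \<in> range Pr"
proof (rule Lim_in_closed_set[OF closed_range _ _ generates_onD(3)[OF gen x]])
  have xY: "x \<in> range Pr" using generates_onD(2)[OF gen] x by blast
  show "\<forall>\<^sub>F h in at_right 0. (T h x - x) /\<^sub>R h \<in> range Pr"
    using eventually_at_right_less[of 0]
    by eventually_elim (intro subspace_scale[OF subspace_range] subspace_diff[OF subspace_range] T_in xY; simp)
qed simp

text \<open>\<open>T s\<close> commutes with \<open>T h\<close>, so it maps the difference quotients
  of \<open>x\<close> to those of \<open>T s x\<close>; by continuity it maps their limit as
  well.\<close>

lemma generator_orbit:
  assumes gen: "generates_on (range Pr) D A T" and x: "x \<in> D" and s: "0 \<le> s"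
  shows "T s x \<in> D \<and> A (T s x) = T s (A x)"
proof -
  have xY: "x \<in> range Pr" using generates_onD(2)[OF gen] x by blast
  have ev: "\<forall>\<^sub>F h in at_right 0. (T h x - x) /\<^sub>R h \<in> range Pr"
    using eventually_at_right_less[of 0]
    by eventually_elim (intro subspace_scale[OF subspace_range] subspace_diff[OF subspace_range] T_in xY; simp)
  have "((\<lambda>h. T s ((T h x - x) /\<^sub>R h)) \<longlongrightarrow> T s (A x)) (at_right 0)"
    by (rule tendsto_T_fixed[OF s generates_onD(3)[OF gen x] ev generator_in[OF gen x]])
  then have "((\<lambda>h. (T h (T s x) - T s x) /\<^sub>R h) \<longlongrightarrow> T s (A x)) (at_right 0)"
  proof (rule Lim_transform_eventually)
    show "\<forall>\<^sub>F h in at_right 0. T s ((T h x - x) /\<^sub>R h) = (T h (T s x) - T s x) /\<^sub>R h"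
      using eventually_at_right_less[of 0]
    proof eventually_elim
      fix h :: real assume h: "0 < h"
      have "T s (T h x) = T h (T s x)"
        using T_plus[of s h x] T_plus[of h s x] s h xY by (simp add: add.commute)
      then show "T s ((T h x - x) /\<^sub>R h) = (T h (T s x) - T s x) /\<^sub>R h"
        using s h xY by (simp add: T_scaleR T_diff T_in subspace_diff[OF subspace_range])
    qed
  qed
  then show ?thesis using generates_onD(4)[OF gen] T_in[OF s xY] by blast
qed

end

section \<open>Uniformly bounded semigroups and Duhamel's principle\<close>

locale bounded_semigroup = c0_semigroup +
  fixes M :: real
  assumes M: "0 \<le> M"
    and T_bound: "\<And>t x. 0 \<le> t \<Longrightarrow> x \<in> range Pr \<Longrightarrow> norm (T t x) \<le> M * norm x"
begin

text \<open>Joint continuity in time and vector: the uniform bound controls the change of the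
  vector, strong continuity at the fixed vector \<open>q0\<close> controls the change of
  time.\<close>

lemma tendsto_T:
  assumes \<theta>: "(\<theta> \<longlongrightarrow> \<theta>0) F" "\<forall>\<^sub>F k in F. 0 \<le> \<theta> k" "0 \<le> \<theta>0"
    and q: "(q \<longlongrightarrow> q0) F" "\<forall>\<^sub>F k in F. q k \<in> range Pr" "q0 \<in> range Pr"
  shows "((\<lambda>k. T (\<theta> k) (q k)) \<longlongrightarrow> T \<theta>0 q0) F"
proof -
  have lim: "((\<lambda>k. T (\<theta> k) q0) \<longlongrightarrow> T \<theta>0 q0) F"
    using continuous_on_tendsto_compose[OF T_cont[OF q(3)] \<theta>(1)] \<theta>(2,3) by simp
  have "((\<lambda>k. T (\<theta> k) (q k) - T (\<theta> k) q0) \<longlongrightarrow> 0) F"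
  proof (rule Lim_null_comparison)
    show "((\<lambda>k. M * norm (q k - q0)) \<longlongrightarrow> 0) F"
      using q(1) by (intro tendsto_mult_right_zero tendsto_norm_zero) (simp add: LIM_zero_iff)
    show "\<forall>\<^sub>F k in F. norm (T (\<theta> k) (q k) - T (\<theta> k) q0) \<le> M * norm (q k - q0)"
      using \<theta>(2) q(2)
      by eventually_elim (simp add: T_diff[symmetric] q(3) T_bound subspace_diff[OF subspace_range])
  qed
  from tendsto_add[OF this lim] show ?thesis by simp
qed

lemma continuous_on_T:
  assumes "continuous_on S \<theta>" "continuous_on S q" "\<And>s. s \<in> S \<Longrightarrow> 0 \<le> \<theta> s" "\<And>s. s \<in> S \<Longrightarrow> q s \<in> range Pr"
  shows "continuous_on S (\<lambda>s. T (\<theta> s) (q s))"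
  unfolding continuous_on_def
proof
  fix s assume s: "s \<in> S"
  show "((\<lambda>s. T (\<theta> s) (q s)) \<longlongrightarrow> T (\<theta> s) (q s)) (at s within S)"
    using assms s by (intro tendsto_T) (auto simp: continuous_on_def eventually_at_filter)
qed

lemma duhamel:
  assumes t: "0 \<le> t" and cw: "continuous_on {0..t} w" and cp: "continuous_on {0..t} p"
    and wY: "\<And>s. 0 \<le> s \<Longrightarrow> s \<le> t \<Longrightarrow> w s \<in> range Pr"
    and pY: "\<And>s. 0 \<le> s \<Longrightarrow> s \<le> t \<Longrightarrow> p s \<in> range Pr"
    and lim: "\<And>s. 0 \<le> s \<Longrightarrow> s < t \<Longrightarrow> ((\<lambda>k. (w (s + k) - T k (w s)) /\<^sub>R k) \<longlongrightarrow> p s) (at_right 0)"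
  shows "((\<lambda>s. T (t - s) (p s)) has_integral w t - T t (w 0)) {0..t}"
proof -
  have "((\<lambda>s. T (t - s) (p s)) has_integral T (t - t) (w t) - T (t - 0) (w 0)) {0..t}"
  proof (rule fundamental_theorem_of_calculus_right[OF t])
    show "continuous_on {0..t} (\<lambda>s. T (t - s) (w s))"
      using wY by (intro continuous_on_T cw continuous_intros) auto
    show "continuous_on {0..t} (\<lambda>s. T (t - s) (p s))"
      using pY by (intro continuous_on_T cp continuous_intros) auto
    fix s assume s: "0 \<le> s" "s < t"
    have small: "\<forall>\<^sub>F k in at_right 0. 0 < k \<and> k < t - s"
      using s by (auto simp: eventually_at_right_field intro!: exI[of _ "t - s"])
    \<comment> \<open>For \<open>0 < k < t - s\<close> the semigroup law gives
      \<open>T (t - s) = T (t - s - k) T k\<close>. So \<open>T (t - s - k)\<close> factors out of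
      the increment of \<open>T (t - s) (w s)\<close> and leaves the quotient of the hypothesis;
      \<open>w s\<close> need not lie in the domain of the generator.\<close>
    have "((\<lambda>k. T (t - s - k) ((w (s + k) - T k (w s)) /\<^sub>R k)) \<longlongrightarrow> T (t - s) (p s)) (at_right 0)"
    proof (rule tendsto_T[OF _ _ _ lim[OF s]])
      show "((\<lambda>k. t - s - k) \<longlongrightarrow> t - s) (at_right 0)"
        by (rule tendsto_eq_intros refl | simp)+
      show "\<forall>\<^sub>F k in at_right 0. 0 \<le> t - s - k" using small by eventually_elim auto
      show "\<forall>\<^sub>F k in at_right 0. (w (s + k) - T k (w s)) /\<^sub>R k \<in> range Pr"
        using small
        by eventually_elim (use s in \<open>intro subspace_scale[OF subspace_range] subspace_diff[OF subspace_range] T_in wY; simp\<close>)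
    qed (use s pY in auto)
    then show "((\<lambda>k. (T (t - (s + k)) (w (s + k)) - T (t - s) (w s)) /\<^sub>R k) \<longlongrightarrow> T (t - s) (p s)) (at_right 0)"
    proof (rule Lim_transform_eventually)
      show "\<forall>\<^sub>F k in at_right 0. T (t - s - k) ((w (s + k) - T k (w s)) /\<^sub>R k)
          = (T (t - (s + k)) (w (s + k)) - T (t - s) (w s)) /\<^sub>R k"
        using small
      proof eventually_elim
        fix k assume k: "0 < k \<and> k < t - s"
        have in': "w s \<in> range Pr" "w (s + k) \<in> range Pr" "T k (w s) \<in> range Pr"
          using wY s k T_in by auto
        have "T (t - s) (w s) = T (t - s - k) (T k (w s))"
          using T_plus[of "t - s - k" k "w s"] k in' by simp
        then show "T (t - s - k) ((w (s + k) - T k (w s)) /\<^sub>R k)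
          = (T (t - (s + k)) (w (s + k)) - T (t - s) (w s)) /\<^sub>R k"
          using k in' subspace_diff[OF subspace_range in'(2,3)]
          by (simp add: T_scaleR T_diff diff_diff_eq)
      qed
    qed
  qed
  then show ?thesis using T_0 wY t by simp
qed

lemma T_integrable:
  assumes k: "0 \<le> k" and cq: "continuous_on {0..k} q" and q: "\<And>s. 0 \<le> s \<Longrightarrow> s \<le> k \<Longrightarrow> q s \<in> range Pr"
  shows "(\<lambda>s. T (k - s) (q s)) integrable_on {0..k}"
  using q by (intro integrable_continuous_real continuous_on_T cq continuous_intros) auto

text \<open>For small \<open>k\<close> the integrand is uniformly close to \<open>q 0\<close> on the
  whole interval: the variation of \<open>q\<close> and the effect of the semigroup on
  \<open>q 0\<close> each contribute at most \<open>e / 4\<close>. Its mean value is then equally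
  close.\<close>

lemma average_tendsto:
  assumes d: "0 < d" and cq: "continuous_on {0..d} q" and q: "\<And>s. 0 \<le> s \<Longrightarrow> s \<le> d \<Longrightarrow> q s \<in> range Pr"
  shows "((\<lambda>k. integral {0..k} (\<lambda>s. T (k - s) (q s)) /\<^sub>R k) \<longlongrightarrow> q 0) (at_right 0)"
proof (rule tendstoI)
  fix e :: real assume e: "e > 0"
  have q0: "q 0 \<in> range Pr" using q d by simp
  have "((\<lambda>s. M * norm (q s - q 0)) \<longlongrightarrow> M * norm (q 0 - q 0)) (at 0 within {0..d})"
    using cq d by (intro tendsto_intros) (auto simp: continuous_on_def)
  then have "\<forall>\<^sub>F s in at 0 within {0..d}. dist (M * norm (q s - q 0)) (M * norm (q 0 - q 0)) < e / 4"
    by (rule tendstoD) (use e in simp)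
  then obtain d1 where d1: "d1 > 0" "\<And>s. s \<in> {0..d} \<Longrightarrow> s \<noteq> 0 \<Longrightarrow> dist s 0 < d1 \<Longrightarrow> M * norm (q s - q 0) < e / 4"
    using M unfolding eventually_at by (auto simp: dist_real_def)
  have "((\<lambda>s. T s (q 0)) \<longlongrightarrow> T 0 (q 0)) (at 0 within {0..})"
    using T_cont[OF q0] by (auto simp: continuous_on_def)
  then have "\<forall>\<^sub>F s in at 0 within {0..}. dist (T s (q 0)) (T 0 (q 0)) < e / 4"
    by (rule tendstoD) (use e in simp)
  then obtain d2 where d2: "d2 > 0" "\<And>s. s \<in> {0..} \<Longrightarrow> s \<noteq> 0 \<Longrightarrow> dist s 0 < d2 \<Longrightarrow> norm (T s (q 0) - q 0) < e / 4"
    using T_0[OF q0] unfolding eventually_at by (auto simp: dist_norm)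
  define d3 where "d3 = min d (min d1 d2)"
  have est: "norm (T (k - s) (q s) - q 0) \<le> e / 2" if "0 \<le> s" "s \<le> k" "k < d3" for s k
  proof -
    have "norm (T (k - s) (q s - q 0)) \<le> M * norm (q s - q 0)"
      using that q q0 by (intro T_bound subspace_diff[OF subspace_range]) (auto simp: d3_def)
    also have "\<dots> \<le> e / 4"
      using d1(2)[of s] that e by (cases "s = 0") (auto simp: d3_def)
    finally have "norm (T (k - s) (q s - q 0)) \<le> e / 4" .
    moreover have "norm (T (k - s) (q 0) - q 0) \<le> e / 4"
      using d2(2)[of "k - s"] that e T_0[OF q0] by (cases "s = k") (auto simp: d3_def)
    moreover have "T (k - s) (q s) - q 0 = T (k - s) (q s - q 0) + (T (k - s) (q 0) - q 0)"
      using that q q0 by (subst T_diff) (auto simp: d3_def)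
    ultimately show ?thesis
      using norm_triangle_mono[of "T (k - s) (q s - q 0)" "e / 4" "T (k - s) (q 0) - q 0" "e / 4"]
      by (simp only:) simp
  qed
  have "\<forall>\<^sub>F k in at_right 0. 0 < k \<and> k < d3"
    using d d1 d2 by (auto simp: d3_def eventually_at_right_field intro!: exI[of _ d3])
  then show "\<forall>\<^sub>F k in at_right 0. dist (integral {0..k} (\<lambda>s. T (k - s) (q s)) /\<^sub>R k) (q 0) < e"
  proof eventually_elim
    fix k assume k: "0 < k \<and> k < d3"
    then have kd: "k \<le> d" by (simp add: d3_def)
    have int: "(\<lambda>s. T (k - s) (q s)) integrable_on {0..k}"
      using k kd q by (intro T_integrable continuous_on_subset[OF cq]) auto
    have "((\<lambda>s. T (k - s) (q s) - q 0) has_integral integral {0..k} (\<lambda>s. T (k - s) (q s)) - k *\<^sub>R q 0) (cbox 0 k)"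
      using k has_integral_diff[OF integrable_integral[OF int] has_integral_const_real[of "q 0" 0 k]] by simp
    from has_integral_bound[OF _ this, of "e / 2"]
    have "norm (integral {0..k} (\<lambda>s. T (k - s) (q s)) - k *\<^sub>R q 0) \<le> e / 2 * k"
      using est e k by auto
    also have "\<dots> < e * k" using e k by simp
    finally have "norm ((integral {0..k} (\<lambda>s. T (k - s) (q s)) - k *\<^sub>R q 0) /\<^sub>R k) < e"
      using k by (simp add: divide_inverse[symmetric] pos_divide_less_eq mult.commute[of "inverse k"])
    moreover have "(integral {0..k} (\<lambda>s. T (k - s) (q s)) - k *\<^sub>R q 0) /\<^sub>R k
        = integral {0..k} (\<lambda>s. T (k - s) (q s)) /\<^sub>R k - q 0"
      using k by (simp add: scaleR_diff_right)
    ultimately show "dist (integral {0..k} (\<lambda>s. T (k - s) (q s)) /\<^sub>R k) (q 0) < e"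
      by (simp add: dist_norm)
  qed
qed

text \<open>A mild solution can be restarted at time \<open>s\<close>:
  \<open>u (s + k) - T k (u s)\<close> is the integral of
  \<open>T (s + k - \<sigma>) (f \<sigma>)\<close> over the last piece of length \<open>k\<close>.
  Divided by \<open>k\<close>, it is an average of the kind treated in
  \<open>average_tendsto\<close>.\<close>

lemma mild_quotient:
  assumes cf: "continuous_on {0..b} f" and fY: "\<And>s. 0 \<le> s \<Longrightarrow> s \<le> b \<Longrightarrow> f s \<in> range Pr"
    and u: "\<And>t. 0 \<le> t \<Longrightarrow> t \<le> b \<Longrightarrow> ((\<lambda>s. T (t - s) (f s)) has_integral u t - T t u0) {0..t}"
    and u0: "u0 \<in> range Pr" and s: "0 \<le> s" "s < b"
  shows "((\<lambda>k. (u (s + k) - T k (u s)) /\<^sub>R k) \<longlongrightarrow> f s) (at_right 0)"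
proof -
  have "((\<lambda>k. integral {0..k} (\<lambda>\<sigma>. T (k - \<sigma>) (f (s + \<sigma>))) /\<^sub>R k) \<longlongrightarrow> f (s + 0)) (at_right 0)"
    using s fY by (intro average_tendsto[of "b - s"] continuous_on_compose2[OF cf] continuous_intros) auto
  then have lim: "((\<lambda>k. integral {0..k} (\<lambda>\<sigma>. T (k - \<sigma>) (f (s + \<sigma>))) /\<^sub>R k) \<longlongrightarrow> f s) (at_right 0)"
    by simp
  have small: "\<forall>\<^sub>F k in at_right 0. 0 < k \<and> k < b - s"
    using s by (auto simp: eventually_at_right_field intro!: exI[of _ "b - s"])
  show ?thesis
  proof (rule Lim_transform_eventually[OF lim])
    show "\<forall>\<^sub>F k in at_right 0. integral {0..k} (\<lambda>\<sigma>. T (k - \<sigma>) (f (s + \<sigma>))) /\<^sub>R k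
        = (u (s + k) - T k (u s)) /\<^sub>R k"
      using small
    proof eventually_elim
      fix k assume k: "0 < k \<and> k < b - s"
      have us: "((\<lambda>\<sigma>. T (s - \<sigma>) (f \<sigma>)) has_integral u s - T s u0) {0..s}" using u s by simp
      have usk: "((\<lambda>\<sigma>. T (s + k - \<sigma>) (f \<sigma>)) has_integral u (s + k) - T (s + k) u0) {0..s + k}"
        using u[of "s + k"] s k by simp
      have "((\<lambda>\<sigma>. T k (Pr (T (s - \<sigma>) (f \<sigma>)))) has_integral T k (Pr (u s - T s u0))) {0..s}"
        using has_integral_linear[OF us bounded_linear_T[of k]] k by (simp add: o_def)
      moreover have "T k (Pr (T (s - \<sigma>) (f \<sigma>))) = T (s + k - \<sigma>) (f \<sigma>)" if "\<sigma> \<in> {0..s}" for \<sigma>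
      proof -
        have "f \<sigma> \<in> range Pr" using fY that s by auto
        then have "Pr (T (s - \<sigma>) (f \<sigma>)) = T (s - \<sigma>) (f \<sigma>)" using T_in that by (simp flip: Pr_eq)
        moreover have "T (k + (s - \<sigma>)) (f \<sigma>) = T k (T (s - \<sigma>) (f \<sigma>))"
          using T_plus[of k "s - \<sigma>"] that k \<open>f \<sigma> \<in> range Pr\<close> by simp
        ultimately show ?thesis by (simp add: algebra_simps)
      qed
      ultimately have 1: "((\<lambda>\<sigma>. T (s + k - \<sigma>) (f \<sigma>)) has_integral T k (Pr (u s - T s u0))) {0..s}"
        by (rule has_integral_eq[rotated])
      have uY: "u s - T s u0 \<in> range Pr"
        by (rule integral_in_range[OF us]) (use T_in fY s in auto)
      have "T s u0 \<in> range Pr" using T_in s u0 by simp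
      then have "T k (u s) = T k (u s - T s u0) + T k (T s u0)"
        using T_add[of k "u s - T s u0" "T s u0"] uY k by simp
      then have Tk: "T k (Pr (u s - T s u0)) = T k (u s) - T (s + k) u0"
        using uY T_plus[of k s u0] k s u0 by (simp add: Pr_eq add.commute)
      have int: "(\<lambda>\<sigma>. T (s + k - \<sigma>) (f \<sigma>)) integrable_on {0..s + k}" using usk by blast
      have "integral {0..s} (\<lambda>\<sigma>. T (s + k - \<sigma>) (f \<sigma>)) + integral {s..s + k} (\<lambda>\<sigma>. T (s + k - \<sigma>) (f \<sigma>))
          = integral {0..s + k} (\<lambda>\<sigma>. T (s + k - \<sigma>) (f \<sigma>))"
        using s k int by (intro Henstock_Kurzweil_Integration.integral_combine) auto
      then have "(T k (u s) - T (s + k) u0) + integral {s..s + k} (\<lambda>\<sigma>. T (s + k - \<sigma>) (f \<sigma>))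
          = u (s + k) - T (s + k) u0"
        by (simp only: integral_unique[OF 1] integral_unique[OF usk] Tk)
      then have "integral {s..s + k} (\<lambda>\<sigma>. T (s + k - \<sigma>) (f \<sigma>))
          = (u (s + k) - T (s + k) u0) - (T k (u s) - T (s + k) u0)"
        by (simp only: eq_diff_eq add.commute)
      then have "integral {s..s + k} (\<lambda>\<sigma>. T (s + k - \<sigma>) (f \<sigma>)) = u (s + k) - T k (u s)"
        by simp
      moreover have "integral {s..s + k} (\<lambda>\<sigma>. T (s + k - \<sigma>) (f \<sigma>)) = integral {0..k} (\<lambda>\<sigma>. T (k - \<sigma>) (f (s + \<sigma>)))"
      proof -
        have "integral {s - s..s + k - s} (\<lambda>\<sigma>. T (s + k - (\<sigma> + s)) (f (\<sigma> + s))) = integral {s..s + k} (\<lambda>\<sigma>. T (s + k - \<sigma>) (f \<sigma>))"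
          by (rule integral_shift_real_ivl)
        then show ?thesis by (simp add: algebra_simps)
      qed
      ultimately show "integral {0..k} (\<lambda>\<sigma>. T (k - \<sigma>) (f (s + \<sigma>))) /\<^sub>R k = (u (s + k) - T k (u s)) /\<^sub>R k"
        by simp
    qed
  qed
qed

end

text \<open>On the domain, both semigroups have the same right derivative \<open>A\<close> along an
  orbit of \<open>T'\<close>, so Duhamel's principle holds with zero forcing and the orbits agree.
  Density and boundedness extend this to the whole space.\<close>

lemma (in bounded_semigroup) generated_semigroup_unique:
  assumes gen: "generates_on (range Pr) D A T" and gen': "generates_on (range Pr) D A T'"
    and dense: "range Pr \<subseteq> closure D" and t: "0 \<le> t" and x: "x \<in> range Pr"
  shows "T' t x = T t x"
proof -
  interpret T': c0_semigroup Pr T'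
    by (intro c0_semigroup.intro Pr Pr_idem generates_onD(1)[OF gen'])
  have onD: "T' t y = T t y" if y: "y \<in> D" for y
  proof -
    have yY: "y \<in> range Pr" using generates_onD(2)[OF gen] y by blast
    have "((\<lambda>s. T (t - s) 0) has_integral T' t y - T t (T' 0 y)) {0..t}"
    proof (rule duhamel[OF t])
      show "continuous_on {0..t} (\<lambda>s. T' s y)"
        by (rule continuous_on_subset[OF T'.T_cont[OF yY]]) auto
      fix s assume s: "0 \<le> s" "s < t"
      have w: "T' s y \<in> D" using T'.generator_orbit[OF gen' y s(1)] by simp
      have "((\<lambda>k. (T' k (T' s y) - T' s y) /\<^sub>R k - (T k (T' s y) - T' s y) /\<^sub>R k) \<longlongrightarrow> A (T' s y) - A (T' s y)) (at_right 0)"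
        by (rule tendsto_diff[OF generates_onD(3)[OF gen' w] generates_onD(3)[OF gen w]])
      then have lim: "((\<lambda>k. (T' k (T' s y) - T' s y) /\<^sub>R k - (T k (T' s y) - T' s y) /\<^sub>R k) \<longlongrightarrow> 0) (at_right 0)"
        by simp
      show "((\<lambda>k. (T' (s + k) y - T k (T' s y)) /\<^sub>R k) \<longlongrightarrow> 0) (at_right 0)"
      proof (rule Lim_transform_eventually[OF lim])
        show "\<forall>\<^sub>F k in at_right 0. (T' k (T' s y) - T' s y) /\<^sub>R k - (T k (T' s y) - T' s y) /\<^sub>R k
            = (T' (s + k) y - T k (T' s y)) /\<^sub>R k"
          using eventually_at_right_less[of 0]
          by eventually_elim
            (use T'.T_plus[OF _ s(1) yY] in \<open>simp add: add.commute[of s] flip: scaleR_diff_right\<close>)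
      qed
    qed (use T'.T_in yY subspace_0[OF subspace_range] in auto)
    moreover have "((\<lambda>s. T (t - s) 0) has_integral 0) {0..t}"
      by (rule has_integral_is_0) (simp add: T_zero)
    ultimately have "T' t y - T t (T' 0 y) = 0" by (rule has_integral_unique)
    then show ?thesis using T'.T_0[OF yY] by simp
  qed
  have "closed {y. T' t (Pr y) = T t (Pr y)}"
    by (intro closed_Collect_eq linear_continuous_on T'.bounded_linear_T bounded_linear_T t)
  moreover have "D \<subseteq> {y. T' t (Pr y) = T t (Pr y)}"
  proof
    fix y assume y: "y \<in> D"
    then have "Pr y = y" using generates_onD(2)[OF gen] Pr_eq by blast
    then show "y \<in> {y. T' t (Pr y) = T t (Pr y)}" using onD[OF y] by simp
  qed
  ultimately have "closure D \<subseteq> {y. T' t (Pr y) = T t (Pr y)}" by (intro closure_minimal)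
  then have "x \<in> {y. T' t (Pr y) = T t (Pr y)}" using x dense by blast
  then show ?thesis using Pr_eq[of x] x by simp
qed

section \<open>Bounded perturbation of a generator\<close>

locale perturbed_semigroup =
  T: bounded_semigroup Pr T M + S: bounded_semigroup Pr S K for Pr :: "'a::banach \<Rightarrow> 'a" and T M S K +
  fixes D :: "'a set" and A B :: "'a \<Rightarrow> 'a"
  assumes gen_T: "generates_on (range Pr) D A T"
    and gen_S: "generates_on (range Pr) D (\<lambda>x. A x + B x) S"
    and dense: "range Pr \<subseteq> closure D"
    and B: "bounded_linear B" and B_in: "\<And>x. B x \<in> range Pr"
begin

lemma continuous_on_BS: "v \<in> range Pr \<Longrightarrow> continuous_on {0..t} (\<lambda>s. B (S s v))"
  by (intro bounded_linear.continuous_on[OF B] continuous_on_subset[OF S.T_cont]) auto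

text \<open>Along an orbit of \<open>S\<close> inside the common domain, the quotients of
  \<open>S\<close> and of \<open>T\<close> tend to \<open>A + B\<close> and to \<open>A\<close>.
  Their difference \<open>B\<close> is the forcing in Duhamel's principle for
  \<open>T\<close>.\<close>

lemma perturbation_on_domain:
  assumes y: "y \<in> D" and t: "0 \<le> t"
  shows "((\<lambda>s. T (t - s) (B (S s y))) has_integral S t y - T t y) {0..t}"
proof -
  have yY: "y \<in> range Pr" using generates_onD(2)[OF gen_T] y by blast
  have "((\<lambda>s. T (t - s) (B (S s y))) has_integral S t y - T t (S 0 y)) {0..t}"
  proof (rule T.duhamel[OF t])
    show "continuous_on {0..t} (\<lambda>s. S s y)"
      by (rule continuous_on_subset[OF S.T_cont[OF yY]]) auto
    show "continuous_on {0..t} (\<lambda>s. B (S s y))" by (rule continuous_on_BS[OF yY])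
    fix s assume s: "0 \<le> s" "s < t"
    have w: "S s y \<in> D" using S.generator_orbit[OF gen_S y s(1)] by simp
    have lim: "((\<lambda>k. (S k (S s y) - S s y) /\<^sub>R k - (T k (S s y) - S s y) /\<^sub>R k) \<longlongrightarrow> B (S s y)) (at_right 0)"
      using tendsto_diff[OF generates_onD(3)[OF gen_S w] generates_onD(3)[OF gen_T w]] by simp
    show "((\<lambda>k. (S (s + k) y - T k (S s y)) /\<^sub>R k) \<longlongrightarrow> B (S s y)) (at_right 0)"
    proof (rule Lim_transform_eventually[OF lim])
      show "\<forall>\<^sub>F k in at_right 0. (S k (S s y) - S s y) /\<^sub>R k - (T k (S s y) - S s y) /\<^sub>R k
          = (S (s + k) y - T k (S s y)) /\<^sub>R k"
        using eventually_at_right_less[of 0]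
        by eventually_elim
          (use S.T_plus[OF _ s(1) yY] in \<open>simp add: add.commute[of s] flip: scaleR_diff_right\<close>)
    qed
  qed (use S.T_in yY B_in in auto)
  then show ?thesis using S.T_0[OF yY] by simp
qed

text \<open>Both sides are bounded linear in the initial vector and agree on a dense
  subspace.\<close>

lemma perturbation:
  assumes v: "v \<in> range Pr" and t: "0 \<le> t"
  shows "((\<lambda>s. T (t - s) (B (S s v))) has_integral S t v - T t v) {0..t}"
proof -
  define J where "J y = integral {0..t} (\<lambda>s. T (t - s) (B (S s (Pr y))))" for y
  have int: "(\<lambda>s. T (t - s) (B (S s (Pr y)))) integrable_on {0..t}" for y
    by (rule T.T_integrable[OF t continuous_on_BS]) (auto simp: B_in)
  note lin = bounded_linear.linear[OF T.Pr] bounded_linear.linear[OF B]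
  have J: "bounded_linear J"
  proof (rule bounded_linear_intro)
    fix x y :: 'a and r :: real
    have "J (x + y) = integral {0..t} (\<lambda>s. T (t - s) (B (S s (Pr x))) + T (t - s) (B (S s (Pr y))))"
      unfolding J_def using lin by (intro integral_cong) (simp add: linear_add S.T_add T.T_add B_in)
    then show "J (x + y) = J x + J y" by (simp add: J_def integral_add[OF int int])
    have "J (r *\<^sub>R x) = integral {0..t} (\<lambda>s. r *\<^sub>R T (t - s) (B (S s (Pr x))))"
      unfolding J_def using lin by (intro integral_cong) (simp add: linear_scale S.T_scaleR T.T_scaleR B_in)
    then show "J (r *\<^sub>R x) = r *\<^sub>R J x" by (simp add: J_def)
    have "norm (J x) \<le> (M * onorm B * K * onorm Pr * norm x) * (t - 0)"
      unfolding J_def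
    proof (rule integral_bound[OF t])
      show "continuous_on {0..t} (\<lambda>s. T (t - s) (B (S s (Pr x))))"
        by (intro T.continuous_on_T continuous_on_BS continuous_intros) (auto simp: B_in)
      fix s assume s: "s \<in> {0..t}"
      have "norm (T (t - s) (B (S s (Pr x)))) \<le> M * norm (B (S s (Pr x)))"
        using s B_in by (intro T.T_bound) auto
      also have "\<dots> \<le> M * (onorm B * norm (S s (Pr x)))"
        by (intro mult_left_mono onorm B T.M)
      also have "\<dots> \<le> M * (onorm B * (K * norm (Pr x)))"
        using s by (intro mult_left_mono S.T_bound T.M onorm_pos_le B) auto
      also have "\<dots> \<le> M * (onorm B * (K * (onorm Pr * norm x)))"
        by (intro mult_left_mono onorm T.Pr T.M S.M onorm_pos_le B)
      finally show "norm (T (t - s) (B (S s (Pr x)))) \<le> M * onorm B * K * onorm Pr * norm x"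
        by (simp add: mult.assoc)
    qed
    then show "norm (J x) \<le> norm x * (M * onorm B * K * onorm Pr * t)"
      by (simp add: mult_ac)
  qed
  have "closed {y. S t (Pr y) - T t (Pr y) = J y}"
    by (intro closed_Collect_eq linear_continuous_on bounded_linear_sub S.bounded_linear_T T.bounded_linear_T t J)
  moreover have "D \<subseteq> {y. S t (Pr y) - T t (Pr y) = J y}"
  proof
    fix y assume y: "y \<in> D"
    then have "Pr y = y" using generates_onD(2)[OF gen_T] T.Pr_eq by blast
    then show "y \<in> {y. S t (Pr y) - T t (Pr y) = J y}"
      using integral_unique[OF perturbation_on_domain[OF y t]] by (simp add: J_def)
  qed
  ultimately have "closure D \<subseteq> {y. S t (Pr y) - T t (Pr y) = J y}" by (intro closure_minimal)
  then have "v \<in> {y. S t (Pr y) - T t (Pr y) = J y}" using v dense by blast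
  then have "S t v - T t v = J v" using T.Pr_eq[of v] v by simp
  then show ?thesis using int[of v] v T.Pr_eq[of v] by (simp add: J_def integrable_integral)
qed

text \<open>\<open>S\<close> and \<open>T\<close> separately need not be differentiable at
  \<open>v\<close>, but their difference is an integral with integrand tending to
  \<open>B v\<close>. This makes the two semigroups comparable at the values of a mild solution,
  which may lie outside the domain.\<close>

lemma quotient_tendsto:
  assumes v: "v \<in> range Pr"
  shows "((\<lambda>k. (S k v - T k v) /\<^sub>R k) \<longlongrightarrow> B v) (at_right 0)"
proof -
  have "((\<lambda>k. integral {0..k} (\<lambda>s. T (k - s) (B (S s v))) /\<^sub>R k) \<longlongrightarrow> B (S 0 v)) (at_right 0)"
    by (rule T.average_tendsto[of 1]) (auto simp: B_in continuous_on_BS[OF v])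
  then have lim: "((\<lambda>k. integral {0..k} (\<lambda>s. T (k - s) (B (S s v))) /\<^sub>R k) \<longlongrightarrow> B v) (at_right 0)"
    by (simp add: S.T_0[OF v])
  show ?thesis
  proof (rule Lim_transform_eventually[OF lim])
    show "\<forall>\<^sub>F k in at_right 0. integral {0..k} (\<lambda>s. T (k - s) (B (S s v))) /\<^sub>R k = (S k v - T k v) /\<^sub>R k"
      using eventually_at_right_less[of 0]
      by eventually_elim (simp add: integral_unique[OF perturbation[OF v]])
  qed
qed

text \<open>The linear part of the forcing moves into the semigroup: relative to \<open>T\<close>
  the quotient of \<open>u\<close> tends to \<open>B (u s) + g s\<close>, and replacing
  \<open>T k\<close> by \<open>S k\<close> subtracts \<open>B (u s)\<close> in the limit. Duhamel's
  principle for \<open>S\<close> then has forcing \<open>g\<close>.\<close>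

lemma mild_solution_perturbed:
  assumes cu: "continuous_on {0..b} u" and cg: "continuous_on {0..b} g"
    and uY: "\<And>s. 0 \<le> s \<Longrightarrow> s \<le> b \<Longrightarrow> u s \<in> range Pr"
    and gY: "\<And>s. 0 \<le> s \<Longrightarrow> s \<le> b \<Longrightarrow> g s \<in> range Pr"
    and u: "\<And>t. 0 \<le> t \<Longrightarrow> t \<le> b \<Longrightarrow> ((\<lambda>s. T (t - s) (B (u s) + g s)) has_integral u t - T t u0) {0..t}"
    and u0: "u0 \<in> range Pr" and t: "0 \<le> t" "t \<le> b"
  shows "((\<lambda>s. S (t - s) (g s)) has_integral u t - S t (u 0)) {0..t}"
proof (rule S.duhamel[OF t(1)])
  show "continuous_on {0..t} u" "continuous_on {0..t} g"
    using t by (auto intro: continuous_on_subset[OF cu] continuous_on_subset[OF cg])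
  show "u s \<in> range Pr" "g s \<in> range Pr" if "0 \<le> s" "s \<le> t" for s
    using that t uY gY by auto
  fix s assume s: "0 \<le> s" "s < t"
  have "((\<lambda>k. (u (s + k) - T k (u s)) /\<^sub>R k) \<longlongrightarrow> B (u s) + g s) (at_right 0)"
  proof (rule T.mild_quotient[OF _ _ u u0 s(1)])
    show "continuous_on {0..b} (\<lambda>s. B (u s) + g s)"
      by (intro continuous_intros bounded_linear.continuous_on[OF B] cu cg)
    show "B (u r) + g r \<in> range Pr" if "0 \<le> r" "r \<le> b" for r
      using that gY B_in by (intro subspace_add[OF T.subspace_range]) auto
  qed (use s t in auto)
  from tendsto_diff[OF this quotient_tendsto[of "u s"]]
  show "((\<lambda>k. (u (s + k) - S k (u s)) /\<^sub>R k) \<longlongrightarrow> g s) (at_right 0)"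
    using uY s t by (simp flip: scaleR_diff_right)
qed

end

section \<open>Finite direct sums of semigroups\<close>

lemma linear_op_on_sum:
  assumes "linear_op_on D A" "finite I" "\<And>i. i \<in> I \<Longrightarrow> x i \<in> D"
  shows "A (\<Sum>i\<in>I. x i) = (\<Sum>i\<in>I. A (x i))"
  using assms(2,3)
proof (induction I)
  case empty
  have "0 \<in> D" using assms(1) by (auto simp: linear_op_on_def subspace_0)
  then have "A (0 *\<^sub>R 0) = 0 *\<^sub>R A 0" using assms(1) unfolding linear_op_on_def by blast
  then show ?case by simp
next
  case (insert i I)
  have "(\<Sum>i\<in>I. x i) \<in> D"
    using assms(1) insert by (intro subspace_sum) (auto simp: linear_op_on_def)
  then show ?case using assms(1) insert by (simp add: linear_op_on_def)
qed

text \<open>Everything reduces to components through \<open>p j (U t x) = T j t (p j x)\<close>,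
  which holds because \<open>T i t\<close> maps the range of \<open>p i\<close> into itself and
  distinct projections annihilate each other.\<close>

lemma generates_on_direct_sum:
  fixes p :: "'i \<Rightarrow> 'a::banach \<Rightarrow> 'a"
  assumes fin: "finite I" and p: "\<And>i. i \<in> I \<Longrightarrow> bounded_linear (p i)"
    and orth: "\<And>i j x. i \<in> I \<Longrightarrow> j \<in> I \<Longrightarrow> p i (p j x) = (if i = j then p j x else 0)"
    and A: "linear_op_on D A" and pD: "\<And>i x. i \<in> I \<Longrightarrow> x \<in> D \<Longrightarrow> p i x \<in> D"
    and gen: "\<And>i. i \<in> I \<Longrightarrow> generates_on (range (p i)) (D \<inter> range (p i)) A (T i)"
  shows "generates_on (range (\<lambda>x. \<Sum>i\<in>I. p i x)) (D \<inter> range (\<lambda>x. \<Sum>i\<in>I. p i x)) A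
    (\<lambda>t x. \<Sum>i\<in>I. T i t (p i x))"
proof -
  define P where "P = (\<lambda>x. \<Sum>i\<in>I. p i x)"
  define U where "U = (\<lambda>t x. \<Sum>i\<in>I. T i t (p i x))"
  have c0: "c0_semigroup (p i) (T i)" if "i \<in> I" for i
    using orth[OF that that] by (intro c0_semigroup.intro p generates_onD(1)[OF gen] that) simp
  have P: "bounded_linear P" unfolding P_def by (intro bounded_linear_sum p)
  have pP: "p j (P x) = p j x" if "j \<in> I" for j x
    using that orth fin by (simp add: P_def linear_sum[OF bounded_linear.linear[OF p]] sum.delta')
  have PP: "x \<in> range P \<longleftrightarrow> P x = x" for x
  proof
    assume "x \<in> range P"
    then obtain y where "x = P y" by blast
    then show "P x = x" using pP by (simp add: P_def)
  qed (metis rangeI)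
  have pU: "p j (U t x) = T j t (p j x)" if "j \<in> I" "0 \<le> t" for j t x
  proof -
    have "p j (T i t (p i x)) = (if i = j then T j t (p j x) else 0)" if i: "i \<in> I" for i
    proof -
      obtain z where "T i t (p i x) = p i z"
        using c0_semigroup.T_in[OF c0[OF i] \<open>0 \<le> t\<close>, of "p i x"] by blast
      then show ?thesis using orth[OF \<open>j \<in> I\<close> i] by auto
    qed
    then show ?thesis
      using that fin by (simp add: U_def linear_sum[OF bounded_linear.linear[OF p]])
  qed
  have Y: "subspace (range P)"
    by (intro linear_subspace_image subspace_UNIV bounded_linear.linear[OF P])
  have UY: "U t x \<in> range P" if "0 \<le> t" for t x
    using pU[OF _ that] by (simp only: PP) (simp add: P_def U_def)
  have quot: "(U h x - x) /\<^sub>R h = (\<Sum>i\<in>I. (T i h (p i x) - p i x) /\<^sub>R h)" if "x \<in> range P" for h x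
    using that unfolding PP by (simp add: U_def sum_subtractf flip: scaleR_sum_right) (simp add: P_def)
  note c0D = c0_semigroup.T_add[OF c0] c0_semigroup.T_scaleR[OF c0] c0_semigroup.T_plus[OF c0] c0_semigroup.T_0[OF c0]
  have "C0_semigroup_on (range P) U"
    unfolding C0_semigroup_on_def
  proof (intro conjI allI ballI impI)
    fix t :: real assume t: "0 \<le> t"
    show "linear_op_on (range P) (U t)"
      unfolding linear_op_on_def U_def using t
      by (simp add: Y c0D linear_add[OF bounded_linear.linear[OF p]] linear_scale[OF bounded_linear.linear[OF p]]
          sum.distrib scaleR_sum_right)
    show "U t ` range P \<subseteq> range P" using UY[OF t] by blast
    have "bounded_linear (U t)"
      unfolding U_def using t by (intro bounded_linear_sum c0_semigroup.bounded_linear_T c0)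
    then show "\<exists>K. \<forall>x\<in>range P. norm (U t x) \<le> K * norm x"
      using onorm by blast
  next
    show "U 0 x = x" if "x \<in> range P" for x
      using that unfolding PP by (simp add: U_def c0D) (simp add: P_def)
    show "U (s + t) x = U s (U t x)" if "0 \<le> s" "0 \<le> t" "x \<in> range P" for s t x
    proof -
      have "U s (U t x) = (\<Sum>i\<in>I. T i s (p i (U t x)))" by (simp add: U_def)
      also have "\<dots> = (\<Sum>i\<in>I. T i (s + t) (p i x))"
        using that by (intro sum.cong) (simp_all add: pU c0D)
      finally show ?thesis by (simp add: U_def)
    qed
    show "continuous_on {0..} (\<lambda>t. U t x)" for x
      unfolding U_def by (intro continuous_on_sum c0_semigroup.T_cont[OF c0]) auto
  qed
  moreover have lim: "((\<lambda>h. (U h x - x) /\<^sub>R h) \<longlongrightarrow> A x) (at_right 0)" if x: "x \<in> D \<inter> range P" for x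
  proof -
    have "((\<lambda>h. \<Sum>i\<in>I. (T i h (p i x) - p i x) /\<^sub>R h) \<longlongrightarrow> (\<Sum>i\<in>I. A (p i x))) (at_right 0)"
      using pD x by (intro tendsto_sum generates_onD(3)[OF gen]) auto
    moreover have "(\<Sum>i\<in>I. A (p i x)) = A (P x)"
      unfolding P_def using pD x by (intro linear_op_on_sum[OF A fin, symmetric]) auto
    ultimately show ?thesis using quot x PP by auto
  qed
  \<comment> \<open>The generator of the sum has no larger domain: applying \<open>p j\<close> to a
    convergent quotient gives a convergent quotient for \<open>T j\<close>, so every component lies
    in \<open>D\<close>, and so does their sum.\<close>
  moreover have "x \<in> D" if x: "x \<in> range P" and l: "((\<lambda>h. (U h x - x) /\<^sub>R h) \<longlongrightarrow> y) (at_right 0)" for x y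
  proof -
    have "p j x \<in> D" if j: "j \<in> I" for j
    proof -
      have 1: "((\<lambda>h. p j ((U h x - x) /\<^sub>R h)) \<longlongrightarrow> p j y) (at_right 0)"
        by (rule bounded_linear.tendsto[OF p[OF j] l])
      have "((\<lambda>h. (T j h (p j x) - p j x) /\<^sub>R h) \<longlongrightarrow> p j y) (at_right 0)"
      proof (rule Lim_transform_eventually[OF 1])
        show "\<forall>\<^sub>F h in at_right 0. p j ((U h x - x) /\<^sub>R h) = (T j h (p j x) - p j x) /\<^sub>R h"
          using eventually_at_right_less[of 0]
          by eventually_elim
            (simp add: linear_diff[OF bounded_linear.linear[OF p[OF j]]]
              linear_scale[OF bounded_linear.linear[OF p[OF j]]] pU j)
      qed
      then show ?thesis using generates_onD(4)[OF gen[OF j], of "p j x"] by blast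
    qed
    then have "P x \<in> D"
      unfolding P_def using A by (intro subspace_sum) (auto simp: linear_op_on_def)
    then show ?thesis using x PP by simp
  qed
  ultimately have "generates_on (range P) (D \<inter> range P) A U"
    unfolding generates_on_def by blast
  then show ?thesis by (simp add: P_def U_def)
qed

section \<open>Mild solutions of globally Lipschitz equations\<close>

context bounded_semigroup
begin

text \<open>Cutting the time argument off at 0 gives a jointly continuous integrand on the fixed
  interval from 0 to \<open>b\<close>. Beyond \<open>t\<close> the semigroup is then the identity,
  so the surplus is the plain integral of \<open>q\<close> from \<open>t\<close> to
  \<open>b\<close>, which is continuous in \<open>t\<close> too.\<close>

lemma continuous_on_convolution:
  assumes cq: "continuous_on {0..} q" and qY: "\<And>s. 0 \<le> s \<Longrightarrow> q s \<in> range Pr"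
  shows "continuous_on {0..} (\<lambda>t. integral {0..t} (\<lambda>s. T (t - s) (q s)))"
proof (rule continuous_on_halfline)
  fix b :: real assume b: "0 \<le> b"
  define f where "f t s = T (max 0 (t - s)) (q s)" for t s
  have cqb: "continuous_on {0..b} q" by (rule continuous_on_subset[OF cq]) auto
  have cf: "continuous_on ({0..b} \<times> cbox 0 b) (\<lambda>(t, s). f t s)"
    unfolding f_def split_beta using qY
    by (intro continuous_on_T continuous_intros continuous_on_compose2[OF cq]) auto
  have c1: "continuous_on {0..b} (\<lambda>t. integral (cbox 0 b) (f t))"
    by (rule integral_continuous_on_param[OF cf])
  have cft: "continuous_on {0..b} (f t)" for t
    unfolding f_def[abs_def] using qY
    by (intro continuous_on_T continuous_intros continuous_on_subset[OF cq]) auto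
  have eq: "integral {0..t} (\<lambda>s. T (t - s) (q s)) = integral (cbox 0 b) (f t) - (integral {0..b} q - integral {0..t} q)"
    if t: "t \<in> {0..b}" for t
  proof -
    have 1: "integral {0..b} (f t) = integral {0..t} (f t) + integral {t..b} (f t)"
      using t integrable_continuous_real[OF cft]
      by (intro Henstock_Kurzweil_Integration.integral_combine[symmetric]) auto
    have 2: "integral {0..t} (f t) = integral {0..t} (\<lambda>s. T (t - s) (q s))"
      by (intro integral_cong) (simp add: f_def)
    have 3: "integral {t..b} (f t) = integral {t..b} q"
    proof (rule integral_cong)
      fix s assume "s \<in> {t..b}"
      then have "max 0 (t - s) = 0" "0 \<le> s" using t by auto
      then show "f t s = q s" using T_0[OF qY] by (simp add: f_def)
    qed
    have 4: "integral {0..b} q = integral {0..t} q + integral {t..b} q"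
      using t integrable_continuous_real[OF cqb]
      by (intro Henstock_Kurzweil_Integration.integral_combine[symmetric]) auto
    show ?thesis unfolding box_real 1 2 3 4 by simp
  qed
  have "continuous_on {0..b} (\<lambda>t. integral (cbox 0 b) (f t) - (integral {0..b} q - integral {0..t} q))"
    by (intro continuous_intros c1 indefinite_integral_continuous_1 integrable_continuous_real cqb)
  then show "continuous_on {0..b} (\<lambda>t. integral {0..t} (\<lambda>s. T (t - s) (q s)))"
    by (subst continuous_on_cong[OF refl eq])
qed

text \<open>The gain of a factor \<open>1 / w\<close> in the weighted norm: it serves both the
  boundedness of the fixed point map and its contraction estimate.\<close>

lemma norm_convolution_le:
  assumes t: "0 \<le> t" and w: "0 < w" and cq: "continuous_on {0..} q" and qY: "\<And>s. 0 \<le> s \<Longrightarrow> q s \<in> range Pr"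
    and Q: "\<And>s. 0 \<le> s \<Longrightarrow> norm (q s) \<le> Q * exp (w * s)"
  shows "norm (integral {0..t} (\<lambda>s. T (t - s) (q s))) \<le> M * Q / w * exp (w * t)"
proof -
  have int: "((\<lambda>s. M * Q * exp (w * s)) has_integral (M * Q / w * exp (w * t) - M * Q / w * exp (w * 0))) {0..t}"
  proof (rule fundamental_theorem_of_calculus[OF t])
    show "((\<lambda>s. M * Q / w * exp (w * s)) has_vector_derivative M * Q * exp (w * x)) (at x within {0..t})" for x
      using w by (auto intro!: derivative_eq_intros simp: has_real_derivative_iff_has_vector_derivative[symmetric])
  qed
  have "norm (integral {0..t} (\<lambda>s. T (t - s) (q s))) \<le> integral {0..t} (\<lambda>s. M * Q * exp (w * s))"
  proof (rule integral_norm_bound_integral)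
    show "(\<lambda>s. T (t - s) (q s)) integrable_on {0..t}"
      using qY by (intro T_integrable[OF t] continuous_on_subset[OF cq]) auto
    show "(\<lambda>s. M * Q * exp (w * s)) integrable_on {0..t}" using int by blast
    show "norm (T (t - s) (q s)) \<le> M * Q * exp (w * s)" if "s \<in> {0..t}" for s
      using T_bound[of "t - s" "q s"] mult_left_mono[OF Q[of s] M] qY that by (simp add: mult.assoc)
  qed
  also have "\<dots> = M * Q / w * exp (w * t) - M * Q / w" using integral_unique[OF int] by simp
  also have "\<dots> \<le> M * Q / w * exp (w * t)"
  proof -
    have "0 \<le> Q" using order_trans[OF norm_ge_zero Q[of 0]] by simp
    then show ?thesis using M w by simp
  qed
  finally show ?thesis .
qed

text \<open>The integral equation is a contraction for the norm \<open>sup\<^sub>t e\<^sup>-\<^sup>w\<^sup>t |x t|\<close> if \<open>w\<close> is large.\<close>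

lemma mild_solution_exists:
  assumes \<xi>: "\<xi> \<in> range Pr" and L: "0 \<le> L" and FL: "\<And>x y. norm (F x - F y) \<le> L * norm (x - y)"
    and FY: "\<And>x. F x \<in> range Pr" and F0: "F 0 = 0"
  obtains x where "continuous_on {0..} x" "\<And>t. 0 \<le> t \<Longrightarrow> x t \<in> range Pr"
    "\<And>t. 0 \<le> t \<Longrightarrow> ((\<lambda>s. T (t - s) (F (x s))) has_integral x t - T t \<xi>) {0..t}"
proof -
  \<comment> \<open>This weight makes the contraction factor \<open>M * L / w\<close> at most one
    half; the summand 1 keeps it positive when \<open>M * L\<close> vanishes.\<close>
  define w where "w = 2 * M * L + 1"
  have w: "0 < w" using M L by (simp add: w_def add_nonneg_pos)
  have half: "M * L / w \<le> 1 / 2" using w by (simp add: w_def divide_simps)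
  have cF: "continuous_on A F" for A
  proof (rule lipschitz_on_continuous_on)
    show "L-lipschitz_on A F" using FL L by (intro lipschitz_onI) (auto simp: dist_norm)
  qed
  define I where "I \<phi> t = integral {0..t} (\<lambda>s. T (t - s) (F (exp (w * s) *\<^sub>R apply_bcontfun \<phi> s)))" for \<phi> :: "real \<Rightarrow>\<^sub>C 'a" and t
  \<comment> \<open>The unknown is \<open>exp (- w * t) *\<^sub>R x t\<close>, so that weighted
    functions become bounded ones. Taking \<open>max 0 t\<close> continues it by a constant to
    negative times and places the map in the complete space of bounded continuous functions on the
    line.\<close>
  define \<Phi> where "\<Phi> \<phi> t = exp (- w * max 0 t) *\<^sub>R (T (max 0 t) \<xi> + I \<phi> (max 0 t))" for \<phi> t
  have cq: "continuous_on A (\<lambda>s. F (exp (w * s) *\<^sub>R apply_bcontfun \<phi> s))" for \<phi> A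
    by (intro continuous_on_compose2[OF cF[of UNIV]] continuous_intros) auto
  have cI: "continuous_on {0..} (I \<phi>)" for \<phi>
    unfolding I_def[abs_def] using FY by (intro continuous_on_convolution cq)
  have bc: "\<Phi> \<phi> \<in> bcontfun" for \<phi>
  proof (rule bcontfun_normI)
    show "continuous_on UNIV (\<Phi> \<phi>)"
      unfolding \<Phi>_def[abs_def]
      by (intro continuous_intros continuous_on_compose2[OF T_cont[OF \<xi>]] continuous_on_compose2[OF cI]) auto
    fix t :: real
    define r where "r = max 0 t"
    have r: "0 \<le> r" by (simp add: r_def)
    have "norm (I \<phi> r) \<le> M * (L * norm \<phi>) / w * exp (w * r)"
      unfolding I_def
    proof (rule norm_convolution_le[OF r w cq FY])
      fix s :: real assume "0 \<le> s"
      have "norm (F (exp (w * s) *\<^sub>R apply_bcontfun \<phi> s)) \<le> L * norm (exp (w * s) *\<^sub>R apply_bcontfun \<phi> s)"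
        using FL[of "exp (w * s) *\<^sub>R apply_bcontfun \<phi> s" 0] by (simp add: F0)
      also have "\<dots> \<le> L * (exp (w * s) * norm \<phi>)"
        using L norm_bounded[of \<phi> s] by (intro mult_left_mono) auto
      finally show "norm (F (exp (w * s) *\<^sub>R apply_bcontfun \<phi> s)) \<le> L * norm \<phi> * exp (w * s)" by (simp add: mult_ac)
    qed
    moreover have "norm (T r \<xi>) \<le> M * norm \<xi> * exp (w * r)"
      using T_bound[OF r \<xi>] mult_left_mono[of 1 "exp (w * r)" "M * norm \<xi>"] M w r by simp
    ultimately have "norm (T r \<xi> + I \<phi> r) \<le> (M * norm \<xi> + M * (L * norm \<phi>) / w) * exp (w * r)"
      using norm_triangle_ineq[of "T r \<xi>" "I \<phi> r"] by (simp add: distrib_right)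
    then have "exp (- w * r) * norm (T r \<xi> + I \<phi> r) \<le> exp (- w * r) * ((M * norm \<xi> + M * (L * norm \<phi>) / w) * exp (w * r))"
      by (intro mult_left_mono) auto
    also have "\<dots> = M * norm \<xi> + M * (L * norm \<phi>) / w" by (simp add: mult_ac exp_minus)
    finally show "norm (\<Phi> \<phi> t) \<le> M * norm \<xi> + M * (L * norm \<phi>) / w" by (simp add: \<Phi>_def r_def)
  qed
  have contr: "dist (Bcontfun (\<Phi> \<phi>)) (Bcontfun (\<Phi> \<psi>)) \<le> 1 / 2 * dist \<phi> \<psi>" for \<phi> \<psi>
  proof (rule dist_bound)
    fix t :: real
    define r where "r = max 0 t"
    have r: "0 \<le> r" by (simp add: r_def)
    have "I \<phi> r - I \<psi> r = integral {0..r} (\<lambda>s. T (r - s) (F (exp (w * s) *\<^sub>R apply_bcontfun \<phi> s) - F (exp (w * s) *\<^sub>R apply_bcontfun \<psi> s)))"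
      unfolding I_def using FY
      by (subst integral_diff[symmetric]) (auto intro!: T_integrable[OF r] cq integral_cong simp: T_diff)
    also have "norm \<dots> \<le> M * (L * dist \<phi> \<psi>) / w * exp (w * r)"
    proof (rule norm_convolution_le[OF r w])
      show "continuous_on {0..} (\<lambda>s. F (exp (w * s) *\<^sub>R apply_bcontfun \<phi> s) - F (exp (w * s) *\<^sub>R apply_bcontfun \<psi> s))"
        by (intro continuous_on_diff cq)
      show "F (exp (w * s) *\<^sub>R apply_bcontfun \<phi> s) - F (exp (w * s) *\<^sub>R apply_bcontfun \<psi> s) \<in> range Pr" for s
        by (intro subspace_diff[OF subspace_range] FY)
      fix s :: real assume "0 \<le> s"
      have "norm (F (exp (w * s) *\<^sub>R apply_bcontfun \<phi> s) - F (exp (w * s) *\<^sub>R apply_bcontfun \<psi> s))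
        \<le> L * (exp (w * s) * dist (apply_bcontfun \<phi> s) (apply_bcontfun \<psi> s))"
        using FL[of "exp (w * s) *\<^sub>R apply_bcontfun \<phi> s" "exp (w * s) *\<^sub>R apply_bcontfun \<psi> s"]
        by (simp add: dist_norm flip: scaleR_diff_right)
      also have "\<dots> \<le> L * (exp (w * s) * dist \<phi> \<psi>)"
        using L by (intro mult_left_mono dist_bounded) auto
      finally show "norm (F (exp (w * s) *\<^sub>R apply_bcontfun \<phi> s) - F (exp (w * s) *\<^sub>R apply_bcontfun \<psi> s))
        \<le> L * dist \<phi> \<psi> * exp (w * s)" by (simp add: mult_ac)
    qed
    finally have "exp (- w * r) * norm (I \<phi> r - I \<psi> r) \<le> exp (- w * r) * (M * (L * dist \<phi> \<psi>) / w * exp (w * r))"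
      by (intro mult_left_mono) auto
    also have "\<dots> = M * L / w * dist \<phi> \<psi>" by (simp add: mult_ac exp_minus)
    also have "\<dots> \<le> 1 / 2 * dist \<phi> \<psi>" by (intro mult_right_mono half) auto
    finally have "exp (- w * r) * norm (I \<phi> r - I \<psi> r) \<le> 1 / 2 * dist \<phi> \<psi>" .
    then show "dist (apply_bcontfun (Bcontfun (\<Phi> \<phi>)) t) (apply_bcontfun (Bcontfun (\<Phi> \<psi>)) t) \<le> 1 / 2 * dist \<phi> \<psi>"
      by (simp add: Bcontfun_inverse[OF bc] \<Phi>_def dist_norm r_def flip: scaleR_diff_right)
  qed
  have "\<exists>!\<phi>. Bcontfun (\<Phi> \<phi>) = \<phi>"
    by (rule banach_fix_type[of "1 / 2"]) (use contr in auto)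
  then obtain \<phi> where \<phi>: "Bcontfun (\<Phi> \<phi>) = \<phi>" by blast
  define x where "x t = exp (w * t) *\<^sub>R apply_bcontfun \<phi> t" for t
  have x_eq: "x t = T t \<xi> + I \<phi> t" if "0 \<le> t" for t
  proof -
    have "apply_bcontfun \<phi> t = \<Phi> \<phi> t" using Bcontfun_inverse[OF bc, of \<phi>] \<phi> by simp
    then have "x t = (exp (w * t) * exp (- w * t)) *\<^sub>R (T t \<xi> + I \<phi> t)"
      using that by (simp add: x_def \<Phi>_def)
    then show ?thesis by (simp flip: exp_add)
  qed
  have int: "((\<lambda>s. T (t - s) (F (x s))) has_integral x t - T t \<xi>) {0..t}" if t: "0 \<le> t" for t
  proof -
    have "(\<lambda>s. T (t - s) (F (x s))) integrable_on {0..t}"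
      unfolding x_def by (intro T_integrable[OF t] cq FY)
    then have "((\<lambda>s. T (t - s) (F (x s))) has_integral I \<phi> t) {0..t}"
      by (simp add: I_def x_def integrable_integral)
    then show ?thesis by (simp add: x_eq[OF t])
  qed
  have "x t \<in> range Pr" if t: "0 \<le> t" for t
  proof -
    have "x t - T t \<xi> \<in> range Pr"
      by (rule integral_in_range[OF int[OF t]]) (use T_in FY in auto)
    from subspace_add[OF subspace_range this T_in[OF t \<xi>]] show ?thesis by simp
  qed
  moreover have "continuous_on {0..} x" unfolding x_def[abs_def] by (intro continuous_intros continuous_on_apply_bcontfun)
  ultimately show ?thesis using int that by blast
qed

text \<open>Continuous dependence on the initial value: Gronwall comparison with
  \<open>l = 0\<close>, \<open>H = M * L\<close> and no forcing, so that the comparison function is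
  a pure exponential.\<close>

lemma mild_solution_diff_le:
  assumes L: "0 \<le> L" and FL: "\<And>x y. norm (F x - F y) \<le> L * norm (x - y)"
    and FY: "\<And>x. F x \<in> range Pr"
    and cx: "continuous_on {0..} x" and cy: "continuous_on {0..} y"
    and x: "\<And>t. 0 \<le> t \<Longrightarrow> ((\<lambda>s. T (t - s) (F (x s))) has_integral x t - T t \<xi>) {0..t}"
    and y: "\<And>t. 0 \<le> t \<Longrightarrow> ((\<lambda>s. T (t - s) (F (y s))) has_integral y t - T t \<zeta>) {0..t}"
    and \<xi>: "\<xi> \<in> range Pr" and \<zeta>: "\<zeta> \<in> range Pr" and t: "0 \<le> t"
  shows "norm (x t - y t) \<le> M * norm (\<xi> - \<zeta>) * exp (M * L * t)"
proof (rule gronwall_compare[where u = "\<lambda>t. norm (x t - y t)" and w = "\<lambda>t. M * norm (\<xi> - \<zeta>) * exp (M * L * t)"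
      and H = "M * L" and l = 0 and b = "\<lambda>_. 0" and c = "\<lambda>_. 0" and a = "M * norm (\<xi> - \<zeta>)" and T = t])
  show "continuous_on {0..t} (\<lambda>t. norm (x t - y t))"
    by (intro continuous_intros continuous_on_subset[OF cx] continuous_on_subset[OF cy]) auto
  show "0 \<le> M * L" using M L by simp
  show "((\<lambda>t. M * norm (\<xi> - \<zeta>) * exp (M * L * t)) has_real_derivative
      (0 + M * L) * (M * norm (\<xi> - \<zeta>) * exp (M * L * t)) + 0) (at t)" for t
    by (auto intro!: derivative_eq_intros)
  fix r assume r: "0 \<le> r" "r \<le> t"
  have 1: "((\<lambda>s. T (r - s) (F (x s)) - T (r - s) (F (y s))) has_integral (x r - T r \<xi>) - (y r - T r \<zeta>)) {0..r}"
    by (rule has_integral_diff[OF x[OF r(1)] y[OF r(1)]])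
  have "norm ((x r - T r \<xi>) - (y r - T r \<zeta>)) \<le> integral {0..r} (\<lambda>s. exp (0 * (r - s)) * (M * L * norm (x s - y s) + 0))"
    unfolding integral_unique[OF 1, symmetric]
  proof (rule integral_norm_bound_integral)
    show "(\<lambda>s. T (r - s) (F (x s)) - T (r - s) (F (y s))) integrable_on {0..r}" using 1 by blast
    show "(\<lambda>s. exp (0 * (r - s)) * (M * L * norm (x s - y s) + 0)) integrable_on {0..r}"
      by (intro integrable_continuous_real continuous_intros continuous_on_subset[OF cx] continuous_on_subset[OF cy]) auto
    fix s assume s: "s \<in> {0..r}"
    have "norm (T (r - s) (F (x s) - F (y s))) \<le> M * norm (F (x s) - F (y s))"
      using s by (intro T_bound subspace_diff[OF subspace_range] FY) auto
    also have "\<dots> \<le> M * (L * norm (x s - y s))" by (intro mult_left_mono FL M)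
    finally show "norm (T (r - s) (F (x s)) - T (r - s) (F (y s))) \<le> exp (0 * (r - s)) * (M * L * norm (x s - y s) + 0)"
      using s FY by (simp add: T_diff mult.assoc)
  qed
  moreover have "norm (x r - y r) \<le> norm (T r (\<xi> - \<zeta>)) + norm ((x r - T r \<xi>) - (y r - T r \<zeta>))"
    using norm_triangle_ineq[of "T r (\<xi> - \<zeta>)" "(x r - T r \<xi>) - (y r - T r \<zeta>)"]
    by (simp add: T_diff[OF r(1) \<xi> \<zeta>])
  moreover have "norm (T r (\<xi> - \<zeta>)) \<le> M * norm (\<xi> - \<zeta>)"
    by (intro T_bound r subspace_diff[OF subspace_range] \<xi> \<zeta>)
  ultimately show "norm (x r - y r) \<le> exp (0 * r) * (M * norm (\<xi> - \<zeta>)) + integral {0..r} (\<lambda>s. exp (0 * (r - s)) * (M * L * norm (x s - y s) + 0))"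
    by simp
qed (use t in auto)

end

section \<open>Projections, charts and the nonlinearity\<close>

lemma norm_convex_comb_le:
  fixes a b :: "'b::real_normed_vector"
  assumes "norm a \<le> r" "norm b \<le> r" "0 \<le> u" "0 \<le> v" "u + v = 1"
  shows "norm (u *\<^sub>R a + v *\<^sub>R b) \<le> r"
  using assms convexD[OF convex_cball[of 0 r], of a b u v] by simp

locale lp_setting =
  fixes S :: "'a::banach lp_data"
  assumes Lam_linear: "linear_op_on (domL S) (Lam S)" and dense_dom: "closure (domL S) = UNIV"
    and C2: "C2_map (Nt S)"
    and split: "splitting S"
    and stable: "\<And>i. i \<in> Is S \<Longrightarrow>
      exp_bound_on (Xc S (Stb i)) (domL S \<inter> Xc S (Stb i)) (Lam S) 1 (lam S (Stb i))"
    and unstable_pos: "\<And>i'. i' \<in> Iu S \<Longrightarrow> lam S (Unst i') > 0"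
    and unstable: "\<And>i'. i' \<in> Iu S \<Longrightarrow>
      exp_bound_on (Xc S (Unst i')) (domL S \<inter> Xc S (Unst i')) (\<lambda>x. - Lam S x) 1 (- lam S (Unst i'))"
    and lam_neg: "\<And>i. i \<in> Is S \<Longrightarrow> lam S (Stb i) < 0"
    and lam_s_neg: "lam_s S < 0" and C_s: "C_s S \<ge> 0"
    and stable_full: "exp_bound_on (Xs S) (domL S \<inter> Xs S) (\<lambda>x. Lam S x + proj_s S (Lop S x)) (C_s S) (lam_s S)"
    and rho: "\<And>i. i \<in> Is S \<Longrightarrow> rho S i > 0"
    and Pc: "\<And>i' i. i' \<in> Iu S \<Longrightarrow> i \<in> Is S \<Longrightarrow> Pc S i' i \<ge> 0"
    and Cc: "\<And>j i. j \<in> Iall S \<Longrightarrow> i \<in> Iall S \<Longrightarrow> Cc S j i \<ge> 0"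
    and Cc_bound: "\<And>j i x y v. j \<in> Iall S \<Longrightarrow> i \<in> Iall S \<Longrightarrow> x \<in> Bs S \<Longrightarrow> y \<in> Bu S \<Longrightarrow> v \<in> Xc S i \<Longrightarrow>
      norm (Npartial S j i (x + y) v) \<le> Cc S j i * norm v"
begin

abbreviation p :: "idx \<Rightarrow> 'a \<Rightarrow> 'a" where "p \<equiv> proj S"

lemma finite_index [simp]: "finite (Is S)" "finite (Iu S)" "finite (Iall S)"
  by (simp_all add: Is_def Iu_def Iall_def)

lemma Iall_intro [simp]: "i \<in> Is S \<Longrightarrow> Stb i \<in> Iall S" "i' \<in> Iu S \<Longrightarrow> Unst i' \<in> Iall S"
  by (simp_all add: Iall_def)

lemma sum_Iall: "(\<Sum>i\<in>Iall S. f i) = (\<Sum>i\<in>Is S. f (Stb i)) + (\<Sum>i'\<in>Iu S. f (Unst i'))"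
  for f :: "idx \<Rightarrow> 'b::comm_monoid_add"
  unfolding Iall_def
  by (subst sum.union_disjoint) (auto simp: sum.reindex inj_on_def)

lemma p_bounded_linear: "i \<in> Iall S \<Longrightarrow> bounded_linear (p i)"
  and p_onorm: "i \<in> Iall S \<Longrightarrow> onorm (p i) \<le> pn S i"
  and p_orth: "i \<in> Iall S \<Longrightarrow> j \<in> Iall S \<Longrightarrow> p i (p j x) = (if i = j then p j x else 0)"
  and p_total: "(\<Sum>i\<in>Iall S. p i x) = x"
  and p_dom: "i \<in> Iall S \<Longrightarrow> x \<in> domL S \<Longrightarrow> p i x \<in> domL S"
  using split unfolding splitting_def by (simp_all add: image_subset_iff)

lemmas p_linear = bounded_linear.linear[OF p_bounded_linear]

lemma p_norm: "i \<in> Iall S \<Longrightarrow> norm (p i x) \<le> pn S i * norm x"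
  using onorm[OF p_bounded_linear, of i x] mult_right_mono[OF p_onorm, of i "norm x"] by simp

lemma pn_nonneg: "i \<in> Iall S \<Longrightarrow> 0 \<le> pn S i"
  using p_onorm onorm_pos_le[OF p_bounded_linear] by (rule order_trans[rotated])

lemma proj_s_bounded_linear: "bounded_linear (proj_s S)"
  unfolding proj_s_def[abs_def] by (intro bounded_linear_sum p_bounded_linear) simp

lemma proj_u_bounded_linear: "bounded_linear (proj_u S)"
  unfolding proj_u_def[abs_def] by (intro bounded_linear_sum p_bounded_linear) simp

lemma p_proj_s [simp]: "i \<in> Is S \<Longrightarrow> p (Stb i) (proj_s S x) = p (Stb i) x"
  and p_proj_u [simp]: "i' \<in> Iu S \<Longrightarrow> p (Unst i') (proj_u S x) = p (Unst i') x"
  by (simp_all add: proj_s_def proj_u_def linear_sum[OF p_linear] p_orth)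

lemma proj_s_idem [simp]: "proj_s S (proj_s S x) = proj_s S x"
  and proj_u_idem [simp]: "proj_u S (proj_u S x) = proj_u S x"
  by (simp_all add: proj_s_def[of S "proj_s S x"] proj_u_def[of S "proj_u S x"])
    (simp_all add: proj_s_def proj_u_def)

lemma Xs_iff: "x \<in> Xs S \<longleftrightarrow> proj_s S x = x"
  unfolding Xs_def using proj_s_idem by (metis rangeE rangeI)

lemma Xu_iff: "x \<in> Xu S \<longleftrightarrow> proj_u S x = x"
  unfolding Xu_def using proj_u_idem by (metis rangeE rangeI)

lemma Xs_unstable [simp]: "i' \<in> Iu S \<Longrightarrow> x \<in> Xs S \<Longrightarrow> p (Unst i') x = 0"
proof -
  assume "i' \<in> Iu S" "x \<in> Xs S"
  then have "p (Unst i') x = p (Unst i') (\<Sum>i\<in>Is S. p (Stb i) x)"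
    by (simp add: Xs_iff proj_s_def)
  also have "\<dots> = 0"
    using \<open>i' \<in> Iu S\<close> by (simp add: linear_sum[OF p_linear] p_orth)
  finally show ?thesis .
qed

lemma Xu_stable [simp]: "i \<in> Is S \<Longrightarrow> x \<in> Xu S \<Longrightarrow> p (Stb i) x = 0"
proof -
  assume "i \<in> Is S" "x \<in> Xu S"
  then have "p (Stb i) x = p (Stb i) (\<Sum>i\<in>Iu S. p (Unst i) x)"
    by (simp add: Xu_iff proj_u_def)
  also have "\<dots> = 0"
    using \<open>i \<in> Is S\<close> by (simp add: linear_sum[OF p_linear] p_orth)
  finally show ?thesis .
qed

lemma Xs_subspace: "subspace (Xs S)"
  unfolding Xs_def by (intro linear_subspace_image subspace_UNIV bounded_linear.linear[OF proj_s_bounded_linear])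

lemma Xu_subspace: "subspace (Xu S)"
  unfolding Xu_def by (intro linear_subspace_image subspace_UNIV bounded_linear.linear[OF proj_u_bounded_linear])

lemma Xc_iff: "i \<in> Iall S \<Longrightarrow> x \<in> Xc S i \<longleftrightarrow> p i x = x"
  using p_orth[of i i] by (auto simp: Xc_def intro: range_eqI[OF sym])

lemma proj_s_in [simp]: "proj_s S x \<in> Xs S" and proj_u_in [simp]: "proj_u S x \<in> Xu S"
  by (simp_all add: Xs_def Xu_def)

lemma p_in_Xs: "i \<in> Is S \<Longrightarrow> p (Stb i) x \<in> Xs S"
  by (simp add: Xs_iff proj_s_def p_orth)

lemma norm_le_sum_p: "x \<in> Xs S \<Longrightarrow> norm x \<le> (\<Sum>i\<in>Is S. norm (p (Stb i) x))"
  using norm_sum[of "\<lambda>i. p (Stb i) x" "Is S"] by (simp add: Xs_iff proj_s_def)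

lemma norm_le_sum_p_u: "x \<in> Xu S \<Longrightarrow> norm x \<le> (\<Sum>i\<in>Iu S. norm (p (Unst i) x))"
  using norm_sum[of "\<lambda>i. p (Unst i) x" "Iu S"] by (simp add: Xu_iff proj_u_def)

lemma Bs_Xs: "x \<in> Bs S \<Longrightarrow> x \<in> Xs S"
  and Bs_bound: "x \<in> Bs S \<Longrightarrow> i \<in> Is S \<Longrightarrow> norm (p (Stb i) x) \<le> rho S i"
  by (simp_all add: Bs_def)

lemma Bs_zero [simp]: "0 \<in> Bs S"
  using rho by (auto simp: Bs_def subspace_0[OF Xs_subspace] linear_0[OF p_linear] less_imp_le)

lemma Bs_nonempty [simp]: "Bs S \<noteq> {}"
  using Bs_zero by (force simp del: Bs_zero)

lemma Bs_norm: "x \<in> Bs S \<Longrightarrow> norm x \<le> (\<Sum>i\<in>Is S. rho S i)"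
  using norm_le_sum_p[OF Bs_Xs] by (rule order_trans) (auto intro!: sum_mono Bs_bound)

lemma convex_Bs: "convex (Bs S)"
  by (rule convexI)
    (auto simp: Bs_def linear_add[OF p_linear] linear_scale[OF p_linear]
      intro!: norm_convex_comb_le subspace_add[OF Xs_subspace] subspace_scale[OF Xs_subspace])

lemma convex_Bu: "convex (Bu S)"
  by (rule convexI)
    (auto simp: Bu_def linear_add[OF p_linear] linear_scale[OF p_linear]
      intro!: norm_convex_comb_le subspace_add[OF Xu_subspace] subspace_scale[OF Xu_subspace])

lemma Nt_has_derivative: "(Nt S has_derivative frechet_derivative (Nt S) (at x)) (at x)"
proof -
  obtain D1 :: "'a \<Rightarrow> 'a \<Rightarrow>\<^sub>L 'a" where "\<And>x. (Nt S has_derivative blinfun_apply (D1 x)) (at x)"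
    using C2 unfolding C2_map_def by auto
  then have "Nt S differentiable (at x)" unfolding differentiable_def by blast
  then show ?thesis by (simp add: frechet_derivative_works)
qed

lemma Lop_bounded_linear: "bounded_linear (Lop S)"
  unfolding Lop_def using Nt_has_derivative by (rule has_derivative_bounded_linear)

lemma Nfull_eq: "Nfull S x = Nt S (eqm S + x) - Nt S (eqm S)"
  by (simp add: Nfull_def Nhat_def)

lemma Nfull_zero [simp]: "Nfull S 0 = 0"
  by (simp add: Nfull_eq)

lemma Nfull_has_derivative: "(Nfull S has_derivative frechet_derivative (Nfull S) (at x)) (at x)"
proof -
  have "((\<lambda>x. Nt S (eqm S + x) - Nt S (eqm S)) has_derivative frechet_derivative (Nt S) (at (eqm S + x))) (at x)"
    by (rule derivative_eq_intros has_derivative_compose[OF _ Nt_has_derivative] refl | simp)+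
  then have "Nfull S differentiable (at x)"
    unfolding Nfull_eq[abs_def] differentiable_def by blast
  then show ?thesis by (simp add: frechet_derivative_works)
qed

lemma Nhat_differentiable: "Nhat S differentiable (at x)"
proof -
  have "Nhat S = (\<lambda>x. Nfull S x - Lop S x)" by (simp add: Nfull_def fun_eq_iff)
  moreover have "Nfull S differentiable (at x)"
    using Nfull_has_derivative unfolding differentiable_def by blast
  ultimately show ?thesis
    by (simp add: differentiable_diff bounded_linear_imp_differentiable[OF Lop_bounded_linear])
qed

lemma continuous_on_Nfull: "continuous_on A (Nfull S)"
  by (intro continuous_at_imp_continuous_on ballI has_derivative_continuous[OF Nfull_has_derivative])

text \<open>Mean value inequality along the segment from \<open>y + b\<close> to
  \<open>x + a\<close>. The direction is decomposed into components, so that each partial derivative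
  contributes with its own constant.\<close>

lemma p_Nfull_diff_le:
  assumes j: "j \<in> Iall S" and x: "x \<in> Bs S" "y \<in> Bs S" and a: "a \<in> Bu S" "b \<in> Bu S"
  shows "norm (p j (Nfull S (x + a)) - p j (Nfull S (y + b)))
    \<le> (\<Sum>i\<in>Is S. Cc S j (Stb i) * norm (p (Stb i) (x - y)))
      + (\<Sum>i'\<in>Iu S. Cc S j (Unst i') * norm (p (Unst i') (a - b)))" (is "_ \<le> ?K")
proof -
  define d where "d = (x + a) - (y + b)"
  define g where "g t = p j (Nfull S ((y + b) + t *\<^sub>R d))" for t :: real
  define DN where "DN t = frechet_derivative (Nfull S) (at ((y + b) + t *\<^sub>R d))" for t :: real
  have pd: "p (Stb i) d = p (Stb i) (x - y)" if "i \<in> Is S" for i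
    using that a by (simp add: d_def linear_diff[OF p_linear] linear_add[OF p_linear] Bu_def)
  have pd': "p (Unst i) d = p (Unst i) (a - b)" if "i \<in> Iu S" for i
    using that x Bs_Xs by (simp add: d_def linear_diff[OF p_linear] linear_add[OF p_linear])
  have K: "?K = (\<Sum>i\<in>Iall S. Cc S j i * norm (p i d))"
    by (simp add: sum_Iall pd pd')
  have "norm (g 1 - g 0) \<le> ?K * norm (1 - 0 :: real)"
  proof (rule differentiable_bound)
    fix t :: real assume t: "t \<in> {0..1}"
    have "((\<lambda>t. (y + b) + t *\<^sub>R d) has_derivative (\<lambda>h. h *\<^sub>R d)) (at t within {0..1})"
      by (auto intro!: derivative_eq_intros)
    from bounded_linear.has_derivative[OF p_bounded_linear[OF j] has_derivative_compose[OF this Nfull_has_derivative]]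
    have "((\<lambda>t. p j (Nfull S ((y + b) + t *\<^sub>R d))) has_derivative (\<lambda>h. p j (DN t (h *\<^sub>R d)))) (at t within {0..1})"
      unfolding DN_def .
    then show "(g has_derivative (\<lambda>h. p j (DN t (h *\<^sub>R d)))) (at t within {0..1})"
      unfolding g_def[abs_def] .
    have DN: "linear (DN t)"
      unfolding DN_def by (rule bounded_linear.linear[OF has_derivative_bounded_linear[OF Nfull_has_derivative]])
    \<comment> \<open>The bounds on partial derivatives are assumed at sums of a point of
      \<open>Bs S\<close> and a point of \<open>Bu S\<close>. By convexity of both sets, every point
      of the segment splits in this way.\<close>
    have pt: "(y + b) + t *\<^sub>R d = ((1 - t) *\<^sub>R y + t *\<^sub>R x) + ((1 - t) *\<^sub>R b + t *\<^sub>R a)"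
      by (simp add: d_def algebra_simps)
    have inB: "(1 - t) *\<^sub>R y + t *\<^sub>R x \<in> Bs S" "(1 - t) *\<^sub>R b + t *\<^sub>R a \<in> Bu S"
      using t x a by (auto intro!: convexD[OF convex_Bs] convexD[OF convex_Bu])
    have "p j (DN t d) = (\<Sum>i\<in>Iall S. p j (DN t (p i d)))"
      by (subst p_total[of d, symmetric]) (simp add: linear_sum[OF DN] linear_sum[OF p_linear[OF j]])
    also have "norm \<dots> \<le> (\<Sum>i\<in>Iall S. norm (p j (DN t (p i d))))" by (rule norm_sum)
    also have "\<dots> \<le> ?K" unfolding K
    proof (rule sum_mono)
      fix i assume i: "i \<in> Iall S"
      have "p i d \<in> Xc S i" by (simp add: Xc_def)
      then show "norm (p j (DN t (p i d))) \<le> Cc S j i * norm (p i d)"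
        using Cc_bound[OF j i inB] by (simp add: Npartial_def DN_def pt)
    qed
    finally have bd: "norm (p j (DN t d)) \<le> ?K" .
    show "onorm (\<lambda>h. p j (DN t (h *\<^sub>R d))) \<le> ?K"
    proof (rule onorm_le)
      fix h :: real
      have "norm (p j (DN t (h *\<^sub>R d))) = \<bar>h\<bar> * norm (p j (DN t d))"
        by (simp add: linear_scale[OF DN] linear_scale[OF p_linear[OF j]])
      also have "\<dots> \<le> \<bar>h\<bar> * ?K" by (intro mult_left_mono bd) simp
      finally show "norm (p j (DN t (h *\<^sub>R d))) \<le> ?K * norm h" by (simp add: mult.commute)
    qed
  qed auto
  then show ?thesis by (simp add: g_def d_def)
qed

lemma charts_in_Xu: "\<alpha> \<in> charts S \<Longrightarrow> x \<in> Bs S \<Longrightarrow> \<alpha> x \<in> Xu S"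
  and charts_zero: "\<alpha> \<in> charts S \<Longrightarrow> \<alpha> 0 = 0"
  and charts_Lip: "\<alpha> \<in> charts S \<Longrightarrow> i' \<in> Iu S \<Longrightarrow> i \<in> Is S \<Longrightarrow> Lip S \<alpha> i' i \<le> ereal (Pc S i' i)"
  by (auto simp: charts_def)

lemma charts_continuous: "\<alpha> \<in> charts S \<Longrightarrow> continuous_on (Bs S) \<alpha>"
  by (auto simp: charts_def intro: lipschitz_on_continuous_on)

lemma Lip_leD:
  assumes "Lip S \<alpha> i' i \<le> ereal c" "x \<in> Bs S" "y \<in> Bs S" "x - y \<in> Xc S (Stb i)"
  shows "norm (p (Unst i') (\<alpha> x) - p (Unst i') (\<alpha> y)) \<le> c * norm (x - y)"
proof (cases "x = y")
  case False
  define \<zeta> where "\<zeta> = x - y"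
  have "ereal (norm (p (Unst i') (\<alpha> (y + \<zeta>)) - p (Unst i') (\<alpha> y)) / norm \<zeta>) \<le> Lip S \<alpha> i' i"
    unfolding Lip_def using assms(2-4) False
    by (intro Sup_upper insertI2 CollectI exI[of _ y] exI[of _ \<zeta>]) (auto simp: \<zeta>_def)
  also note assms(1)
  finally show ?thesis using False by (simp add: \<zeta>_def pos_divide_le_eq)
qed simp

text \<open>The condition \<open>0 \<le> c\<close> accounts for the element 0 inserted into the
  supremum that defines \<open>Lip\<close>.\<close>

lemma Lip_leI:
  assumes "0 \<le> c"
    and "\<And>x y. x \<in> Bs S \<Longrightarrow> y \<in> Bs S \<Longrightarrow> x - y \<in> Xc S (Stb i) \<Longrightarrow>
      norm (p (Unst i') (\<alpha> x) - p (Unst i') (\<alpha> y)) \<le> c * norm (x - y)"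
  shows "Lip S \<alpha> i' i \<le> ereal c"
  unfolding Lip_def
proof (intro Sup_least, elim insertE CollectE exE conjE)
  fix z \<xi> \<zeta>
  assume z: "z = ereal (norm (p (Unst i') (\<alpha> (\<xi> + \<zeta>)) - p (Unst i') (\<alpha> \<xi>)) / norm \<zeta>)"
    and *: "\<xi> \<in> Bs S" "\<xi> + \<zeta> \<in> Bs S" "\<zeta> \<in> Xc S (Stb i)" "\<zeta> \<noteq> 0"
  show "z \<le> ereal c" using assms(2)[of "\<xi> + \<zeta>" \<xi>] * by (simp add: z pos_divide_le_eq)
qed (use assms(1) in simp)

text \<open>Two points of the box are joined by changing one coordinate at a time.\<close>

lemma chart_diff_le:
  assumes \<alpha>: "\<alpha> \<in> charts S" and i': "i' \<in> Iu S" and x: "x \<in> Bs S" and y: "y \<in> Bs S"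
  shows "norm (p (Unst i') (\<alpha> x) - p (Unst i') (\<alpha> y)) \<le> (\<Sum>i\<in>Is S. Pc S i' i * norm (p (Stb i) (x - y)))"
proof -
  \<comment> \<open>Induction over a set \<open>A\<close> containing all coordinates in which
    \<open>x\<close> and \<open>y\<close> differ, with \<open>x\<close> fixed. The intermediate
    point \<open>z\<close> takes one coordinate from \<open>x\<close> and the others from
    \<open>y\<close>; it stays in the box because the box is defined coordinatewise.\<close>
  have *: "norm (p (Unst i') (\<alpha> x) - p (Unst i') (\<alpha> y)) \<le> (\<Sum>i\<in>A. Pc S i' i * norm (p (Stb i) (x - y)))"
    if "finite A" "A \<subseteq> Is S" "y \<in> Bs S" "\<And>i. i \<in> Is S - A \<Longrightarrow> p (Stb i) (x - y) = 0" for A y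
    using that
  proof (induction A arbitrary: y)
    case empty
    then have "norm (x - y) \<le> 0"
      using norm_le_sum_p[of "x - y"] Bs_Xs[OF x] Bs_Xs[OF empty(2)] by (simp add: subspace_diff[OF Xs_subspace])
    then show ?case by simp
  next
    case (insert j A)
    define z where "z = y + p (Stb j) (x - y)"
    have j: "j \<in> Is S" using insert by simp
    have pz: "p (Stb i) z = (if i = j then p (Stb i) x else p (Stb i) y)" if "i \<in> Is S" for i
      using that j by (simp add: z_def linear_add[OF p_linear] linear_diff[OF p_linear] p_orth)
    have zB: "z \<in> Bs S"
      using pz Bs_bound x insert.prems j
      by (auto simp: Bs_def z_def[symmetric]) (simp add: z_def subspace_add[OF Xs_subspace] Bs_Xs p_in_Xs)
    have pxz: "p (Stb i) (x - z) = (if i = j then 0 else p (Stb i) (x - y))" if "i \<in> Is S" for i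
      using pz that by (simp add: linear_diff[OF p_linear])
    have "norm (p (Unst i') (\<alpha> x) - p (Unst i') (\<alpha> z)) \<le> (\<Sum>i\<in>A. Pc S i' i * norm (p (Stb i) (x - z)))"
      using insert.prems pxz by (intro insert.IH zB) auto
    also have "\<dots> = (\<Sum>i\<in>A. Pc S i' i * norm (p (Stb i) (x - y)))"
    proof (rule sum.cong)
      fix i assume "i \<in> A"
      then have "i \<in> Is S" "i \<noteq> j" using insert by blast+
      then show "Pc S i' i * norm (p (Stb i) (x - z)) = Pc S i' i * norm (p (Stb i) (x - y))" using pxz by simp
    qed simp
    finally have 1: "norm (p (Unst i') (\<alpha> x) - p (Unst i') (\<alpha> z)) \<le> \<dots>" .
    have "z - y \<in> Xc S (Stb j)" by (simp add: z_def Xc_def)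
    then have 2: "norm (p (Unst i') (\<alpha> z) - p (Unst i') (\<alpha> y)) \<le> Pc S i' j * norm (p (Stb j) (x - y))"
      using Lip_leD[OF charts_Lip[OF \<alpha> i' j] zB insert.prems(2)] by (simp add: z_def)
    show ?case
      using norm_triangle_mono[OF 1 2] insert by simp
  qed
  show ?thesis by (rule *[OF _ _ y]) auto
qed

lemma chart_in_Bu:
  assumes "\<alpha> \<in> charts S" "x \<in> Bs S"
  shows "\<alpha> x \<in> Bu S"
proof -
  have "norm (p (Unst i') (\<alpha> x)) \<le> ru S i'" if i': "i' \<in> Iu S" for i'
  proof -
    have "norm (p (Unst i') (\<alpha> x)) \<le> (\<Sum>i\<in>Is S. Pc S i' i * norm (p (Stb i) x))"
      using chart_diff_le[OF assms(1) i' assms(2) Bs_zero] i'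
      by (simp add: charts_zero[OF assms(1)] linear_0[OF p_linear])
    also have "\<dots> \<le> ru S i'"
      unfolding ru_def using Pc i' Bs_bound assms by (intro sum_mono mult_left_mono) auto
    finally show ?thesis .
  qed
  then show ?thesis using charts_in_Xu assms by (simp add: Bu_def)
qed

lemma Hc_nonneg: "j \<in> Iall S \<Longrightarrow> i \<in> Is S \<Longrightarrow> 0 \<le> Hc S j i"
  unfolding Hc_def using Cc Pc by (intro add_nonneg_nonneg sum_nonneg mult_nonneg_nonneg) auto

text \<open>On the graph of a chart, the unstable displacement is bounded by \<open>Pc\<close> times
  the stable one. Inserting this into the mean value bound produces the constants \<open>Hc\<close>,
  the chain rule in the form of Lipschitz constants.\<close>

lemma p_Nfull_chart_diff_le:
  assumes \<alpha>: "\<alpha> \<in> charts S" and j: "j \<in> Iall S" and x: "x \<in> Bs S" and y: "y \<in> Bs S"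
  shows "norm (p j (Nfull S (x + \<alpha> x)) - p j (Nfull S (y + \<alpha> y))) \<le> (\<Sum>i\<in>Is S. Hc S j i * norm (p (Stb i) (x - y)))"
proof -
  let ?n = "\<lambda>i. norm (p (Stb i) (x - y))"
  have "norm (p j (Nfull S (x + \<alpha> x)) - p j (Nfull S (y + \<alpha> y)))
    \<le> (\<Sum>i\<in>Is S. Cc S j (Stb i) * ?n i) + (\<Sum>i'\<in>Iu S. Cc S j (Unst i') * norm (p (Unst i') (\<alpha> x - \<alpha> y)))"
    by (intro p_Nfull_diff_le j x y chart_in_Bu \<alpha>)
  also have "\<dots> \<le> (\<Sum>i\<in>Is S. Cc S j (Stb i) * ?n i) + (\<Sum>i'\<in>Iu S. Cc S j (Unst i') * (\<Sum>i\<in>Is S. Pc S i' i * ?n i))"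
    using chart_diff_le[OF \<alpha> _ x y] Cc j
    by (intro add_left_mono sum_mono mult_left_mono) (auto simp: linear_diff[OF p_linear])
  also have "(\<Sum>i'\<in>Iu S. Cc S j (Unst i') * (\<Sum>i\<in>Is S. Pc S i' i * ?n i))
      = (\<Sum>i\<in>Is S. (\<Sum>i'\<in>Iu S. Cc S j (Unst i') * Pc S i' i) * ?n i)"
    by (simp add: sum_distrib_left sum_distrib_right mult.assoc sum.swap[of _ "Iu S"])
  finally show ?thesis by (simp add: Hc_def distrib_right sum.distrib)
qed

end

section \<open>Finiteness of \<open>Hhat\<close> and the Lipschitz bound for the nonlinear
  remainder\<close>

lemma has_derivative_within_direction_le:
  fixes f :: "'a::real_normed_vector \<Rightarrow> 'b::real_normed_vector"
  assumes D: "(f has_derivative D) (at x within A)"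
    and lip: "\<And>y z. y \<in> A \<Longrightarrow> z \<in> A \<Longrightarrow> norm (f y - f z) \<le> K * norm (y - z)"
    and x: "x \<in> A" and r: "0 < r" and seg: "\<And>s. 0 \<le> s \<Longrightarrow> s \<le> r \<Longrightarrow> x + s *\<^sub>R w \<in> A"
  shows "norm (D w) \<le> K * norm w"
proof (cases "w = 0")
  case True
  then show ?thesis using linear_0[OF bounded_linear.linear[OF has_derivative_bounded_linear[OF D]]] by simp
next
  case False
  have lin: "linear D" by (rule bounded_linear.linear[OF has_derivative_bounded_linear[OF D]])
  have "norm (D w) \<le> K * norm w + e" if e: "e > 0" for e
  proof -
    have "e / norm w > 0" using e False by simp
    then obtain d where d: "d > 0" "\<And>y. y \<in> A \<Longrightarrow> norm (y - x) < d \<Longrightarrow> norm (f y - f x - D (y - x)) \<le> e / norm w * norm (y - x)"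
      using D unfolding has_derivative_within_alt by blast
    \<comment> \<open>A step short enough both to stay in \<open>A\<close> along the admissible
      segment and to lie in the ball of radius \<open>d\<close>, where the linearization error is
      controlled. The factor 2 makes the second condition strict.\<close>
    define s where "s = min r (d / (2 * norm w))"
    have s: "0 < s" "s \<le> r" using r d False by (auto simp: s_def)
    have "s * norm w \<le> d / (2 * norm w) * norm w" by (intro mult_right_mono) (auto simp: s_def)
    also have "\<dots> < d" using False d by simp
    finally have small: "s * norm w < d" .
    have in': "x + s *\<^sub>R w \<in> A" using seg s by simp
    have "norm (D (s *\<^sub>R w)) \<le> norm (f (x + s *\<^sub>R w) - f x) + norm (f (x + s *\<^sub>R w) - f x - D (s *\<^sub>R w))"
      using norm_triangle_ineq4[of "f (x + s *\<^sub>R w) - f x" "f (x + s *\<^sub>R w) - f x - D (s *\<^sub>R w)"] by simp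
    also have "\<dots> \<le> K * norm (s *\<^sub>R w) + e / norm w * norm (s *\<^sub>R w)"
      using lip[OF in' x] d(2)[OF in'] small s by (intro add_mono) simp_all
    also have "\<dots> = s * (K * norm w + e)" using s False by (simp add: algebra_simps)
    finally have "s * norm (D w) \<le> s * (K * norm w + e)" using s by (simp add: linear_scale[OF lin])
    then show ?thesis using s by simp
  qed
  then show ?thesis by (rule field_le_epsilon)
qed

context lp_setting
begin

lemma rem_s_eq: "rem_s S \<alpha> x = proj_s S (Nfull S (x + \<alpha> x)) - proj_s S (Lop S x)"
  using bounded_linear.linear[OF proj_s_bounded_linear] bounded_linear.linear[OF Lop_bounded_linear]
  by (simp add: rem_s_def Nfull_def linear_add)

text \<open>A crude Lipschitz constant of \<open>rem_s\<close> valid for all charts at once: the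
  double sum comes from the field on the graph, the operator norm from subtracting the linear part.
  It serves to show that the set whose supremum is \<open>Hhat\<close> is bounded.\<close>

definition K0 :: real where
  "K0 = (\<Sum>j\<in>Is S. \<Sum>i\<in>Is S. Hc S (Stb j) i * pn S (Stb i)) + onorm (\<lambda>x. proj_s S (Lop S x))"

lemma proj_Lop_bounded_linear: "bounded_linear (\<lambda>x. proj_s S (Lop S x))"
  by (rule bounded_linear_compose[OF proj_s_bounded_linear Lop_bounded_linear])

lemma K0_nonneg: "0 \<le> K0"
  unfolding K0_def
  by (intro add_nonneg_nonneg sum_nonneg mult_nonneg_nonneg Hc_nonneg pn_nonneg onorm_pos_le proj_Lop_bounded_linear) auto

lemma proj_s_Nfull_chart_diff_le:
  assumes "\<alpha> \<in> charts S" "x \<in> Bs S" "y \<in> Bs S"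
  shows "norm (proj_s S (Nfull S (x + \<alpha> x)) - proj_s S (Nfull S (y + \<alpha> y)))
    \<le> (\<Sum>j\<in>Is S. \<Sum>i\<in>Is S. Hc S (Stb j) i * pn S (Stb i)) * norm (x - y)"
proof -
  have "norm (proj_s S (Nfull S (x + \<alpha> x)) - proj_s S (Nfull S (y + \<alpha> y)))
    \<le> (\<Sum>j\<in>Is S. norm (p (Stb j) (Nfull S (x + \<alpha> x)) - p (Stb j) (Nfull S (y + \<alpha> y))))"
    unfolding proj_s_def by (simp add: sum_norm_le flip: sum_subtractf)
  also have "\<dots> \<le> (\<Sum>j\<in>Is S. \<Sum>i\<in>Is S. Hc S (Stb j) i * (pn S (Stb i) * norm (x - y)))"
  proof (rule sum_mono)
    fix j assume j: "j \<in> Is S"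
    have "norm (p (Stb j) (Nfull S (x + \<alpha> x)) - p (Stb j) (Nfull S (y + \<alpha> y)))
      \<le> (\<Sum>i\<in>Is S. Hc S (Stb j) i * norm (p (Stb i) (x - y)))"
      using j by (intro p_Nfull_chart_diff_le assms) simp
    also have "\<dots> \<le> (\<Sum>i\<in>Is S. Hc S (Stb j) i * (pn S (Stb i) * norm (x - y)))"
      using j by (intro sum_mono mult_left_mono p_norm Hc_nonneg) auto
    finally show "norm (p (Stb j) (Nfull S (x + \<alpha> x)) - p (Stb j) (Nfull S (y + \<alpha> y))) \<le> \<dots>" .
  qed
  finally show ?thesis by (simp add: sum_distrib_right mult.assoc)
qed

lemma rem_s_diff_le_K0:
  assumes "\<alpha> \<in> charts S" "x \<in> Bs S" "y \<in> Bs S"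
  shows "norm (rem_s S \<alpha> x - rem_s S \<alpha> y) \<le> K0 * norm (x - y)"
proof -
  have "rem_s S \<alpha> x - rem_s S \<alpha> y = (proj_s S (Nfull S (x + \<alpha> x)) - proj_s S (Nfull S (y + \<alpha> y))) - proj_s S (Lop S (x - y))"
    by (simp add: rem_s_eq linear_diff[OF bounded_linear.linear[OF proj_Lop_bounded_linear]])
  also have "norm \<dots> \<le> (\<Sum>j\<in>Is S. \<Sum>i\<in>Is S. Hc S (Stb j) i * pn S (Stb i)) * norm (x - y)
      + onorm (\<lambda>x. proj_s S (Lop S x)) * norm (x - y)"
    using proj_s_Nfull_chart_diff_le[OF assms] onorm[OF proj_Lop_bounded_linear, of "x - y"]
    by (intro order_trans[OF norm_triangle_ineq4 add_mono])
  finally show ?thesis by (simp add: K0_def distrib_right)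
qed

lemma rem_s_differentiable:
  assumes "\<alpha> differentiable_on Bs S" "x \<in> Bs S"
  shows "rem_s S \<alpha> differentiable (at x within Bs S)"
proof -
  obtain A where A: "(\<alpha> has_derivative A) (at x within Bs S)"
    using assms unfolding differentiable_on_def differentiable_def by blast
  obtain E where E: "(Nhat S has_derivative E) (at (x + \<alpha> x))"
    using Nhat_differentiable unfolding differentiable_def by blast
  have "((\<lambda>x. x + \<alpha> x) has_derivative (\<lambda>h. h + A h)) (at x within Bs S)"
    by (intro derivative_intros A)
  from has_derivative_compose[OF this E]
  have "((\<lambda>x. proj_s S (Lop S (\<alpha> x)) + proj_s S (Nhat S (x + \<alpha> x))) has_derivative
      (\<lambda>h. proj_s S (Lop S (A h)) + proj_s S (E (h + A h)))) (at x within Bs S)"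
    by (intro has_derivative_add bounded_linear.has_derivative[OF proj_s_bounded_linear]
        bounded_linear.has_derivative[OF Lop_bounded_linear] A)
  then show ?thesis unfolding rem_s_def[abs_def] differentiable_def by blast
qed

text \<open>At a boundary point of the box, a direction is a combination of two directions that point into it.\<close>

definition K1 :: real where
  "K1 = K0 * (1 + 2 * ((1 + (\<Sum>i\<in>Is S. pn S (Stb i) / rho S i)) * (\<Sum>i\<in>Is S. rho S i)))"

lemma K0_le_K1: "K0 \<le> K1"
proof -
  have "0 \<le> (1 + (\<Sum>i\<in>Is S. pn S (Stb i) / rho S i)) * (\<Sum>i\<in>Is S. rho S i)"
    using rho by (intro mult_nonneg_nonneg add_nonneg_nonneg sum_nonneg divide_nonneg_nonneg pn_nonneg) (auto intro: less_imp_le)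
  then have "K0 * 1 \<le> K1" unfolding K1_def using K0_nonneg by (intro mult_left_mono) auto
  then show ?thesis by simp
qed

lemma rem_s_derivative_le:
  assumes \<alpha>: "\<alpha> \<in> charts S" and x: "x \<in> Bs S"
    and D: "(rem_s S \<alpha> has_derivative D) (at x within Bs S)" and v: "v \<in> Xs S" "norm v \<le> 1"
  shows "norm (D v) \<le> K1"
proof -
  \<comment> \<open>Chosen so that \<open>v\<close> divided by \<open>c\<close> lies in the box for
    every \<open>v\<close> in the unit ball. A step from \<open>x\<close> in direction
    \<open>v - c *\<^sub>R x\<close> is then a convex combination of \<open>x\<close> and that
    point, hence stays in the box up to step length \<open>1 / c\<close>.\<close>
  define c where "c = 1 + (\<Sum>i\<in>Is S. pn S (Stb i) / rho S i)"
  have nn: "0 \<le> pn S (Stb i) / rho S i" if "i \<in> Is S" for i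
    using that pn_nonneg[of "Stb i"] rho[of i] by simp
  have c1: "1 \<le> c" using nn by (simp add: c_def sum_nonneg)
  have cp: "norm (p (Stb i) v) \<le> c * rho S i" if i: "i \<in> Is S" for i
  proof -
    have "pn S (Stb i) / rho S i \<le> (\<Sum>i\<in>Is S. pn S (Stb i) / rho S i)"
      by (rule member_le_sum[OF i]) (use nn in auto)
    then have "pn S (Stb i) / rho S i \<le> c" by (simp add: c_def)
    then have "pn S (Stb i) \<le> c * rho S i" using rho[OF i] by (simp add: pos_divide_le_eq)
    moreover have "norm (p (Stb i) v) \<le> pn S (Stb i)"
      using p_norm[of "Stb i" v] mult_left_mono[OF v(2) pn_nonneg[of "Stb i"]] i by simp
    ultimately show ?thesis by simp
  qed
  have lin: "linear D" by (rule bounded_linear.linear[OF has_derivative_bounded_linear[OF D]])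
  have lip: "norm (rem_s S \<alpha> y - rem_s S \<alpha> z) \<le> K0 * norm (y - z)" if "y \<in> Bs S" "z \<in> Bs S" for y z
    using rem_s_diff_le_K0[OF \<alpha> that] .
  have xX: "x \<in> Xs S" using Bs_Xs[OF x] .
  have "norm (D (- x)) \<le> K0 * norm (- x)"
  proof (rule has_derivative_within_direction_le[OF D lip x zero_less_one])
    fix s :: real assume s: "0 \<le> s" "s \<le> 1"
    have "x + s *\<^sub>R (- x) = (1 - s) *\<^sub>R x + s *\<^sub>R 0" by (simp add: algebra_simps)
    then show "x + s *\<^sub>R (- x) \<in> Bs S"
      using convexD[OF convex_Bs x Bs_zero, of "1 - s" s] s by simp
  qed
  then have 1: "norm (D x) \<le> K0 * norm x" by (simp add: linear_neg[OF lin])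
  have "norm (D (v - c *\<^sub>R x)) \<le> K0 * norm (v - c *\<^sub>R x)"
  proof (rule has_derivative_within_direction_le[OF D lip x, of "1 / c"])
    fix s :: real assume s: "0 \<le> s" "s \<le> 1 / c"
    then have sc: "s * c \<le> 1" using c1 by (simp add: pos_le_divide_eq)
    have eq: "x + s *\<^sub>R (v - c *\<^sub>R x) = (1 - s * c) *\<^sub>R x + s *\<^sub>R v" by (simp add: algebra_simps)
    have "norm (p (Stb i) ((1 - s * c) *\<^sub>R x + s *\<^sub>R v)) \<le> rho S i" if i: "i \<in> Is S" for i
    proof -
      have "norm (p (Stb i) ((1 - s * c) *\<^sub>R x + s *\<^sub>R v)) \<le> norm ((1 - s * c) *\<^sub>R p (Stb i) x) + norm (s *\<^sub>R p (Stb i) v)"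
        using norm_triangle_ineq[of "(1 - s * c) *\<^sub>R p (Stb i) x" "s *\<^sub>R p (Stb i) v"] i
        by (simp only: linear_add[OF p_linear] linear_scale[OF p_linear] Iall_intro)
      also have "\<dots> = (1 - s * c) * norm (p (Stb i) x) + s * norm (p (Stb i) v)" using s sc by simp
      also have "\<dots> \<le> (1 - s * c) * rho S i + s * (c * rho S i)"
        using s sc cp[OF i] Bs_bound[OF x i] by (intro add_mono mult_left_mono) auto
      finally show ?thesis by (simp add: algebra_simps)
    qed
    then show "x + s *\<^sub>R (v - c *\<^sub>R x) \<in> Bs S"
      unfolding eq using xX v(1)
      by (auto simp: Bs_def intro!: subspace_add[OF Xs_subspace] subspace_scale[OF Xs_subspace])
  qed (use c1 in auto)
  also have "\<dots> \<le> K0 * (1 + c * norm x)"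
    using norm_triangle_ineq4[of v "c *\<^sub>R x"] v(2) c1 by (intro mult_left_mono K0_nonneg) auto
  finally have 2: "norm (D (v - c *\<^sub>R x)) \<le> K0 * (1 + c * norm x)" .
  \<comment> \<open>Linearity turns the bound for the direction \<open>- x\<close>, which points to
    the centre, into one for \<open>x\<close>. The two lengths add up to at most
    \<open>1 + 2 * (c * norm x)\<close>, the origin of the factor in \<open>K1\<close>.\<close>
  have "D v = D (v - c *\<^sub>R x) + c *\<^sub>R D x"
    by (simp add: linear_diff[OF lin] linear_scale[OF lin])
  then have "norm (D v) \<le> norm (D (v - c *\<^sub>R x)) + c * norm (D x)"
    using norm_triangle_ineq[of "D (v - c *\<^sub>R x)" "c *\<^sub>R D x"] c1 by simp
  also have "\<dots> \<le> K0 * (1 + c * norm x) + c * (K0 * norm x)"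
    using 1 2 c1 by (intro add_mono mult_left_mono) auto
  also have "\<dots> = K0 * (1 + 2 * (c * norm x))" by (simp add: algebra_simps)
  also have "\<dots> \<le> K0 * (1 + 2 * (c * (\<Sum>i\<in>Is S. rho S i)))"
    using Bs_norm[OF x] c1 K0_nonneg by (intro mult_left_mono add_left_mono) auto
  finally show ?thesis by (simp add: K1_def c_def)
qed

text \<open>The cases follow the two readings of the inner supremum: for a differentiable chart, the
  mean value inequality in the convex box; otherwise, the infimum of the Lipschitz constants, which
  is again one. As \<open>K1\<close> does not depend on the chart, the supremum over charts is over
  a bounded set.\<close>

lemma Hhat_at_bounds:
  assumes \<alpha>: "\<alpha> \<in> charts S"
  shows "0 \<le> Hhat_at S \<alpha>" "Hhat_at S \<alpha> \<le> K1"
    and "x \<in> Bs S \<Longrightarrow> y \<in> Bs S \<Longrightarrow> norm (rem_s S \<alpha> x - rem_s S \<alpha> y) \<le> Hhat_at S \<alpha> * norm (x - y)"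
proof -
  let ?f = "rem_s S \<alpha>"
  have "0 \<le> Hhat_at S \<alpha> \<and> Hhat_at S \<alpha> \<le> K1 \<and>
    (\<forall>x\<in>Bs S. \<forall>y\<in>Bs S. norm (?f x - ?f y) \<le> Hhat_at S \<alpha> * norm (x - y))"
  proof (cases "\<alpha> differentiable_on Bs S")
    case True
    define V where "V = {v \<in> Xs S. norm v \<le> 1}"
    define D where "D x = frechet_derivative ?f (at x within Bs S)" for x
    have D: "(?f has_derivative D x) (at x within Bs S)" if "x \<in> Bs S" for x
      unfolding D_def frechet_derivative_works[symmetric] by (rule rem_s_differentiable[OF True that])
    have lin: "linear (D x)" if "x \<in> Bs S" for x
      by (rule bounded_linear.linear[OF has_derivative_bounded_linear[OF D[OF that]]])
    have DV: "norm (D x v) \<le> K1" if "x \<in> Bs S" "v \<in> V" for x v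
      using rem_s_derivative_le[OF \<alpha> that(1) D[OF that(1)]] that(2) by (simp add: V_def)
    have V0: "0 \<in> V" by (simp add: V_def subspace_0[OF Xs_subspace])
    define h where "h x = (SUP v\<in>V. norm (D x v))" for x
    have bdd: "bdd_above ((\<lambda>v. norm (D x v)) ` V)" if "x \<in> Bs S" for x
      using DV[OF that] by (auto simp: bdd_above_def)
    have h_ge: "norm (D x v) \<le> h x" if "x \<in> Bs S" "v \<in> V" for x v
      unfolding h_def by (rule cSUP_upper[OF that(2) bdd[OF that(1)]])
    have h_le: "h x \<le> K1" if "x \<in> Bs S" for x
      unfolding h_def using V0 DV that by (intro cSUP_least) auto
    have H: "Hhat_at S \<alpha> = (SUP x\<in>Bs S. h x)"
      using True by (simp add: Hhat_at_def h_def V_def D_def)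
    have bddh: "bdd_above (h ` Bs S)" using h_le by (auto simp: bdd_above_def)
    have H_ge: "h x \<le> Hhat_at S \<alpha>" if "x \<in> Bs S" for x
      unfolding H by (rule cSUP_upper[OF that bddh])
    have H_le: "Hhat_at S \<alpha> \<le> K1"
      unfolding H using h_le by (intro cSUP_least) auto
    have H0: "0 \<le> Hhat_at S \<alpha>"
      using h_ge[OF Bs_zero V0] H_ge[OF Bs_zero] norm_ge_zero[of "D 0 0"] by linarith
    have "norm (?f x - ?f y) \<le> Hhat_at S \<alpha> * norm (x - y)" if x: "x \<in> Bs S" and y: "y \<in> Bs S" for x y
    proof -
      define g where "g s = ?f (y + s *\<^sub>R (x - y))" for s :: real
      have seg: "y + s *\<^sub>R (x - y) \<in> Bs S" if "s \<in> {0..1}" for s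
      proof -
        have "y + s *\<^sub>R (x - y) = (1 - s) *\<^sub>R y + s *\<^sub>R x" by (simp add: algebra_simps)
        then show ?thesis using convexD[OF convex_Bs y x, of "1 - s" s] that by simp
      qed
      have "norm (g 1 - g 0) \<le> (Hhat_at S \<alpha> * norm (x - y)) * norm (1 - 0 :: real)"
      proof (rule differentiable_bound)
        fix s :: real assume s: "s \<in> {0..1}"
        let ?z = "y + s *\<^sub>R (x - y)"
        have 1: "((\<lambda>s. y + s *\<^sub>R (x - y)) has_derivative (\<lambda>h. h *\<^sub>R (x - y))) (at s within {0..1})"
          by (auto intro!: derivative_eq_intros)
        have 2: "(?f has_derivative D ?z) (at ?z within (\<lambda>s. y + s *\<^sub>R (x - y)) ` {0..1})"
          by (rule has_derivative_subset[OF D[OF seg[OF s]]]) (use seg in auto)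
        show "(g has_derivative (\<lambda>h. D ?z (h *\<^sub>R (x - y)))) (at s within {0..1})"
          using has_derivative_in_compose[OF 1 2] unfolding g_def[abs_def] .
        have "norm (D ?z (x - y)) \<le> Hhat_at S \<alpha> * norm (x - y)"
        proof (cases "x = y")
          case False
          \<comment> \<open>The inner supremum runs over the unit ball of \<open>Xs S\<close>, so
            the displacement is normalized.\<close>
          let ?v = "(x - y) /\<^sub>R norm (x - y)"
          have "?v \<in> V"
            using False Bs_Xs[OF x] Bs_Xs[OF y]
            by (auto simp: V_def intro!: subspace_scale[OF Xs_subspace] subspace_diff[OF Xs_subspace])
          then have "norm (D ?z ?v) \<le> Hhat_at S \<alpha>"
            using h_ge[OF seg[OF s]] H_ge[OF seg[OF s]] by force
          then show ?thesis using False
            by (simp add: linear_scale[OF lin[OF seg[OF s]]] divide_inverse[symmetric] pos_divide_le_eq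
                mult.commute[of "inverse _"])
        qed (use linear_0[OF lin[OF seg[OF s]]] in simp)
        then show "onorm (\<lambda>h. D ?z (h *\<^sub>R (x - y))) \<le> Hhat_at S \<alpha> * norm (x - y)"
          by (intro onorm_le) (simp add: linear_scale[OF lin[OF seg[OF s]]] mult.commute mult_left_mono)
      qed auto
      then show ?thesis by (simp add: g_def)
    qed
    then show ?thesis using H0 H_le by blast
  next
    case False
    define L where "L = {K. K-lipschitz_on (Bs S) ?f}"
    have H: "Hhat_at S \<alpha> = Inf L" using False by (simp add: Hhat_at_def L_def)
    have KL: "K0 \<in> L"
      unfolding L_def using K0_nonneg rem_s_diff_le_K0[OF \<alpha>] by (auto intro!: lipschitz_onI simp: dist_norm)
    have bdd: "bdd_below L" unfolding L_def bdd_below_def using lipschitz_on_nonneg by blast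
    have "0 \<le> Inf L" using KL by (intro cInf_greatest) (auto simp: L_def dest: lipschitz_on_nonneg)
    moreover have "Inf L \<le> K1" using cInf_lower[OF KL bdd] K0_le_K1 by simp
    moreover have "norm (?f x - ?f y) \<le> Inf L * norm (x - y)" if "x \<in> Bs S" "y \<in> Bs S" for x y
    proof (cases "x = y")
      case False
      \<comment> \<open>The infimum is attained: every difference quotient is a lower bound of the
        set of Lipschitz constants.\<close>
      have "norm (?f x - ?f y) / norm (x - y) \<le> Inf L"
      proof (rule cInf_greatest)
        fix K assume "K \<in> L"
        then have "dist (?f x) (?f y) \<le> K * dist x y"
          unfolding L_def using that by (auto intro: lipschitz_onD)
        then show "norm (?f x - ?f y) / norm (x - y) \<le> K"
          using False by (simp add: dist_norm pos_divide_le_eq)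
      qed (use KL in auto)
      then show ?thesis using False by (simp add: pos_divide_le_eq)
    qed simp
    ultimately show ?thesis unfolding H by blast
  qed
  then show "0 \<le> Hhat_at S \<alpha>" "Hhat_at S \<alpha> \<le> K1"
    "x \<in> Bs S \<Longrightarrow> y \<in> Bs S \<Longrightarrow> norm (?f x - ?f y) \<le> Hhat_at S \<alpha> * norm (x - y)" by blast+
qed

lemma Hhat_at_le_Hhat: "\<alpha> \<in> charts S \<Longrightarrow> Hhat_at S \<alpha> \<le> Hhat S"
  unfolding Hhat_def using Hhat_at_bounds(2) by (intro cSUP_upper) (auto simp: bdd_above_def)

lemma rem_s_diff_le_Hhat:
  assumes "\<alpha> \<in> charts S" "x \<in> Bs S" "y \<in> Bs S"
  shows "norm (rem_s S \<alpha> x - rem_s S \<alpha> y) \<le> Hhat S * norm (x - y)"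
  using Hhat_at_bounds(3)[OF assms] mult_right_mono[OF Hhat_at_le_Hhat[OF assms(1)], of "norm (x - y)"]
  by simp

lemma Hhat_nonneg: "\<alpha> \<in> charts S \<Longrightarrow> 0 \<le> Hhat S"
  using Hhat_at_bounds(1) Hhat_at_le_Hhat by (rule order_trans)

end

section \<open>Differences of trajectories\<close>

lemma generates_on_op_exp: "generates_on Y D A T \<Longrightarrow> generates_on Y D A (op_exp Y D A)"
  unfolding op_exp_def by (rule someI[of "generates_on Y D A"])

lemma exp_bound_on_generates: "exp_bound_on Y D A K r \<Longrightarrow> generates_on Y D A (op_exp Y D A)"
  unfolding exp_bound_on_def using generates_on_op_exp by blast

lemma exp_bound_onD:
  "exp_bound_on Y D A K r \<Longrightarrow> 0 \<le> t \<Longrightarrow> x \<in> Y \<Longrightarrow> norm (op_exp Y D A t x) \<le> K * exp (r * t) * norm x"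
  by (simp add: exp_bound_on_def)

lemma linear_op_on_uminus: "linear_op_on D A \<Longrightarrow> linear_op_on D (\<lambda>x. - A x)"
  by (simp add: linear_op_on_def)

context lp_setting
begin

lemma range_subset_closure:
  assumes P: "bounded_linear P" and PD: "\<And>x. x \<in> domL S \<Longrightarrow> P x \<in> domL S"
  shows "range P \<subseteq> closure (domL S \<inter> range P)"
proof -
  have "P ` closure (domL S) \<subseteq> closure (P ` domL S)"
    by (rule closure_bounded_linear_image_subset[OF P])
  also have "\<dots> \<subseteq> closure (domL S \<inter> range P)"
    using PD by (intro closure_mono) auto
  finally show ?thesis by (simp add: dense_dom)
qed

text \<open>\<open>E\<close> is picked by choice, so its action on components is not visible. The
  sum \<open>U\<close> of the component semigroups has the same generator, and uniqueness transfers
  the componentwise decay from \<open>U\<close> to \<open>E\<close>. Since the rates are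
  nonpositive, each component semigroup is a contraction, and the uniform bound is the sum of the
  bounds \<open>pn\<close>.\<close>

lemma direct_sum_semigroup:
  assumes J: "J \<subseteq> Iall S" and A: "linear_op_on (domL S) A"
    and bnd: "\<And>j. j \<in> J \<Longrightarrow> exp_bound_on (Xc S j) (domL S \<inter> Xc S j) A 1 (r j)"
    and r: "\<And>j. j \<in> J \<Longrightarrow> r j \<le> 0"
    and P: "\<And>x. P x = (\<Sum>j\<in>J. p j x)"
  defines "E \<equiv> op_exp (range P) (domL S \<inter> range P) A"
  shows "bounded_semigroup P E (\<Sum>j\<in>J. pn S j)"
    and "generates_on (range P) (domL S \<inter> range P) A E"
    and "\<And>t x j. 0 \<le> t \<Longrightarrow> x \<in> range P \<Longrightarrow> j \<in> J \<Longrightarrow> norm (p j (E t x)) \<le> exp (r j * t) * norm (p j x)"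
proof -
  define T where "T j = op_exp (Xc S j) (domL S \<inter> Xc S j) A" for j
  define U where "U = (\<lambda>t x. \<Sum>j\<in>J. T j t (p j x))"
  have fin: "finite J" using J finite_index(3) by (rule finite_subset)
  have JI: "j \<in> Iall S" if "j \<in> J" for j using J that by blast
  have P_eq: "P = (\<lambda>x. \<Sum>j\<in>J. p j x)" using P by blast
  have gen: "generates_on (range (p j)) (domL S \<inter> range (p j)) A (T j)" if "j \<in> J" for j
    unfolding T_def using exp_bound_on_generates[OF bnd[OF that]] by (simp add: Xc_def)
  have Tb: "norm (T j t (p j x)) \<le> exp (r j * t) * norm (p j x)" if "j \<in> J" "0 \<le> t" for j t x
    unfolding T_def using exp_bound_onD[OF bnd[OF that(1)] that(2), of "p j x"] by (simp add: Xc_def)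
  have genU: "generates_on (range P) (domL S \<inter> range P) A U"
    unfolding P_eq U_def
    by (rule generates_on_direct_sum[OF fin _ _ A _ gen]) (use p_bounded_linear p_orth p_dom JI in auto)
  have genE: "generates_on (range P) (domL S \<inter> range P) A E"
    unfolding E_def by (rule generates_on_op_exp[OF genU])
  have pP: "p j (P x) = p j x" if "j \<in> J" for j x
    using that fin by (simp add: P linear_sum[OF p_linear] JI p_orth sum.delta')
  have PP: "P (P x) = P x" for x
    using pP by (simp add: P[of "P x"]) (simp add: P)
  have Pbl: "bounded_linear P"
    unfolding P_eq by (intro bounded_linear_sum p_bounded_linear JI)
  have pn: "0 \<le> (\<Sum>j\<in>J. pn S j)" by (intro sum_nonneg pn_nonneg JI)
  have Ub: "norm (U t x) \<le> (\<Sum>j\<in>J. pn S j) * norm x" if t: "0 \<le> t" for t x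
  proof -
    have "norm (U t x) \<le> (\<Sum>j\<in>J. norm (T j t (p j x)))" unfolding U_def by (rule norm_sum)
    also have "\<dots> \<le> (\<Sum>j\<in>J. pn S j * norm x)"
    proof (rule sum_mono)
      fix j assume j: "j \<in> J"
      have "exp (r j * t) \<le> 1" using r[OF j] t by (simp add: mult_nonpos_nonneg)
      then have "exp (r j * t) * norm (p j x) \<le> 1 * norm (p j x)" by (intro mult_right_mono) auto
      then show "norm (T j t (p j x)) \<le> pn S j * norm x"
        using Tb[OF j t, of x] p_norm[OF JI[OF j], of x] by linarith
    qed
    finally show ?thesis by (simp add: sum_distrib_right)
  qed
  interpret U: bounded_semigroup P U "\<Sum>j\<in>J. pn S j"
    by (intro bounded_semigroup.intro c0_semigroup.intro bounded_semigroup_axioms.intro Pbl PP pn Ub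
        generates_onD(1)[OF genU])
  have dense: "range P \<subseteq> closure (domL S \<inter> range P)"
  proof (rule range_subset_closure[OF Pbl])
    show "P x \<in> domL S" if "x \<in> domL S" for x
      unfolding P using Lam_linear p_dom[OF JI that] by (intro subspace_sum) (auto simp: linear_op_on_def)
  qed
  have EU: "E t x = U t x" if "0 \<le> t" "x \<in> range P" for t x
    by (rule U.generated_semigroup_unique[OF genU genE dense that])
  show "bounded_semigroup P E (\<Sum>j\<in>J. pn S j)"
    by (intro bounded_semigroup.intro c0_semigroup.intro bounded_semigroup_axioms.intro Pbl PP pn
        generates_onD(1)[OF genE]) (simp only: EU Ub)
  show "generates_on (range P) (domL S \<inter> range P) A E" by (rule genE)
  fix t :: real and x j assume t: "0 \<le> t" and x: "x \<in> range P" and j: "j \<in> J"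
  have "p j (T i t (p i x)) = (if i = j then T j t (p j x) else 0)" if i: "i \<in> J" for i
  proof -
    have c0: "c0_semigroup (p i) (T i)"
      using p_orth[OF JI JI, OF i i]
      by (intro c0_semigroup.intro p_bounded_linear JI i generates_onD(1)[OF gen]) simp
    obtain z where "T i t (p i x) = p i z"
      using c0_semigroup.T_in[OF c0 t, of "p i x"] by blast
    then show ?thesis using p_orth[OF JI[OF j] JI[OF i]] by auto
  qed
  then have "p j (E t x) = T j t (p j x)"
    using j fin by (simp add: EU[OF t x] U_def linear_sum[OF p_linear[OF JI[OF j]]])
  then show "norm (p j (E t x)) \<le> exp (r j * t) * norm (p j x)" using Tb[OF j t] by simp
qed

definition Ms :: real where "Ms = (\<Sum>j\<in>Stb ` Is S. pn S j)"
definition Mu :: real where "Mu = (\<Sum>j\<in>Unst ` Iu S. pn S j)"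

lemma stable_semigroup:
  shows "bounded_semigroup (proj_s S) (expLs S) Ms"
    and "generates_on (range (proj_s S)) (domL S \<inter> range (proj_s S)) (Lam S) (expLs S)"
    and "\<And>t x j. 0 \<le> t \<Longrightarrow> x \<in> Xs S \<Longrightarrow> j \<in> Is S \<Longrightarrow>
      norm (p (Stb j) (expLs S t x)) \<le> exp (lam S (Stb j) * t) * norm (p (Stb j) x)"
proof -
  have P: "proj_s S x = (\<Sum>j\<in>Stb ` Is S. p j x)" for x
    by (simp add: proj_s_def sum.reindex inj_on_def)
  note * = direct_sum_semigroup[of "Stb ` Is S" "Lam S" "lam S" "proj_s S", OF _ Lam_linear _ _ P,
      folded expLs_def[unfolded Xs_def] Ms_def]
  show "bounded_semigroup (proj_s S) (expLs S) Ms"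
    by (rule *(1)) (use stable lam_neg in \<open>auto intro: less_imp_le\<close>)
  show "generates_on (range (proj_s S)) (domL S \<inter> range (proj_s S)) (Lam S) (expLs S)"
    by (rule *(2)) (use stable lam_neg in \<open>auto intro: less_imp_le\<close>)
  show "norm (p (Stb j) (expLs S t x)) \<le> exp (lam S (Stb j) * t) * norm (p (Stb j) x)"
    if "0 \<le> t" "x \<in> Xs S" "j \<in> Is S" for t x j
    by (rule *(3)) (use that stable lam_neg in \<open>auto intro: less_imp_le simp: Xs_def\<close>)
qed

lemma unstable_semigroup:
  shows "bounded_semigroup (proj_u S) (exp_minus_Lu S) Mu"
    and "\<And>t x j. 0 \<le> t \<Longrightarrow> x \<in> Xu S \<Longrightarrow> j \<in> Iu S \<Longrightarrow>
      norm (p (Unst j) (exp_minus_Lu S t x)) \<le> exp (- lam S (Unst j) * t) * norm (p (Unst j) x)"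
proof -
  have P: "proj_u S x = (\<Sum>j\<in>Unst ` Iu S. p j x)" for x
    by (simp add: proj_u_def sum.reindex inj_on_def)
  note * = direct_sum_semigroup[of "Unst ` Iu S" "\<lambda>x. - Lam S x" "\<lambda>j. - lam S j" "proj_u S",
      OF _ linear_op_on_uminus[OF Lam_linear] _ _ P, folded exp_minus_Lu_def[unfolded Xu_def] Mu_def]
  show "bounded_semigroup (proj_u S) (exp_minus_Lu S) Mu"
    by (rule *(1)) (use unstable unstable_pos in \<open>auto intro: less_imp_le\<close>)
  show "norm (p (Unst j) (exp_minus_Lu S t x)) \<le> exp (- lam S (Unst j) * t) * norm (p (Unst j) x)"
    if "0 \<le> t" "x \<in> Xu S" "j \<in> Iu S" for t x j
    by (rule *(3)) (use that unstable unstable_pos in \<open>auto intro: less_imp_le simp: Xu_def\<close>)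
qed

definition Sfull :: "real \<Rightarrow> 'a \<Rightarrow> 'a" where
  "Sfull = op_exp (Xs S) (domL S \<inter> Xs S) (\<lambda>x. Lam S x + proj_s S (Lop S x))"

lemma Sfull_bound: "0 \<le> t \<Longrightarrow> x \<in> Xs S \<Longrightarrow> norm (Sfull t x) \<le> C_s S * exp (lam_s S * t) * norm x"
  unfolding Sfull_def by (rule exp_bound_onD[OF stable_full])

sublocale unst: bounded_semigroup "proj_u S" "exp_minus_Lu S" Mu
  by (rule unstable_semigroup(1))

text \<open>\<open>expLs S\<close> occurs in the definition of solutions and acts diagonally on
  components; \<open>Sfull\<close> carries the decay rate \<open>lam_s S\<close>. The perturbation
  linking them is the stable block of the linearization, and \<open>C_s S\<close> bounds
  \<open>Sfull\<close> for all times because \<open>lam_s S\<close> is negative.\<close>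

sublocale pert: perturbed_semigroup "proj_s S" "expLs S" Ms Sfull "C_s S" "domL S \<inter> Xs S" "Lam S" "\<lambda>x. proj_s S (Lop S x)"
proof (intro perturbed_semigroup.intro perturbed_semigroup_axioms.intro stable_semigroup(1))
  have gen: "generates_on (Xs S) (domL S \<inter> Xs S) (\<lambda>x. Lam S x + proj_s S (Lop S x)) Sfull"
    unfolding Sfull_def by (rule exp_bound_on_generates[OF stable_full])
  show "bounded_semigroup (proj_s S) Sfull (C_s S)"
  proof (intro bounded_semigroup.intro c0_semigroup.intro bounded_semigroup_axioms.intro
      proj_s_bounded_linear proj_s_idem C_s)
    show "C0_semigroup_on (range (proj_s S)) Sfull"
      using generates_onD(1)[OF gen] by (simp add: Xs_def)
    show "norm (Sfull t x) \<le> C_s S * norm x" if t: "0 \<le> t" and x: "x \<in> range (proj_s S)" for t x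
    proof -
      have "norm (Sfull t x) \<le> C_s S * exp (lam_s S * t) * norm x"
        by (rule Sfull_bound[OF t]) (use x in \<open>simp add: Xs_def\<close>)
      also have "\<dots> \<le> C_s S * 1 * norm x"
        using t lam_s_neg C_s by (intro mult_right_mono mult_left_mono) (auto simp: mult_nonpos_nonneg)
      finally show ?thesis by simp
    qed
  qed
  show "generates_on (range (proj_s S)) (domL S \<inter> Xs S) (Lam S) (expLs S)"
    using stable_semigroup(2) by (simp add: Xs_def)
  show "generates_on (range (proj_s S)) (domL S \<inter> Xs S) (\<lambda>x. Lam S x + proj_s S (Lop S x)) Sfull"
    using gen by (simp add: Xs_def)
  show "range (proj_s S) \<subseteq> closure (domL S \<inter> Xs S)"
    unfolding Xs_def
  proof (rule range_subset_closure[OF proj_s_bounded_linear])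
    show "proj_s S x \<in> domL S" if "x \<in> domL S" for x
      unfolding proj_s_def using Lam_linear p_dom[OF _ that]
      by (intro subspace_sum) (auto simp: linear_op_on_def)
  qed
  show "bounded_linear (\<lambda>x. proj_s S (Lop S x))" by (rule proj_Lop_bounded_linear)
qed simp

section \<open>A priori bounds for solutions on finite intervals, before global existence is
  known\<close>

definition sol_upto :: "('a \<Rightarrow> 'a) \<Rightarrow> real \<Rightarrow> 'a \<Rightarrow> (real \<Rightarrow> 'a) \<Rightarrow> bool" where
  "sol_upto \<alpha> b \<xi> x \<longleftrightarrow> continuous_on {0..b} x \<and> (\<forall>t\<in>{0..b}. x t \<in> Bs S) \<and>
     (\<forall>t\<in>{0..b}. ((\<lambda>\<tau>. expLs S (t - \<tau>) (proj_s S (Nfull S (x \<tau> + \<alpha> (x \<tau>)))))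
                has_integral (x t - expLs S t \<xi>)) {0..t})"

lemma is_sol_upto: "is_sol S \<alpha> \<xi> x \<Longrightarrow> sol_upto \<alpha> b \<xi> x"
  unfolding is_sol_def sol_upto_def by (auto intro: continuous_on_subset)

lemma is_solI:
  assumes "continuous_on {0..} x" and "\<And>b. sol_upto \<alpha> b \<xi> x"
  shows "is_sol S \<alpha> \<xi> x"
  unfolding is_sol_def
proof (intro conjI allI impI assms(1))
  fix t :: real assume "0 \<le> t"
  with assms(2)[of t] show "x t \<in> Bs S"
    and "((\<lambda>\<tau>. expLs S (t - \<tau>) (proj_s S (Nfull S (x \<tau> + \<alpha> (x \<tau>))))) has_integral (x t - expLs S t \<xi>)) {0..t}"
    by (simp_all add: sol_upto_def)
qed

text \<open>Comparison with this solution turns bounds on differences into bounds on a single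
  solution.\<close>

lemma sol_upto_zero:
  assumes "\<alpha> \<in> charts S"
  shows "sol_upto \<alpha> b 0 (\<lambda>_. 0)"
proof -
  have "((\<lambda>\<tau>. expLs S (t - \<tau>) (proj_s S (Nfull S (0 + \<alpha> 0)))) has_integral (0 - expLs S t 0)) {0..t}"
    if t: "0 \<le> t" for t
  proof -
    have "((\<lambda>\<tau>. expLs S (t - \<tau>) (proj_s S (Nfull S (0 + \<alpha> 0)))) has_integral 0) {0..t}"
      by (rule has_integral_is_0)
        (simp add: charts_zero[OF assms] pert.T.T_zero linear_0[OF bounded_linear.linear[OF proj_s_bounded_linear]])
    then show ?thesis by (simp add: pert.T.T_zero[OF t])
  qed
  then show ?thesis by (simp add: sol_upto_def)
qed

lemma continuous_on_chart_field:
  assumes \<alpha>: "\<alpha> \<in> charts S" and x: "continuous_on A x" "\<And>t. t \<in> A \<Longrightarrow> x t \<in> Bs S"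
  shows "continuous_on A (\<lambda>t. Nfull S (x t + \<alpha> (x t)))"
  using x by (intro continuous_on_compose2[OF continuous_on_Nfull[of UNIV]] continuous_intros
      continuous_on_compose2[OF charts_continuous[OF \<alpha>]]) auto

context
  fixes \<alpha> b \<xi> \<zeta> x y
  assumes \<alpha>: "\<alpha> \<in> charts S" and x: "sol_upto \<alpha> b \<xi> x" and y: "sol_upto \<alpha> b \<zeta> y"
    and \<xi>: "\<xi> \<in> Bs S" and \<zeta>: "\<zeta> \<in> Bs S"
begin

private definition "f z \<tau> = proj_s S (Nfull S (z \<tau> + \<alpha> (z \<tau>)))" for z :: "real \<Rightarrow> 'a" and \<tau>

private lemma xB: "0 \<le> t \<Longrightarrow> t \<le> b \<Longrightarrow> x t \<in> Bs S" and yB: "0 \<le> t \<Longrightarrow> t \<le> b \<Longrightarrow> y t \<in> Bs S"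
  and cx: "continuous_on {0..b} x" and cy: "continuous_on {0..b} y"
  using x y by (auto simp: sol_upto_def)

private lemma f_in: "f z \<tau> \<in> Xs S" for z \<tau>
  by (simp add: f_def)

private lemma cf: "continuous_on {0..b} (f x)" "continuous_on {0..b} (f y)"
  unfolding f_def[abs_def]
  by (intro bounded_linear.continuous_on[OF proj_s_bounded_linear] continuous_on_chart_field \<alpha> cx cy; simp add: xB yB)+

private lemma diff_mild:
  assumes "0 \<le> t" "t \<le> b"
  shows "((\<lambda>\<tau>. expLs S (t - \<tau>) (f x \<tau> - f y \<tau>)) has_integral (x t - y t) - expLs S t (\<xi> - \<zeta>)) {0..t}"
proof -
  have 1: "((\<lambda>\<tau>. expLs S (t - \<tau>) (f x \<tau>) - expLs S (t - \<tau>) (f y \<tau>)) has_integral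
      (x t - expLs S t \<xi>) - (y t - expLs S t \<zeta>)) {0..t}"
    using x y assms by (intro has_integral_diff) (auto simp: sol_upto_def f_def)
  have 2: "(x t - expLs S t \<xi>) - (y t - expLs S t \<zeta>) = (x t - y t) - expLs S t (\<xi> - \<zeta>)"
    using pert.T.T_diff[OF assms(1), of \<xi> \<zeta>] Bs_Xs[OF \<xi>] Bs_Xs[OF \<zeta>] by (simp add: Xs_def)
  have 3: "expLs S (t - \<tau>) (f x \<tau>) - expLs S (t - \<tau>) (f y \<tau>) = expLs S (t - \<tau>) (f x \<tau> - f y \<tau>)"
    if "\<tau> \<in> {0..t}" for \<tau>
    using pert.T.T_diff[of "t - \<tau>" "f x \<tau>" "f y \<tau>"] f_in that by (simp add: Xs_def)
  show ?thesis by (rule has_integral_eq[OF 3 1[unfolded 2]])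
qed

lemma sol_upto_init: "0 \<le> b \<Longrightarrow> x 0 - y 0 = \<xi> - \<zeta>"
proof -
  assume "0 \<le> b"
  then have "((\<lambda>\<tau>. expLs S (0 - \<tau>) (f x \<tau> - f y \<tau>)) has_integral (x 0 - y 0) - expLs S 0 (\<xi> - \<zeta>)) {0}"
    using diff_mild[of 0] by simp
  from has_integral_unique[OF this has_integral_refl(2)]
  have "(x 0 - y 0) - expLs S 0 (\<xi> - \<zeta>) = 0" .
  moreover have "expLs S 0 (\<xi> - \<zeta>) = \<xi> - \<zeta>"
    using subspace_diff[OF Xs_subspace Bs_Xs[OF \<xi>] Bs_Xs[OF \<zeta>]] by (intro pert.T.T_0) (simp add: Xs_def)
  ultimately show ?thesis by simp
qed

text \<open>The difference of the fields is a linear term plus a difference of remainders. The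
  linear term is absorbed into \<open>Sfull\<close>, and the remainder has Lipschitz constant
  \<open>Hhat S\<close>. Gronwall with \<open>l = lam_s S\<close> and
  \<open>H = C_s S * Hhat S\<close> gives the rate \<open>l + H\<close>, which is
  \<open>gam S 0\<close>.\<close>

lemma sol_diff_le_global:
  assumes t: "0 \<le> t" "t \<le> b"
  shows "norm (x t - y t) \<le> C_s S * exp (gam S 0 * t) * norm (\<xi> - \<zeta>)"
proof -
  define g where "g \<tau> = rem_s S \<alpha> (x \<tau>) - rem_s S \<alpha> (y \<tau>)" for \<tau>
  define B where "B = (\<lambda>x. proj_s S (Lop S x))"
  have lB: "linear B" unfolding B_def by (rule bounded_linear.linear[OF proj_Lop_bounded_linear])
  have fg: "f x \<tau> - f y \<tau> = B (x \<tau> - y \<tau>) + g \<tau>" for \<tau>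
    by (simp add: g_def rem_s_eq f_def linear_diff[OF lB]) (simp add: B_def)
  have g_eq: "g = (\<lambda>\<tau>. f x \<tau> - f y \<tau> - B (x \<tau> - y \<tau>))" using fg by (simp add: fun_eq_iff)
  have cu: "continuous_on {0..b} (\<lambda>\<tau>. x \<tau> - y \<tau>)" by (intro continuous_intros cx cy)
  have cg: "continuous_on {0..b} g"
    unfolding g_eq B_def
    by (intro continuous_intros cf bounded_linear.continuous_on[OF proj_Lop_bounded_linear] cx cy)
  have uX: "x \<tau> - y \<tau> \<in> Xs S" if "0 \<le> \<tau>" "\<tau> \<le> b" for \<tau>
    using Bs_Xs[OF xB[OF that]] Bs_Xs[OF yB[OF that]] by (rule subspace_diff[OF Xs_subspace])
  have gX: "g \<tau> \<in> Xs S" for \<tau>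
    unfolding g_def rem_s_eq by (intro subspace_diff[OF Xs_subspace] proj_s_in)
  have mild: "((\<lambda>s. Sfull (r - s) (g s)) has_integral (x r - y r) - Sfull r (\<xi> - \<zeta>)) {0..r}" if r: "0 \<le> r" "r \<le> b" for r
  proof -
    have "((\<lambda>s. Sfull (r - s) (g s)) has_integral (x r - y r) - Sfull r (x 0 - y 0)) {0..r}"
    proof (rule pert.mild_solution_perturbed[OF cu cg _ _ _ _ r])
      show "((\<lambda>s. expLs S (t - s) (proj_s S (Lop S (x s - y s)) + g s)) has_integral x t - y t - expLs S t (\<xi> - \<zeta>)) {0..t}"
        if "0 \<le> t" "t \<le> b" for t
        using diff_mild[OF that] unfolding fg B_def .
      show "\<xi> - \<zeta> \<in> range (proj_s S)"
        using subspace_diff[OF Xs_subspace Bs_Xs[OF \<xi>] Bs_Xs[OF \<zeta>]] by (simp add: Xs_def)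
    qed (use uX gX in \<open>simp_all add: Xs_def\<close>)
    moreover have "x 0 - y 0 = \<xi> - \<zeta>" using r by (intro sol_upto_init) simp
    ultimately show ?thesis by simp
  qed
  have "norm (x t - y t) \<le> C_s S * norm (\<xi> - \<zeta>) * exp (gam S 0 * t)"
  proof (rule gronwall_compare[where u = "\<lambda>t. norm (x t - y t)" and w = "\<lambda>t. C_s S * norm (\<xi> - \<zeta>) * exp (gam S 0 * t)"
        and H = "C_s S * Hhat S" and l = "lam_s S" and b = "\<lambda>_. 0" and c = "\<lambda>_. 0" and T = b
        and a = "C_s S * norm (\<xi> - \<zeta>)", OF _ _ _ _ _ _ _ _ t])
    show "continuous_on {0..b} (\<lambda>t. norm (x t - y t))" by (intro continuous_intros cx cy)
    show "0 \<le> C_s S * Hhat S" using C_s Hhat_nonneg[OF \<alpha>] by simp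
    show "((\<lambda>t. C_s S * norm (\<xi> - \<zeta>) * exp (gam S 0 * t)) has_real_derivative
        (lam_s S + C_s S * Hhat S) * (C_s S * norm (\<xi> - \<zeta>) * exp (gam S 0 * t)) + 0) (at t)" for t
      by (auto intro!: derivative_eq_intros simp: gam_def algebra_simps)
    fix r assume r: "0 \<le> r" "r \<le> b"
    have uX0: "\<xi> - \<zeta> \<in> Xs S" by (rule subspace_diff[OF Xs_subspace Bs_Xs[OF \<xi>] Bs_Xs[OF \<zeta>]])
    have "norm (x r - y r - Sfull r (\<xi> - \<zeta>)) \<le> integral {0..r} (\<lambda>s. exp (lam_s S * (r - s)) * (C_s S * Hhat S * norm (x s - y s) + 0))"
      unfolding integral_unique[OF mild[OF r], symmetric]
    proof (rule integral_norm_bound_integral)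
      show "(\<lambda>s. Sfull (r - s) (g s)) integrable_on {0..r}" using mild[OF r] by blast
      show "(\<lambda>s. exp (lam_s S * (r - s)) * (C_s S * Hhat S * norm (x s - y s) + 0)) integrable_on {0..r}"
        using r by (intro integrable_continuous_real continuous_intros continuous_on_subset[OF cx] continuous_on_subset[OF cy]) auto
      fix s assume s: "s \<in> {0..r}"
      have "norm (Sfull (r - s) (g s)) \<le> C_s S * exp (lam_s S * (r - s)) * norm (g s)"
        using s by (intro Sfull_bound gX) auto
      also have "\<dots> \<le> C_s S * exp (lam_s S * (r - s)) * (Hhat S * norm (x s - y s))"
        unfolding g_def using s r C_s by (intro mult_left_mono rem_s_diff_le_Hhat \<alpha> xB yB) auto
      finally show "norm (Sfull (r - s) (g s)) \<le> exp (lam_s S * (r - s)) * (C_s S * Hhat S * norm (x s - y s) + 0)"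
        by (simp add: mult_ac)
    qed
    moreover have "norm (Sfull r (\<xi> - \<zeta>)) \<le> exp (lam_s S * r) * (C_s S * norm (\<xi> - \<zeta>))"
      using Sfull_bound[OF r(1) uX0] by (simp add: mult_ac)
    moreover have "norm (x r - y r) \<le> norm (Sfull r (\<xi> - \<zeta>)) + norm (x r - y r - Sfull r (\<xi> - \<zeta>))"
      using norm_triangle_ineq[of "Sfull r (\<xi> - \<zeta>)" "x r - y r - Sfull r (\<xi> - \<zeta>)"] by simp
    ultimately show "norm (x r - y r) \<le> exp (lam_s S * r) * (C_s S * norm (\<xi> - \<zeta>)) +
        integral {0..r} (\<lambda>s. exp (lam_s S * (r - s)) * (C_s S * Hhat S * norm (x s - y s) + 0))"
      by linarith
  qed auto
  then show ?thesis by (simp add: mult_ac)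
qed

text \<open>Here the unperturbed semigroup is used, because it respects the components and decays
  like \<open>exp (lam S (Stb j) * t)\<close> on the one in question. The whole nonlinearity, with
  its linear part, enters through row \<open>j\<close> of \<open>Hc\<close>, whose diagonal entry is
  kept apart for the later Gronwall step.\<close>

lemma sol_diff_le_component:
  assumes t: "0 \<le> t" "t \<le> b" and j: "j \<in> Is S"
  shows "norm (p (Stb j) (x t - y t)) \<le> exp (lam S (Stb j) * t) * norm (p (Stb j) (\<xi> - \<zeta>))
    + integral {0..t} (\<lambda>s. exp (lam S (Stb j) * (t - s)) *
        (Hc S (Stb j) j * norm (p (Stb j) (x s - y s))
         + (\<Sum>i\<in>Is S - {j}. Hc S (Stb j) i * norm (p (Stb i) (x s - y s)))))"
proof -
  let ?h = "\<lambda>s. exp (lam S (Stb j) * (t - s)) *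
        (Hc S (Stb j) j * norm (p (Stb j) (x s - y s))
         + (\<Sum>i\<in>Is S - {j}. Hc S (Stb j) i * norm (p (Stb i) (x s - y s))))"
  have pj: "bounded_linear (p (Stb j))" using j by (intro p_bounded_linear) simp
  have uX0: "\<xi> - \<zeta> \<in> Xs S" by (rule subspace_diff[OF Xs_subspace Bs_Xs[OF \<xi>] Bs_Xs[OF \<zeta>]])
  have 1: "((\<lambda>\<tau>. p (Stb j) (expLs S (t - \<tau>) (f x \<tau> - f y \<tau>))) has_integral
      p (Stb j) ((x t - y t) - expLs S t (\<xi> - \<zeta>))) {0..t}"
    using has_integral_linear[OF diff_mild[OF t] pj] by (simp add: o_def)
  have "norm (p (Stb j) ((x t - y t) - expLs S t (\<xi> - \<zeta>))) \<le> integral {0..t} ?h"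
    unfolding integral_unique[OF 1, symmetric]
  proof (rule integral_norm_bound_integral)
    show "(\<lambda>\<tau>. p (Stb j) (expLs S (t - \<tau>) (f x \<tau> - f y \<tau>))) integrable_on {0..t}" using 1 by blast
    have "continuous_on {0..t} x" "continuous_on {0..t} y"
      using t by (auto intro: continuous_on_subset[OF cx] continuous_on_subset[OF cy])
    then show "?h integrable_on {0..t}"
      using j by (intro integrable_continuous_real continuous_intros bounded_linear.continuous_on[OF p_bounded_linear]) auto
    fix s assume s: "s \<in> {0..t}"
    have fX: "f x s - f y s \<in> Xs S" by (rule subspace_diff[OF Xs_subspace f_in f_in])
    have "norm (p (Stb j) (f x s - f y s)) = norm (p (Stb j) (Nfull S (x s + \<alpha> (x s))) - p (Stb j) (Nfull S (y s + \<alpha> (y s))))"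
      using j by (simp add: f_def linear_diff[OF p_linear])
    also have "\<dots> \<le> (\<Sum>i\<in>Is S. Hc S (Stb j) i * norm (p (Stb i) (x s - y s)))"
      using s t j by (intro p_Nfull_chart_diff_le \<alpha> xB yB) auto
    also have "\<dots> = Hc S (Stb j) j * norm (p (Stb j) (x s - y s))
         + (\<Sum>i\<in>Is S - {j}. Hc S (Stb j) i * norm (p (Stb i) (x s - y s)))"
      using j by (intro sum.remove) auto
    finally have "norm (p (Stb j) (f x s - f y s)) \<le> \<dots>" .
    then have "exp (lam S (Stb j) * (t - s)) * norm (p (Stb j) (f x s - f y s)) \<le> ?h s"
      by (intro mult_left_mono) auto
    moreover have "norm (p (Stb j) (expLs S (t - s) (f x s - f y s)))
        \<le> exp (lam S (Stb j) * (t - s)) * norm (p (Stb j) (f x s - f y s))"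
      using s fX j by (intro stable_semigroup(3)) auto
    ultimately show "norm (p (Stb j) (expLs S (t - s) (f x s - f y s))) \<le> ?h s"
      by (rule order_trans[rotated])
  qed
  moreover have "norm (p (Stb j) (expLs S t (\<xi> - \<zeta>))) \<le> exp (lam S (Stb j) * t) * norm (p (Stb j) (\<xi> - \<zeta>))"
    by (rule stable_semigroup(3)[OF t(1) uX0 j])
  moreover have "norm (p (Stb j) (x t - y t)) \<le> norm (p (Stb j) (expLs S t (\<xi> - \<zeta>)))
      + norm (p (Stb j) ((x t - y t) - expLs S t (\<xi> - \<zeta>)))"
    using norm_triangle_ineq[of "p (Stb j) (expLs S t (\<xi> - \<zeta>))" "p (Stb j) ((x t - y t) - expLs S t (\<xi> - \<zeta>))"]
    by (simp add: linear_diff[OF bounded_linear.linear[OF pj]])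
  ultimately show ?thesis by linarith
qed

end

end

section \<open>The bootstrapped tensor\<close>

definition tensor_sum :: "('a::banach, 'z) lp_data_scheme \<Rightarrow> tensor \<Rightarrow> nat \<Rightarrow> nat \<Rightarrow> real \<Rightarrow> real" where
  "tensor_sum S G j n t = (\<Sum>k\<in>{0..ms S}. exp (gam S k * t) * G j k n)"

locale lp_rates = lp_setting +
  assumes gam_Suc: "\<And>k. k < ms S \<Longrightarrow> gam S k > gam S (k + 1)"
begin

lemma gam_antimono: "k < l \<Longrightarrow> l \<le> ms S \<Longrightarrow> gam S l < gam S k"
proof (induction l)
  case (Suc l)
  then show ?case using gam_Suc[of l] by (cases "k = l") auto
qed simp

lemma gam_neq: "k \<le> ms S \<Longrightarrow> l \<le> ms S \<Longrightarrow> k \<noteq> l \<Longrightarrow> gam S k \<noteq> gam S l"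
  using gam_antimono[of k l] gam_antimono[of l k] by (cases "k < l") auto

text \<open>The resonant term of rate \<open>\<gamma>\<^sub>j\<close> is absorbed into a neighbouring rate, in the direction that its sign allows.\<close>

lemma tensor_sum_le_Qop:
  assumes j: "j \<in> Is S" and t: "0 \<le> t"
  shows "tensor_sum S G i n t \<le> tensor_sum S (Qop j G) i n t"
proof -
  define g where "g = G i j n"
  let ?e = "\<lambda>k. exp (gam S k * t)"
  have j1: "1 \<le> j" "j \<le> ms S" using j by (auto simp: Is_def)
  have "tensor_sum S (Qop j G) i n t - tensor_sum S G i n t
    = (\<Sum>k\<in>{0..ms S}. ?e k * (Qop j G i k n - G i k n))"
    by (simp add: tensor_sum_def right_diff_distrib sum_subtractf)
  \<comment> \<open>The entry at \<open>j\<close> is deleted and moved to \<open>j - 1\<close> if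
    positive, to \<open>j + 1\<close> if negative. The slot \<open>j - 1\<close> always exists since
    rates start at index 0. For \<open>j = ms S\<close> there is no slot \<open>j + 1\<close>, but
    deleting a negative entry already raises the sum.\<close>
  also have "\<dots> = (\<Sum>k\<in>{0..ms S}. (if k = j then - (?e j * g) else 0)
      + (if k = j - 1 then ?e (j - 1) * max g 0 else 0) + (if k = j + 1 then ?e (j + 1) * min g 0 else 0))"
    using j1 by (intro sum.cong) (auto simp: Qop_def g_def)
  also have "\<dots> = - (?e j * g) + ?e (j - 1) * max g 0 + (if j + 1 \<le> ms S then ?e (j + 1) * min g 0 else 0)"
    using j1 by (simp add: sum.distrib sum.delta)
  also have "\<dots> \<ge> 0"
  proof (cases "0 \<le> g")
    case True
    have "gam S j * t \<le> gam S (j - 1) * t"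
      using gam_antimono[of "j - 1" j] j1 t by (intro mult_right_mono) auto
    then show ?thesis using True by (simp add: mult_right_mono max_absorb1 min_absorb2)
  next
    case False
    have "?e (j + 1) \<le> ?e j" if "j + 1 \<le> ms S"
      using gam_antimono[of j "j + 1"] that t by (auto intro!: mult_right_mono)
    then have "?e (j + 1) * g \<ge> ?e j * g" if "j + 1 \<le> ms S"
      using False that by (intro mult_right_mono_neg) auto
    then show ?thesis using False by (auto simp: mult_nonneg_nonpos)
  qed
  finally show ?thesis by simp
qed

text \<open>The formula for \<open>Top\<close> is undetermined coefficients: each forcing term of
  rate \<open>gam S k\<close> is divided by \<open>gam S k - gam S j\<close>, and the coefficient of
  the homogeneous solution adjusts the initial value. Since \<open>Qop\<close> has emptied slot
  \<open>j\<close>, no resonant term arises, and distinct rates make the divisions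
  legitimate.\<close>

lemma boot_row_derivative:
  assumes j: "j \<in> Is S"
  shows "((\<lambda>t. tensor_sum S (boot_row S j G) j n t) has_real_derivative
    gam S j * tensor_sum S (boot_row S j G) j n t + (\<Sum>i\<in>Is S - {j}. Hc S (Stb j) i * tensor_sum S (Qop j G) i n t)) (at t)"
    and "tensor_sum S (boot_row S j G) j n 0 = (if n = j then 1 else 0)"
proof -
  define Q where "Q = Qop j G"
  define K where "K = {0..ms S} - {j}"
  define \<delta> :: real where "\<delta> = (if n = j then 1 else 0)"
  have j1: "j \<in> {0..ms S}" "j \<le> ms S" using j by (auto simp: Is_def)
  have K: "finite K" "\<And>k. k \<in> K \<Longrightarrow> k \<noteq> j \<and> k \<le> ms S" by (auto simp: K_def)
  have Topj: "Top S j Q j n = \<delta> - (\<Sum>k\<in>K. Top S j Q k n)"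
  proof -
    have "(\<Sum>k\<in>K. Top S j Q k n) = (\<Sum>k\<in>K. \<Sum>i\<in>Is S - {j}. inverse (gam S k - gam S j) * Hc S (Stb j) i * Q i k n)"
      using K(2) by (intro sum.cong) (auto simp: Top_def)
    also have "\<dots> = (\<Sum>i\<in>Is S - {j}. \<Sum>k\<in>K. inverse (gam S k - gam S j) * Hc S (Stb j) i * Q i k n)"
      by (rule sum.swap)
    finally show ?thesis by (simp add: Top_def[of S j Q j] \<delta>_def K_def)
  qed
  have E: "tensor_sum S (boot_row S j G) j n t = exp (gam S j * t) * Top S j Q j n + (\<Sum>k\<in>K. exp (gam S k * t) * Top S j Q k n)" for t
    unfolding tensor_sum_def K_def using j1 by (subst sum.remove[of _ j]) (auto simp: boot_row_def Q_def)
  show "tensor_sum S (boot_row S j G) j n 0 = (if n = j then 1 else 0)"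
    unfolding E Topj by (simp add: \<delta>_def)
  have QE: "tensor_sum S Q i n t = (\<Sum>k\<in>K. exp (gam S k * t) * Q i k n)" for i
    unfolding tensor_sum_def K_def using j1 by (subst sum.remove[of _ j]) (auto simp: Q_def Qop_def)
  have key: "(gam S k - gam S j) * Top S j Q k n = (\<Sum>i\<in>Is S - {j}. Hc S (Stb j) i * Q i k n)" if "k \<in> K" for k
  proof -
    have "gam S k - gam S j \<noteq> 0" using gam_neq[of k j] K(2)[OF that] j1 by simp
    then show ?thesis using K(2)[OF that] by (simp add: Top_def sum_distrib_left mult.assoc[symmetric])
  qed
  have "(\<Sum>i\<in>Is S - {j}. Hc S (Stb j) i * tensor_sum S Q i n t) = (\<Sum>k\<in>K. exp (gam S k * t) * (\<Sum>i\<in>Is S - {j}. Hc S (Stb j) i * Q i k n))"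
    unfolding QE sum_distrib_left by (subst sum.swap) (simp add: mult_ac)
  also have "\<dots> = (\<Sum>k\<in>K. exp (gam S k * t) * ((gam S k - gam S j) * Top S j Q k n))"
    by (intro sum.cong) (simp_all add: key)
  finally have forcing: "(\<Sum>i\<in>Is S - {j}. Hc S (Stb j) i * tensor_sum S Q i n t)
    = (\<Sum>k\<in>K. exp (gam S k * t) * ((gam S k - gam S j) * Top S j Q k n))" .
  have "((\<lambda>t. exp (gam S j * t) * Top S j Q j n + (\<Sum>k\<in>K. exp (gam S k * t) * Top S j Q k n)) has_real_derivative
      gam S j * exp (gam S j * t) * Top S j Q j n + (\<Sum>k\<in>K. gam S k * exp (gam S k * t) * Top S j Q k n)) (at t)"
    by (auto intro!: derivative_eq_intros DERIV_sum sum.cong simp: mult_ac)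
  moreover have "gam S j * exp (gam S j * t) * Top S j Q j n + (\<Sum>k\<in>K. gam S k * exp (gam S k * t) * Top S j Q k n)
    = gam S j * tensor_sum S (boot_row S j G) j n t + (\<Sum>i\<in>Is S - {j}. Hc S (Stb j) i * tensor_sum S Q i n t)"
    unfolding forcing E by (simp add: distrib_left sum_distrib_left algebra_simps sum_subtractf flip: sum.distrib)
  ultimately show "((\<lambda>t. tensor_sum S (boot_row S j G) j n t) has_real_derivative
    gam S j * tensor_sum S (boot_row S j G) j n t + (\<Sum>i\<in>Is S - {j}. Hc S (Stb j) i * tensor_sum S (Qop j G) i n t)) (at t)"
    unfolding Q_def[symmetric] E by simp
qed

lemma continuous_on_tensor_sum [continuous_intros]: "continuous_on A (tensor_sum S G i n)"
  unfolding tensor_sum_def[abs_def] by (intro continuous_intros)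

text \<open>Stated for the exponential sums, since single entries can be negative:
  \<open>Top\<close> divides by \<open>gam S k - gam S j\<close>, which is negative for
  \<open>k > j\<close>.\<close>

definition nonneg_tensor :: "tensor \<Rightarrow> bool" where
  "nonneg_tensor G \<longleftrightarrow> (\<forall>i\<in>Is S. \<forall>n\<in>Is S. \<forall>t\<ge>0. 0 \<le> tensor_sum S G i n t)"

definition dominates :: "tensor \<Rightarrow> real \<Rightarrow> (nat \<Rightarrow> real) \<Rightarrow> (nat \<Rightarrow> real \<Rightarrow> real) \<Rightarrow> bool" where
  "dominates G b d u \<longleftrightarrow> (\<forall>i\<in>Is S. \<forall>t\<in>{0..b}. u i t \<le> (\<Sum>n\<in>Is S. tensor_sum S G i n t * d n))"

lemma tensor_sum_boot_row_other: "i \<noteq> j \<Longrightarrow> tensor_sum S (boot_row S j G) i n t = tensor_sum S G i n t"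
  by (simp add: tensor_sum_def boot_row_def)

text \<open>The new row sums solve a scalar linear equation with nonnegative initial value. Its
  forcing is nonnegative because the sums of \<open>Qop j G\<close> dominate those of
  \<open>G\<close>. Comparison with the zero function gives the sign.\<close>

lemma nonneg_boot_row:
  assumes j: "j \<in> Is S" and G: "nonneg_tensor G"
  shows "nonneg_tensor (boot_row S j G)"
  unfolding nonneg_tensor_def
proof (intro ballI allI impI)
  fix i n t assume i: "i \<in> Is S" and n: "n \<in> Is S" and t: "0 \<le> (t::real)"
  show "0 \<le> tensor_sum S (boot_row S j G) i n t"
  proof (cases "i = j")
    case True
    define c where "c t = (\<Sum>i\<in>Is S - {j}. Hc S (Stb j) i * tensor_sum S (Qop j G) i n t)" for t
    have c: "0 \<le> c s" if "0 \<le> s" for s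
      unfolding c_def
    proof (intro sum_nonneg mult_nonneg_nonneg Hc_nonneg)
      fix i assume i: "i \<in> Is S - {j}"
      show "0 \<le> tensor_sum S (Qop j G) i n s"
        using tensor_sum_le_Qop[OF j that, of G i n] G i n that unfolding nonneg_tensor_def by force
    qed (use j in auto)
    have "0 \<le> tensor_sum S (boot_row S j G) j n t"
    proof (rule gronwall_compare[where u = "\<lambda>_. 0" and b = "\<lambda>_. 0" and c = c and T = t and H = 0
          and l = "gam S j" and a = 0 and w = "tensor_sum S (boot_row S j G) j n"])
      show "continuous_on UNIV c" unfolding c_def[abs_def] by (intro continuous_intros)
      show "0 \<le> tensor_sum S (boot_row S j G) j n 0" by (simp add: boot_row_derivative(2)[OF j])
      show "(tensor_sum S (boot_row S j G) j n has_real_derivative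
          (gam S j + 0) * tensor_sum S (boot_row S j G) j n t + c t) (at t)" for t
        using boot_row_derivative(1)[OF j, of G n t] by (simp add: c_def)
    qed (use t c in auto)
    then show ?thesis using True by simp
  next
    case False
    then show ?thesis using G i n t by (simp add: tensor_sum_boot_row_other nonneg_tensor_def)
  qed
qed

text \<open>Gronwall is applied with \<open>l = lam S (Stb j)\<close> and
  \<open>H = Hc S (Stb j) j\<close>, so the diagonal coupling turns the linear rate into
  \<open>gam S j\<close>. The other components act as forcing, estimated through
  \<open>Qop j G\<close>, and the new row sums solve the equation with exactly this forcing.\<close>

lemma dominates_boot_row:
  assumes j: "j \<in> Is S" and G: "dominates G b d u"
    and d: "\<And>n. n \<in> Is S \<Longrightarrow> 0 \<le> d n"
    and cu: "\<And>i. i \<in> Is S \<Longrightarrow> continuous_on {0..b} (u i)"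
    and u: "\<And>t. 0 \<le> t \<Longrightarrow> t \<le> b \<Longrightarrow> u j t \<le> exp (lam S (Stb j) * t) * d j
      + integral {0..t} (\<lambda>s. exp (lam S (Stb j) * (t - s)) *
          (Hc S (Stb j) j * u j s + (\<Sum>i\<in>Is S - {j}. Hc S (Stb j) i * u i s)))"
  shows "dominates (boot_row S j G) b d u"
  unfolding dominates_def
proof (intro ballI)
  fix i t assume i: "i \<in> Is S" and t: "t \<in> {0..b}"
  show "u i t \<le> (\<Sum>n\<in>Is S. tensor_sum S (boot_row S j G) i n t * d n)"
  proof (cases "i = j")
    case True
    define w where "w t = (\<Sum>n\<in>Is S. tensor_sum S (boot_row S j G) j n t * d n)" for t
    define c where "c t = (\<Sum>n\<in>Is S. (\<Sum>i\<in>Is S - {j}. Hc S (Stb j) i * tensor_sum S (Qop j G) i n t) * d n)" for t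
    have gj: "lam S (Stb j) + Hc S (Stb j) j = gam S j" using j by (simp add: gam_def Is_def)
    have "u j t \<le> w t"
    proof (rule gronwall_compare[where c = c and T = b and H = "Hc S (Stb j) j" and l = "lam S (Stb j)" and a = "d j"
          and b = "\<lambda>s. \<Sum>i\<in>Is S - {j}. Hc S (Stb j) i * u i s", OF _ _ _ _ _ _ _ u])
      show "continuous_on {0..b} (u j)" using cu j by simp
      show "continuous_on {0..b} (\<lambda>s. \<Sum>i\<in>Is S - {j}. Hc S (Stb j) i * u i s)"
        using cu by (intro continuous_intros) auto
      show "continuous_on UNIV c" unfolding c_def[abs_def] by (intro continuous_intros)
      show "0 \<le> Hc S (Stb j) j" using j by (intro Hc_nonneg) auto
      have "w 0 = (\<Sum>n\<in>Is S. if n = j then d n else 0)"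
        unfolding w_def by (intro sum.cong) (simp_all add: boot_row_derivative(2)[OF j])
      then show "d j \<le> w 0" using j by simp
      show "(w has_real_derivative (lam S (Stb j) + Hc S (Stb j) j) * w r + c r) (at r)" for r
      proof -
        have "(w has_real_derivative (\<Sum>n\<in>Is S. (gam S j * tensor_sum S (boot_row S j G) j n r
            + (\<Sum>i\<in>Is S - {j}. Hc S (Stb j) i * tensor_sum S (Qop j G) i n r)) * d n)) (at r)"
          unfolding w_def[abs_def] by (intro DERIV_sum DERIV_cmult_right boot_row_derivative(1) j)
        then show ?thesis
          unfolding gj by (simp add: w_def c_def distrib_right sum.distrib sum_distrib_left mult.assoc)
      qed
      fix s assume s: "0 \<le> s" "s \<le> b"
      have "(\<Sum>i\<in>Is S - {j}. Hc S (Stb j) i * u i s)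
        \<le> (\<Sum>i\<in>Is S - {j}. Hc S (Stb j) i * (\<Sum>n\<in>Is S. tensor_sum S (Qop j G) i n s * d n))"
      proof (intro sum_mono mult_left_mono Hc_nonneg)
        fix i assume i: "i \<in> Is S - {j}"
        have "u i s \<le> (\<Sum>n\<in>Is S. tensor_sum S G i n s * d n)" using G i s by (simp add: dominates_def)
        also have "\<dots> \<le> (\<Sum>n\<in>Is S. tensor_sum S (Qop j G) i n s * d n)"
          using s d by (intro sum_mono mult_right_mono tensor_sum_le_Qop j)
        finally show "u i s \<le> \<dots>" .
      qed (use j in auto)
      also have "\<dots> = c s"
        unfolding c_def sum_distrib_left sum_distrib_right by (subst sum.swap) (simp add: mult.assoc)
      finally show "(\<Sum>i\<in>Is S - {j}. Hc S (Stb j) i * u i s) \<le> c s" .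
    qed (use t in auto)
    then show ?thesis using True by (simp add: w_def)
  next
    case False
    then show ?thesis using G i t by (simp add: tensor_sum_boot_row_other dominates_def)
  qed
qed

text \<open>Rows are replaced in place, so later rows already see the earlier ones. It therefore
  suffices that an invariant survives each single replacement.\<close>

lemma boot_sweep_invariant:
  assumes "I G" and step: "\<And>j G. j \<in> Is S \<Longrightarrow> I G \<Longrightarrow> I (boot_row S j G)"
  shows "I (boot_sweep S G)"
proof -
  have "I (fold (boot_row S) js G)" if "set js \<subseteq> Is S" "I G" for js G
    using that by (induction js arbitrary: G) (auto intro: step)
  moreover have "set [1..<ms S + 1] \<subseteq> Is S" by (auto simp: Is_def)
  ultimately show ?thesis using assms(1) unfolding boot_sweep_def by blast
qed

lemma Gout_invariant:
  assumes init: "I (G_init S)" and step: "\<And>j G. j \<in> Is S \<Longrightarrow> I G \<Longrightarrow> I (boot_row S j G)"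
  shows "I (Gout S)"
proof -
  have "I ((boot_sweep S ^^ N) (G_init S))" for N
    by (induction N) (auto intro: init boot_sweep_invariant step)
  then show ?thesis by (simp add: Gout_def)
qed

lemma tensor_sum_G_init: "tensor_sum S (G_init S) j n t = exp (gam S 0 * t) * (pn S (Stb j) * C_s S)"
proof -
  have "tensor_sum S (G_init S) j n t = (\<Sum>k\<in>{0..ms S}. if k = 0 then exp (gam S 0 * t) * (pn S (Stb j) * C_s S) else 0)"
    unfolding tensor_sum_def by (intro sum.cong) (auto simp: G_init_def)
  then show ?thesis by simp
qed

lemma nonneg_Gout: "nonneg_tensor (Gout S)"
proof (rule Gout_invariant)
  show "nonneg_tensor (G_init S)"
    using pn_nonneg C_s by (simp add: nonneg_tensor_def tensor_sum_G_init)
qed (rule nonneg_boot_row)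

lemma sol_diff_le_Gout:
  assumes \<alpha>: "\<alpha> \<in> charts S" and x: "sol_upto \<alpha> b \<xi> x" and y: "sol_upto \<alpha> b \<zeta> y"
    and \<xi>: "\<xi> \<in> Bs S" and \<zeta>: "\<zeta> \<in> Bs S" and j: "j \<in> Is S" and t: "0 \<le> t" "t \<le> b"
  shows "norm (p (Stb j) (x t - y t)) \<le> (\<Sum>n\<in>Is S. tensor_sum S (Gout S) j n t * norm (p (Stb n) (\<xi> - \<zeta>)))"
proof -
  define u where "u i s = norm (p (Stb i) (x s - y s))" for i s
  define d where "d n = norm (p (Stb n) (\<xi> - \<zeta>))" for n
  have "dominates (Gout S) b d u"
  proof (rule Gout_invariant)
    \<comment> \<open>The initial tensor encodes the global bound: \<open>pn\<close> passes from the
      full norm to a component, \<open>C_s S\<close> is the constant of the decay, and the norm of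
      the initial difference is at most the sum of its component norms, so the entry is the same for
      every \<open>n\<close>.\<close>
    show "dominates (G_init S) b d u"
      unfolding dominates_def
    proof (intro ballI)
      fix i s assume i: "i \<in> Is S" and s: "s \<in> {0..b}"
      have "u i s \<le> pn S (Stb i) * norm (x s - y s)"
        unfolding u_def using i by (intro p_norm) simp
      also have "\<dots> \<le> pn S (Stb i) * (C_s S * exp (gam S 0 * s) * norm (\<xi> - \<zeta>))"
        using s i by (intro mult_left_mono sol_diff_le_global[OF \<alpha> x y \<xi> \<zeta>] pn_nonneg) auto
      also have "\<dots> \<le> pn S (Stb i) * (C_s S * exp (gam S 0 * s) * (\<Sum>n\<in>Is S. d n))"
        unfolding d_def using i C_s
        by (intro mult_left_mono norm_le_sum_p subspace_diff[OF Xs_subspace] Bs_Xs \<xi> \<zeta> pn_nonneg) auto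
      finally show "u i s \<le> (\<Sum>n\<in>Is S. tensor_sum S (G_init S) i n s * d n)"
        by (simp only: tensor_sum_G_init sum_distrib_left) (simp add: mult_ac)
    qed
    show "dominates (boot_row S j G) b d u" if "j \<in> Is S" "dominates G b d u" for j G
    proof (rule dominates_boot_row[OF that])
      show "0 \<le> d n" for n by (simp add: d_def)
      have "continuous_on {0..b} x" "continuous_on {0..b} y" using x y by (simp_all add: sol_upto_def)
      then show "continuous_on {0..b} (u i)" if "i \<in> Is S" for i
        unfolding u_def[abs_def] using that
        by (intro continuous_intros bounded_linear.continuous_on[OF p_bounded_linear]) auto
      show "u j t \<le> exp (lam S (Stb j) * t) * d j + integral {0..t} (\<lambda>s. exp (lam S (Stb j) * (t - s)) *
          (Hc S (Stb j) j * u j s + (\<Sum>i\<in>Is S - {j}. Hc S (Stb j) i * u i s)))" if "0 \<le> t" "t \<le> b" for t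
        unfolding u_def d_def by (rule sol_diff_le_component[OF \<alpha> x y \<xi> \<zeta> that \<open>j \<in> Is S\<close>])
    qed
  qed
  then show ?thesis using j t by (simp add: dominates_def u_def d_def)
qed

end

section \<open>Global existence\<close>

definition radial :: "real \<Rightarrow> 'a::real_normed_vector \<Rightarrow> 'a" where
  "radial r a = a /\<^sub>R max 1 (norm a / r)"

lemma norm_radial_le: "0 < r \<Longrightarrow> norm (radial r a) \<le> r"
proof -
  assume r: "0 < r"
  have m: "0 < max 1 (norm a / r)" by simp
  have "norm a \<le> r * max 1 (norm a / r)"
    using mult_left_mono[of "norm a / r" "max 1 (norm a / r)" r] r by simp
  then show ?thesis
    using m by (simp add: radial_def divide_inverse[symmetric] pos_divide_le_eq mult.commute[of "inverse _"])
qed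

lemma radial_eq: "0 < r \<Longrightarrow> norm a \<le> r \<Longrightarrow> radial r a = a"
  by (simp add: radial_def max_absorb1)

text \<open>With \<open>m a = max 1 (norm a / r)\<close> one has \<open>m a *\<^sub>R (radial r a -
  radial r b) = (a - b) + (m b - m a) *\<^sub>R radial r b\<close>. The function \<open>m\<close>
  has Lipschitz constant \<open>1 / r\<close> and the retracted point has norm at most
  \<open>r\<close>, so both terms are bounded by \<open>norm (a - b)\<close>. This yields the
  constant 2 in every normed space.\<close>

lemma norm_radial_diff_le:
  assumes r: "0 < r"
  shows "norm (radial r a - radial r b) \<le> 2 * norm (a - b)"
proof -
  define m where "m a = max 1 (norm a / r)" for a :: 'a
  have m1: "1 \<le> m a" for a by (simp add: m_def)
  have "\<bar>m b - m a\<bar> \<le> norm (a - b) / r"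
  proof -
    have "\<bar>m b - m a\<bar> \<le> \<bar>norm b / r - norm a / r\<bar>" by (simp add: m_def max_def)
    also have "\<dots> = \<bar>norm a - norm b\<bar> / r" using r by (simp add: abs_minus_commute flip: diff_divide_distrib)
    also have "\<dots> \<le> norm (a - b) / r" using r by (intro divide_right_mono norm_triangle_ineq3) simp
    finally show ?thesis .
  qed
  then have "r * \<bar>m b - m a\<bar> \<le> norm (a - b)" using r by (simp add: pos_le_divide_eq mult.commute)
  moreover have "norm (radial r b) * \<bar>m b - m a\<bar> \<le> r * \<bar>m b - m a\<bar>"
    by (intro mult_right_mono norm_radial_le r) simp
  ultimately have 1: "norm ((m b - m a) *\<^sub>R radial r b) \<le> norm (a - b)" by (simp add: mult.commute)
  have "radial r a - radial r b = ((a - b) + (m b - m a) *\<^sub>R radial r b) /\<^sub>R m a"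
  proof -
    have "m b *\<^sub>R radial r b = b" using m1[of b] by (simp add: radial_def m_def)
    then have 2: "(a - b) + (m b - m a) *\<^sub>R radial r b = a - m a *\<^sub>R radial r b"
      by (simp add: algebra_simps)
    have "a /\<^sub>R m a = radial r a" by (simp add: radial_def m_def)
    then show ?thesis unfolding 2 using m1[of a] by (simp add: scaleR_diff_right)
  qed
  also have "norm \<dots> \<le> norm ((a - b) + (m b - m a) *\<^sub>R radial r b)"
    using m1[of a] mult_right_mono[of "inverse (m a)" 1 "norm ((a - b) + (m b - m a) *\<^sub>R radial r b)"]
    by (simp add: inverse_le_1_iff)
  also have "\<dots> \<le> norm (a - b) + norm (a - b)"
    using 1 by (intro norm_triangle_le add_left_mono)
  finally show ?thesis by simp
qed

locale lp_system = lp_rates +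
  assumes gam0: "gam S 0 < 0"
    and rho_bound: "\<And>j t. j \<in> Is S \<Longrightarrow> t \<ge> 0 \<Longrightarrow>
           rho S j \<ge> (\<Sum>n\<in>Is S. \<Sum>k\<in>{0..ms S}. exp (gam S k * t) * Gout S j k n * rho S n)"
begin

text \<open>Comparison with the zero solution. The condition on \<open>rho\<close> is homogeneous,
  so the box scaled by \<open>c\<close> is controlled as well; nonnegativity of the tensor sums is
  what allows the bounds on the initial components to be inserted.\<close>

lemma sol_upto_le:
  assumes \<alpha>: "\<alpha> \<in> charts S" and x: "sol_upto \<alpha> b \<xi> x" and \<xi>: "\<xi> \<in> Bs S"
    and c: "0 \<le> c" "\<And>n. n \<in> Is S \<Longrightarrow> norm (p (Stb n) \<xi>) \<le> c * rho S n"
    and j: "j \<in> Is S" and t: "0 \<le> t" "t \<le> b"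
  shows "norm (p (Stb j) (x t)) \<le> c * rho S j"
proof -
  have "norm (p (Stb j) (x t - 0)) \<le> (\<Sum>n\<in>Is S. tensor_sum S (Gout S) j n t * norm (p (Stb n) (\<xi> - 0)))"
    by (rule sol_diff_le_Gout[OF \<alpha> x sol_upto_zero[OF \<alpha>] \<xi> Bs_zero j t])
  also have "\<dots> \<le> (\<Sum>n\<in>Is S. tensor_sum S (Gout S) j n t * (c * rho S n))"
    using nonneg_Gout j t c unfolding nonneg_tensor_def by (intro sum_mono mult_left_mono) auto
  also have "\<dots> = c * (\<Sum>n\<in>Is S. \<Sum>k\<in>{0..ms S}. exp (gam S k * t) * Gout S j k n * rho S n)"
    by (simp add: tensor_sum_def sum_distrib_left sum_distrib_right mult_ac)
  also have "\<dots> \<le> c * rho S j" using rho_bound[OF j t(1)] c(1) by (rule mult_left_mono)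
  finally show ?thesis by simp
qed

text \<open>Since a chart is meaningful only on the box, composing with this map is what gives a
  globally Lipschitz field, as the fixed point argument requires.\<close>

definition box_retract :: "'a \<Rightarrow> 'a" where
  "box_retract x = (\<Sum>i\<in>Is S. radial (rho S i) (p (Stb i) x))"

lemma p_box_retract: "j \<in> Is S \<Longrightarrow> p (Stb j) (box_retract x) = radial (rho S j) (p (Stb j) x)"
  by (simp add: box_retract_def radial_def linear_sum[OF p_linear] linear_scale[OF p_linear] p_orth if_distrib sum.delta' cong: if_cong)

lemma box_retract_in: "box_retract x \<in> Bs S"
proof -
  have "box_retract x \<in> Xs S"
    unfolding box_retract_def radial_def
    by (intro subspace_sum[OF Xs_subspace] subspace_scale[OF Xs_subspace] p_in_Xs)
  then show ?thesis using rho by (simp add: Bs_def p_box_retract norm_radial_le)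
qed

lemma box_retract_eq: "x \<in> Bs S \<Longrightarrow> box_retract x = x"
proof -
  assume x: "x \<in> Bs S"
  then have "box_retract x = proj_s S x"
    unfolding box_retract_def proj_s_def using rho Bs_bound[OF x] by (intro sum.cong radial_eq) auto
  then show ?thesis using Bs_Xs[OF x] by (simp add: Xs_iff)
qed

lemma box_retract_diff_le: "norm (box_retract x - box_retract y) \<le> (2 * (\<Sum>i\<in>Is S. pn S (Stb i))) * norm (x - y)"
proof -
  have "norm (box_retract x - box_retract y) \<le> (\<Sum>i\<in>Is S. norm (radial (rho S i) (p (Stb i) x) - radial (rho S i) (p (Stb i) y)))"
    unfolding box_retract_def sum_subtractf[symmetric] by (rule norm_sum)
  also have "\<dots> \<le> (\<Sum>i\<in>Is S. 2 * (pn S (Stb i) * norm (x - y)))"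
  proof (rule sum_mono)
    fix i assume i: "i \<in> Is S"
    have "norm (radial (rho S i) (p (Stb i) x) - radial (rho S i) (p (Stb i) y)) \<le> 2 * norm (p (Stb i) x - p (Stb i) y)"
      by (rule norm_radial_diff_le[OF rho[OF i]])
    also have "\<dots> \<le> 2 * (pn S (Stb i) * norm (x - y))"
      using p_norm[of "Stb i" "x - y"] i by (simp add: linear_diff[OF p_linear])
    finally show "norm (radial (rho S i) (p (Stb i) x) - radial (rho S i) (p (Stb i) y)) \<le> \<dots>" .
  qed
  finally show ?thesis by (simp add: sum_distrib_left sum_distrib_right mult_ac)
qed

definition field :: "('a \<Rightarrow> 'a) \<Rightarrow> 'a \<Rightarrow> 'a" where
  "field \<alpha> z = proj_s S (Nfull S (box_retract z + \<alpha> (box_retract z)))"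

lemma field_lipschitz:
  assumes \<alpha>: "\<alpha> \<in> charts S"
  obtains L where "0 \<le> L" "\<And>x y. norm (field \<alpha> x - field \<alpha> y) \<le> L * norm (x - y)"
proof
  define H where "H = (\<Sum>j\<in>Is S. \<Sum>i\<in>Is S. Hc S (Stb j) i * pn S (Stb i))"
  define R where "R = 2 * (\<Sum>i\<in>Is S. pn S (Stb i))"
  have H: "0 \<le> H" unfolding H_def by (intro sum_nonneg mult_nonneg_nonneg Hc_nonneg pn_nonneg) auto
  have R: "0 \<le> R" unfolding R_def by (simp add: sum_nonneg pn_nonneg)
  show "0 \<le> H * R" using H R by simp
  show "norm (field \<alpha> x - field \<alpha> y) \<le> H * R * norm (x - y)" for x y
  proof -
    have "norm (field \<alpha> x - field \<alpha> y) \<le> H * norm (box_retract x - box_retract y)"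
      unfolding field_def H_def by (intro proj_s_Nfull_chart_diff_le \<alpha> box_retract_in)
    also have "\<dots> \<le> H * (R * norm (x - y))"
      unfolding R_def by (intro mult_left_mono box_retract_diff_le H)
    finally show ?thesis by (simp add: mult.assoc)
  qed
qed

definition mild_field :: "('a \<Rightarrow> 'a) \<Rightarrow> 'a \<Rightarrow> (real \<Rightarrow> 'a) \<Rightarrow> bool" where
  "mild_field \<alpha> \<xi> x \<longleftrightarrow> continuous_on {0..} x \<and> (\<forall>t\<ge>0. x t \<in> Xs S) \<and>
    (\<forall>t\<ge>0. ((\<lambda>s. expLs S (t - s) (field \<alpha> (x s))) has_integral x t - expLs S t \<xi>) {0..t})"

lemma mild_field_sol_upto:
  assumes x: "mild_field \<alpha> \<xi> x" and B: "\<And>s. 0 \<le> s \<Longrightarrow> s \<le> b \<Longrightarrow> x s \<in> Bs S"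
  shows "sol_upto \<alpha> b \<xi> x"
  unfolding sol_upto_def
proof (intro conjI ballI)
  show "continuous_on {0..b} x" using x by (auto simp: mild_field_def intro: continuous_on_subset)
  show "x t \<in> Bs S" if "t \<in> {0..b}" for t using that B by simp
  show "((\<lambda>\<tau>. expLs S (t - \<tau>) (proj_s S (Nfull S (x \<tau> + \<alpha> (x \<tau>))))) has_integral (x t - expLs S t \<xi>)) {0..t}"
    if t: "t \<in> {0..b}" for t
  proof (rule has_integral_eq)
    show "((\<lambda>s. expLs S (t - s) (field \<alpha> (x s))) has_integral x t - expLs S t \<xi>) {0..t}"
      using x t by (simp add: mild_field_def)
    show "expLs S (t - s) (field \<alpha> (x s)) = expLs S (t - s) (proj_s S (Nfull S (x s + \<alpha> (x s))))" if "s \<in> {0..t}" for s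
      using B[of s] that t by (simp add: field_def box_retract_eq)
  qed
qed

text \<open>Let \<open>s\<close> be the first time at which the scaled box is about to be left. As
  \<open>c < 1\<close>, the solution remains in the full box for a little longer. There the
  retraction acts as the identity, so the solution solves the original equation, and the a priori
  bound keeps it in the scaled box beyond \<open>s\<close>, a contradiction.\<close>

lemma mild_field_strictly_inside:
  assumes \<alpha>: "\<alpha> \<in> charts S" and x: "mild_field \<alpha> \<xi> x" and \<xi>: "\<xi> \<in> Bs S"
    and c: "0 \<le> c" "c < 1" "\<And>n. n \<in> Is S \<Longrightarrow> norm (p (Stb n) \<xi>) \<le> c * rho S n"
    and t: "0 \<le> t" and j: "j \<in> Is S"
  shows "norm (p (Stb j) (x t)) \<le> c * rho S j"
proof (rule ccontr)
  assume neg: "\<not> norm (p (Stb j) (x t)) \<le> c * rho S j"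
  define V where "V = {t. 0 \<le> t \<and> (\<exists>j\<in>Is S. norm (p (Stb j) (x t)) > c * rho S j)}"
  define s where "s = Inf V"
  have tV: "t \<in> V" using neg t j by (auto simp: V_def not_le intro!: bexI[of _ j])
  have bdd: "bdd_below V" by (auto simp: V_def bdd_below_def)
  have s0: "0 \<le> s" unfolding s_def using tV by (intro cInf_greatest) (auto simp: V_def)
  have cx: "continuous_on {0..} x" and xX: "\<And>t. 0 \<le> t \<Longrightarrow> x t \<in> Xs S"
    using x by (auto simp: mild_field_def)
  have ci: "continuous_on {0..} (\<lambda>t. norm (p (Stb i) (x t)))" if "i \<in> Is S" for i
    using that by (intro continuous_intros bounded_linear.continuous_on[OF p_bounded_linear] cx) auto
  have below: "norm (p (Stb i) (x r)) \<le> c * rho S i" if "i \<in> Is S" "0 \<le> r" "r < s" for i r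
  proof (rule ccontr)
    assume "\<not> norm (p (Stb i) (x r)) \<le> c * rho S i"
    then have "r \<in> V" using that by (auto simp: V_def not_le intro!: bexI[of _ i])
    then have "s \<le> r" unfolding s_def using bdd by (intro cInf_lower)
    with that show False by simp
  qed
  have c_rho: "c * rho S i < rho S i" if "i \<in> Is S" for i
    using c(2) rho[OF that] by simp
  have x0: "x 0 = \<xi>"
  proof -
    have "((\<lambda>s. expLs S (0 - s) (field \<alpha> (x s))) has_integral x 0 - expLs S 0 \<xi>) {0}"
      using x by (auto simp: mild_field_def dest: spec[of _ 0])
    from has_integral_unique[OF this has_integral_refl(2)]
    show ?thesis using pert.T.T_0[of \<xi>] Bs_Xs[OF \<xi>] by (simp add: Xs_def)
  qed
  have at_s: "norm (p (Stb i) (x s)) \<le> c * rho S i" if i: "i \<in> Is S" for i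
  proof (cases "s = 0")
    case True
    then show ?thesis using c(3) i x0 by simp
  next
    case False
    then have "0 < s" using s0 by simp
    show ?thesis
    proof (rule continuous_le_on_closure[of "{0<..<s}" "\<lambda>t. norm (p (Stb i) (x t))" s "c * rho S i"])
      show "continuous_on (closure {0<..<s}) (\<lambda>t. norm (p (Stb i) (x t)))"
        using \<open>0 < s\<close> by (intro continuous_on_subset[OF ci[OF i]]) auto
      show "s \<in> closure {0<..<s}" using \<open>0 < s\<close> by simp
      show "norm (p (Stb i) (x r)) \<le> c * rho S i" if "r \<in> {0<..<s}" for r
        using below[OF i] that by simp
    qed
  qed
  have "\<forall>\<^sub>F r in at s within {0..}. \<forall>i\<in>Is S. norm (p (Stb i) (x r)) < rho S i"
  proof (rule eventually_ball_finite, simp, intro ballI)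
    fix i assume i: "i \<in> Is S"
    have "((\<lambda>r. norm (p (Stb i) (x r))) \<longlongrightarrow> norm (p (Stb i) (x s))) (at s within {0..})"
      using ci[OF i] s0 by (simp add: continuous_on_def)
    then show "\<forall>\<^sub>F r in at s within {0..}. norm (p (Stb i) (x r)) < rho S i"
      by (rule order_tendstoD(2)) (use at_s[OF i] c_rho[OF i] in simp)
  qed
  then obtain \<delta> where \<delta>: "\<delta> > 0" "\<And>r. 0 \<le> r \<Longrightarrow> r \<noteq> s \<Longrightarrow> dist r s < \<delta> \<Longrightarrow> \<forall>i\<in>Is S. norm (p (Stb i) (x r)) < rho S i"
    unfolding eventually_at by auto
  \<comment> \<open>Before and at \<open>s\<close> the bound with \<open>c\<close> applies; after
    \<open>s\<close> only the strict bound obtained from continuity is available, on an interval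
    whose half is used to stay clear of its end point.\<close>
  have inB: "x r \<in> Bs S" if r: "0 \<le> r" "r \<le> s + \<delta> / 2" for r
  proof -
    have "norm (p (Stb i) (x r)) \<le> rho S i" if i: "i \<in> Is S" for i
    proof (cases r s rule: linorder_cases)
      case less
      then show ?thesis using below[OF i r(1)] c_rho[OF i] by simp
    next
      case equal
      then show ?thesis using at_s[OF i] c_rho[OF i] by simp
    next
      case greater
      then have "\<forall>i\<in>Is S. norm (p (Stb i) (x r)) < rho S i"
        using r \<delta>(1) by (intro \<delta>(2)) (auto simp: dist_real_def)
      then show ?thesis using i by (simp add: less_imp_le)
    qed
    then show ?thesis using xX[OF r(1)] by (simp add: Bs_def)
  qed
  have sol: "sol_upto \<alpha> (s + \<delta> / 2) \<xi> x" by (rule mild_field_sol_upto[OF x inB])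
  obtain r where r: "r \<in> V" "r < s + \<delta> / 2"
    using cInf_lessD[of V "s + \<delta> / 2"] tV \<delta>(1) unfolding s_def by auto
  then obtain i where "i \<in> Is S" "norm (p (Stb i) (x r)) > c * rho S i" "0 \<le> r" by (auto simp: V_def)
  then show False using sol_upto_le[OF \<alpha> sol \<xi> c(1) c(3), of i r] r by simp
qed

text \<open>The bound on the box is not strict, so points of the boundary are approached from inside.\<close>

lemma sol_exists:
  assumes \<alpha>: "\<alpha> \<in> charts S" and \<xi>: "\<xi> \<in> Bs S"
  shows "\<exists>x. is_sol S \<alpha> \<xi> x"
proof -
  obtain L where L: "0 \<le> L" "\<And>x y. norm (field \<alpha> x - field \<alpha> y) \<le> L * norm (x - y)"
    using field_lipschitz[OF \<alpha>] by blast
  have field_in: "field \<alpha> z \<in> range (proj_s S)" for z by (simp add: field_def)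
  have field_0: "field \<alpha> 0 = 0"
    by (simp add: field_def box_retract_eq charts_zero[OF \<alpha>] linear_0[OF bounded_linear.linear[OF proj_s_bounded_linear]])
  have ex: "\<exists>x. mild_field \<alpha> \<eta> x" if "\<eta> \<in> Xs S" for \<eta>
  proof -
    have "\<eta> \<in> range (proj_s S)" using that by (simp add: Xs_def)
    from pert.T.mild_solution_exists[OF this L field_in field_0] show ?thesis
      unfolding mild_field_def Xs_def by metis
  qed
  obtain x where x: "mild_field \<alpha> \<xi> x" using ex Bs_Xs[OF \<xi>] by blast
  have "x t \<in> Bs S" if t: "0 \<le> t" for t
  proof -
    have "norm (p (Stb j) (x t)) \<le> rho S j" if j: "j \<in> Is S" for j
    proof (rule field_le_epsilon)
      fix e :: real assume e: "0 < e"
      \<comment> \<open>By continuous dependence, shrinking the initial value by \<open>c\<close>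
        moves the \<open>j\<close>-th component at time \<open>t\<close> by at most
        \<open>(1 - c) * K\<close>.\<close>
      define K where "K = pn S (Stb j) * (Ms * norm \<xi> * exp (Ms * L * t))"
      have K: "0 \<le> K" unfolding K_def using pn_nonneg[of "Stb j"] j pert.T.M by simp
      \<comment> \<open>Makes \<open>(1 - c) * K\<close> at most \<open>e\<close> and keeps
        \<open>c\<close> in the range from 0 to below 1; adding 1 to \<open>K\<close> avoids a
        division by zero.\<close>
      define c where "c = 1 - min 1 (e / (K + 1))"
      have "0 < e / (K + 1)" using e K by (simp add: add_nonneg_pos)
      then have c: "0 \<le> c" "c < 1" by (auto simp: c_def)
      have "(1 - c) * K \<le> e / (K + 1) * K" using K by (intro mult_right_mono) (auto simp: c_def)
      also have "\<dots> = e * (K / (K + 1))" by simp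
      also have "\<dots> \<le> e" using e K by (intro mult_left_le) auto
      finally have ce: "(1 - c) * K \<le> e" .
      have c\<xi>: "c *\<^sub>R \<xi> \<in> Bs S"
        using convexD[OF convex_Bs \<xi> Bs_zero, of c "1 - c"] c by simp
      have c\<xi>': "norm (p (Stb n) (c *\<^sub>R \<xi>)) \<le> c * rho S n" if "n \<in> Is S" for n
        using that c Bs_bound[OF \<xi> that] by (simp add: linear_scale[OF p_linear] mult_left_mono)
      obtain y where y: "mild_field \<alpha> (c *\<^sub>R \<xi>) y" using ex Bs_Xs[OF c\<xi>] by blast
      have "norm (x t - y t) \<le> Ms * norm (\<xi> - c *\<^sub>R \<xi>) * exp (Ms * L * t)"
        using x y Bs_Xs[OF \<xi>] Bs_Xs[OF c\<xi>]
        by (intro pert.T.mild_solution_diff_le[OF L field_in _ _ _ _ _ _ t]) (auto simp: mild_field_def Xs_def)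
      also have "norm (\<xi> - c *\<^sub>R \<xi>) = (1 - c) * norm \<xi>"
        using c by (metis abs_of_pos diff_gt_0_iff_gt norm_scaleR scaleR_left_diff_distrib scaleR_one)
      finally have "norm (x t - y t) \<le> Ms * ((1 - c) * norm \<xi>) * exp (Ms * L * t)" .
      from mult_left_mono[OF this, of "pn S (Stb j)"]
      have "pn S (Stb j) * norm (x t - y t) \<le> (1 - c) * K"
        using pn_nonneg[of "Stb j"] j by (simp add: K_def mult_ac)
      then have "norm (p (Stb j) (x t - y t)) \<le> e"
        using p_norm[of "Stb j" "x t - y t"] ce j by simp
      moreover have "norm (p (Stb j) (y t)) \<le> rho S j"
      proof -
        have "c * rho S j \<le> 1 * rho S j" using c rho[OF j] by (intro mult_right_mono) auto
        then show ?thesis using mild_field_strictly_inside[OF \<alpha> y c\<xi> c c\<xi>' t j] by simp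
      qed
      moreover have "norm (p (Stb j) (x t)) \<le> norm (p (Stb j) (y t)) + norm (p (Stb j) (x t - y t))"
        using norm_triangle_ineq[of "p (Stb j) (y t)" "p (Stb j) (x t - y t)"] j by (simp add: linear_diff[OF p_linear])
      ultimately show "norm (p (Stb j) (x t)) \<le> rho S j + e" by linarith
    qed
    then show ?thesis using x t by (simp add: Bs_def mild_field_def)
  qed
  then have "sol_upto \<alpha> b \<xi> x" for b using mild_field_sol_upto[OF x] by blast
  then have "is_sol S \<alpha> \<xi> x" using x by (intro is_solI) (auto simp: mild_field_def)
  then show ?thesis by blast
qed

lemma sol_unique:
  assumes \<alpha>: "\<alpha> \<in> charts S" and \<xi>: "\<xi> \<in> Bs S" and x: "is_sol S \<alpha> \<xi> x" and y: "is_sol S \<alpha> \<xi> y" and t: "0 \<le> t"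
  shows "x t = y t"
proof -
  have in': "x t - y t \<in> Xs S"
    using x y t by (intro subspace_diff[OF Xs_subspace] Bs_Xs) (auto simp: is_sol_def)
  have "norm (p (Stb j) (x t - y t)) \<le> 0" if j: "j \<in> Is S" for j
    using sol_diff_le_Gout[OF \<alpha> is_sol_upto[OF x] is_sol_upto[OF y] \<xi> \<xi> j t, of t]
    by (simp add: linear_0[OF p_linear])
  then have "norm (x t - y t) \<le> 0" using norm_le_sum_p[OF in'] by simp
  then show ?thesis by simp
qed

lemma traj_is_sol: "\<alpha> \<in> charts S \<Longrightarrow> \<xi> \<in> Bs S \<Longrightarrow> is_sol S \<alpha> \<xi> (\<lambda>t. traj S \<alpha> t \<xi>)"
  unfolding traj_def by (rule someI_ex[OF sol_exists])

end

section \<open>The Lyapunov--Perron operator\<close>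

context lp_system
begin

definition lp_kernel :: "nat \<Rightarrow> nat \<Rightarrow> real \<Rightarrow> real" where
  "lp_kernel i' n t = (\<Sum>i\<in>Is S. exp (- lam S (Unst i') * t) * Hc S (Unst i') i * tensor_sum S (Gout S) i n t)"

lemma gam_less_lam: "i' \<in> Iu S \<Longrightarrow> k \<le> ms S \<Longrightarrow> gam S k < lam S (Unst i')"
  using gam_antimono[of 0 k] gam0 unstable_pos[of i'] by (cases "k = 0") auto

lemma lp_kernel_nonneg: "i' \<in> Iu S \<Longrightarrow> n \<in> Is S \<Longrightarrow> 0 \<le> t \<Longrightarrow> 0 \<le> lp_kernel i' n t"
  using nonneg_Gout unfolding lp_kernel_def nonneg_tensor_def
  by (intro sum_nonneg mult_nonneg_nonneg Hc_nonneg) auto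

text \<open>The source of the inverse factors in \<open>Ptilde\<close>: each rate contributes an
  exponential with exponent \<open>- (lam S (Unst i') - gam S k) * t\<close>. The gap is positive
  because all \<open>gam S k\<close> are at most \<open>gam S 0 < 0\<close>.\<close>

lemma lp_kernel_has_integral:
  assumes i': "i' \<in> Iu S"
  shows "(lp_kernel i' n has_integral Ptilde S i' n) {0..}"
proof -
  have "((\<lambda>t. \<Sum>k\<in>{0..ms S}. \<Sum>i\<in>Is S. (Hc S (Unst i') i * Gout S i k n) * exp (- (lam S (Unst i') - gam S k) * t))
    has_integral (\<Sum>k\<in>{0..ms S}. \<Sum>i\<in>Is S. (Hc S (Unst i') i * Gout S i k n)
      * (exp (- (lam S (Unst i') - gam S k) * 0) / (lam S (Unst i') - gam S k)))) {0..}"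
    using gam_less_lam[OF i']
    by (intro has_integral_sum has_integral_mult_right has_integral_exp_minus_to_infinity) auto
  moreover have "(\<Sum>k\<in>{0..ms S}. \<Sum>i\<in>Is S. (Hc S (Unst i') i * Gout S i k n) * exp (- (lam S (Unst i') - gam S k) * t))
      = lp_kernel i' n t" for t
    unfolding lp_kernel_def tensor_sum_def sum_distrib_left
    by (subst sum.swap) (simp add: algebra_simps exp_add exp_diff exp_minus divide_inverse)
  ultimately show ?thesis by (simp add: Ptilde_def divide_inverse mult_ac)
qed

text \<open>The entries of \<open>Gout S\<close> may have either sign, so the sign is read off from
  the integral of the nonnegative kernel instead of the defining sum.\<close>

lemma Ptilde_nonneg: "i' \<in> Iu S \<Longrightarrow> n \<in> Is S \<Longrightarrow> 0 \<le> Ptilde S i' n"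
  using has_integral_nonneg[OF lp_kernel_has_integral] lp_kernel_nonneg by auto

context
  fixes \<alpha> assumes \<alpha>: "\<alpha> \<in> charts S"
begin

private abbreviation "intg \<equiv> lp_integrand S \<alpha>"

private lemma traj_in: "\<xi> \<in> Bs S \<Longrightarrow> 0 \<le> t \<Longrightarrow> traj S \<alpha> t \<xi> \<in> Bs S"
  using traj_is_sol[OF \<alpha>] by (simp add: is_sol_def)

lemma lp_integrand_continuous: "\<xi> \<in> Bs S \<Longrightarrow> continuous_on {0..} (intg \<xi>)"
proof -
  assume \<xi>: "\<xi> \<in> Bs S"
  have "continuous_on {0..} (\<lambda>t. traj S \<alpha> t \<xi>)" using traj_is_sol[OF \<alpha> \<xi>] by (simp add: is_sol_def)
  then show ?thesis
    unfolding lp_integrand_def[abs_def] using traj_in[OF \<xi>]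
    by (intro unst.continuous_on_T continuous_intros bounded_linear.continuous_on[OF proj_u_bounded_linear]
        continuous_on_chart_field \<alpha>) auto
qed

lemma lp_integrand_in: "0 \<le> t \<Longrightarrow> intg \<xi> t \<in> Xu S"
  using unst.T_in[of t] unfolding lp_integrand_def Xu_def by blast

text \<open>The trajectory is picked by choice, so uniqueness is needed to know that it vanishes for
  zero data. This is the reference point for absolute convergence and for \<Psi> fixing the
  origin.\<close>

lemma lp_integrand_zero: "0 \<le> t \<Longrightarrow> intg 0 t = 0"
proof -
  assume t: "0 \<le> t"
  have "is_sol S \<alpha> 0 (\<lambda>_. 0)"
    by (intro is_solI sol_upto_zero[OF \<alpha>] continuous_on_const)
  from sol_unique[OF \<alpha> Bs_zero traj_is_sol[OF \<alpha> Bs_zero] this t]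
  have "traj S \<alpha> t 0 = 0" .
  then show ?thesis
    by (simp add: lp_integrand_def charts_zero[OF \<alpha>] unst.T_zero[OF t]
        linear_0[OF bounded_linear.linear[OF proj_u_bounded_linear]])
qed

lemma lp_integrand_diff_le:
  assumes i': "i' \<in> Iu S" and \<xi>: "\<xi> \<in> Bs S" and \<zeta>: "\<zeta> \<in> Bs S" and t: "0 \<le> t"
  shows "norm (p (Unst i') (intg \<xi> t - intg \<zeta> t)) \<le> (\<Sum>n\<in>Is S. lp_kernel i' n t * norm (p (Stb n) (\<xi> - \<zeta>)))"
proof -
  define x where "x = traj S \<alpha> t \<xi>"
  define y where "y = traj S \<alpha> t \<zeta>"
  let ?N = "\<lambda>z. Nfull S (z + \<alpha> z)"
  let ?e = "exp (- lam S (Unst i') * t)"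
  have xy: "x \<in> Bs S" "y \<in> Bs S" using traj_in \<xi> \<zeta> t by (simp_all add: x_def y_def)
  have lin: "linear (proj_u S)" by (rule bounded_linear.linear[OF proj_u_bounded_linear])
  have "intg \<xi> t - intg \<zeta> t = exp_minus_Lu S t (proj_u S (?N x - ?N y))"
    unfolding lp_integrand_def x_def[symmetric] y_def[symmetric]
    by (simp add: linear_diff[OF lin] unst.T_diff[OF t])
  then have "norm (p (Unst i') (intg \<xi> t - intg \<zeta> t)) \<le> ?e * norm (p (Unst i') (proj_u S (?N x - ?N y)))"
    using unstable_semigroup(2)[OF t proj_u_in i'] by simp
  also have "norm (p (Unst i') (proj_u S (?N x - ?N y))) = norm (p (Unst i') (?N x) - p (Unst i') (?N y))"
    using i' by (simp add: linear_diff[OF p_linear])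
  also have "\<dots> \<le> (\<Sum>i\<in>Is S. Hc S (Unst i') i * norm (p (Stb i) (x - y)))"
    using i' by (intro p_Nfull_chart_diff_le \<alpha> xy) simp
  also have "\<dots> \<le> (\<Sum>i\<in>Is S. Hc S (Unst i') i * (\<Sum>n\<in>Is S. tensor_sum S (Gout S) i n t * norm (p (Stb n) (\<xi> - \<zeta>))))"
    unfolding x_def y_def using i' t
    by (intro sum_mono mult_left_mono Hc_nonneg
        sol_diff_le_Gout[OF \<alpha> is_sol_upto[OF traj_is_sol[OF \<alpha> \<xi>], of t] is_sol_upto[OF traj_is_sol[OF \<alpha> \<zeta>]] \<xi> \<zeta>]) auto
  finally have "norm (p (Unst i') (intg \<xi> t - intg \<zeta> t)) \<le> ?e * \<dots>" by simp
  also have "\<dots> = (\<Sum>n\<in>Is S. lp_kernel i' n t * norm (p (Stb n) (\<xi> - \<zeta>)))"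
    unfolding lp_kernel_def sum_distrib_left sum_distrib_right by (subst sum.swap) (simp add: mult_ac)
  finally show ?thesis .
qed

text \<open>The difference estimate against the vanishing integrand at 0 bounds every unstable
  component by integrable kernels; summing over the components gives a dominating function.\<close>

lemma lp_integrand_integrable:
  assumes \<xi>: "\<xi> \<in> Bs S"
  shows "intg \<xi> integrable_on {0..}" "(\<lambda>t. norm (intg \<xi> t)) integrable_on {0..}"
proof -
  define h where "h t = (\<Sum>i'\<in>Iu S. \<Sum>n\<in>Is S. lp_kernel i' n t * norm (p (Stb n) \<xi>))" for t
  have h: "h integrable_on {0..}"
    unfolding h_def[abs_def]
    by (intro integrable_sum integrable_on_mult_left has_integral_integrable[OF lp_kernel_has_integral]) auto
  have le: "norm (intg \<xi> t) \<le> h t" if t: "0 \<le> t" for t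
  proof -
    have "norm (intg \<xi> t) \<le> (\<Sum>i'\<in>Iu S. norm (p (Unst i') (intg \<xi> t)))"
      by (rule norm_le_sum_p_u[OF lp_integrand_in[OF t]])
    also have "\<dots> \<le> h t"
      unfolding h_def using lp_integrand_diff_le[OF _ \<xi> Bs_zero t] lp_integrand_zero[OF t] by (intro sum_mono) simp
    finally show ?thesis .
  qed
  show "intg \<xi> integrable_on {0..}"
    by (rule integrable_on_halfline_dominated[OF lp_integrand_continuous[OF \<xi>] h le])
  show "(\<lambda>t. norm (intg \<xi> t)) integrable_on {0..}"
    by (rule integrable_on_halfline_dominated[OF _ h])
      (use le in \<open>auto intro!: continuous_intros lp_integrand_continuous[OF \<xi>]\<close>)
qed

lemma Psi_in_Xu: "\<xi> \<in> Bs S \<Longrightarrow> Psi S \<alpha> \<xi> \<in> Xu S"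
proof -
  assume \<xi>: "\<xi> \<in> Bs S"
  have "integral {0..} (intg \<xi>) \<in> range (proj_u S)"
    by (rule unst.integral_in_range[OF integrable_integral[OF lp_integrand_integrable(1)[OF \<xi>]]])
      (use lp_integrand_in in \<open>auto simp: Xu_def\<close>)
  then show ?thesis unfolding Psi_def Xu_def[symmetric] by (rule subspace_neg[OF Xu_subspace])
qed

lemma Psi_zero: "Psi S \<alpha> 0 = 0"
proof -
  have "integral {0..} (intg 0) = integral {0..} (\<lambda>_::real. 0)"
    by (intro integral_cong) (simp add: lp_integrand_zero)
  then show ?thesis by (simp add: Psi_def)
qed

lemma Psi_diff_le:
  assumes i': "i' \<in> Iu S" and \<xi>: "\<xi> \<in> Bs S" and \<zeta>: "\<zeta> \<in> Bs S"
  shows "norm (p (Unst i') (Psi S \<alpha> \<xi>) - p (Unst i') (Psi S \<alpha> \<zeta>)) \<le> (\<Sum>n\<in>Is S. Ptilde S i' n * norm (p (Stb n) (\<xi> - \<zeta>)))"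
proof -
  have pl: "bounded_linear (p (Unst i'))" using i' by (intro p_bounded_linear) simp
  have 1: "((\<lambda>t. p (Unst i') (intg \<xi> t - intg \<zeta> t)) has_integral p (Unst i') (integral {0..} (intg \<xi>) - integral {0..} (intg \<zeta>))) {0..}"
    using has_integral_linear[OF has_integral_diff[OF integrable_integral[OF lp_integrand_integrable(1)[OF \<xi>]]
          integrable_integral[OF lp_integrand_integrable(1)[OF \<zeta>]]] pl] by (simp add: o_def)
  have 2: "((\<lambda>t. \<Sum>n\<in>Is S. lp_kernel i' n t * norm (p (Stb n) (\<xi> - \<zeta>))) has_integral
      (\<Sum>n\<in>Is S. Ptilde S i' n * norm (p (Stb n) (\<xi> - \<zeta>)))) {0..}"
    by (intro has_integral_sum has_integral_mult_left lp_kernel_has_integral i') simp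
  have "norm (p (Unst i') (integral {0..} (intg \<xi>) - integral {0..} (intg \<zeta>))) \<le> (\<Sum>n\<in>Is S. Ptilde S i' n * norm (p (Stb n) (\<xi> - \<zeta>)))"
    unfolding integral_unique[OF 1, symmetric] integral_unique[OF 2, symmetric]
    using 1 2 lp_integrand_diff_le[OF i' \<xi> \<zeta>] by (intro integral_norm_bound_integral) auto
  then show ?thesis
    unfolding Psi_def linear_neg[OF bounded_linear.linear[OF pl]] linear_diff[OF bounded_linear.linear[OF pl]]
    by (simp add: norm_minus_commute)
qed

lemma Psi_defined_charts: "Psi_defined S \<alpha>"
  unfolding Psi_defined_def
  using sol_exists[OF \<alpha>] sol_unique[OF \<alpha>] lp_integrand_integrable by blast

text \<open>If the displacement lies in the \<open>n\<close>-th component, all other terms of the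
  full difference bound vanish.\<close>

lemma Lip_Psi_le:
  assumes i': "i' \<in> Iu S" and n: "n \<in> Is S"
  shows "Lip S (Psi S \<alpha>) i' n \<le> ereal (Ptilde S i' n)"
proof (rule Lip_leI[OF Ptilde_nonneg[OF i' n]])
  fix x y assume x: "x \<in> Bs S" and y: "y \<in> Bs S" and xy: "x - y \<in> Xc S (Stb n)"
  have "p (Stb n) (x - y) = x - y" using xy n by (simp add: Xc_iff)
  then have "p (Stb k) (x - y) = (if k = n then x - y else 0)" if "k \<in> Is S" for k
    using p_orth[of "Stb k" "Stb n" "x - y"] that n by auto
  then have "(\<Sum>k\<in>Is S. Ptilde S i' k * norm (p (Stb k) (x - y))) = (\<Sum>k\<in>Is S. if k = n then Ptilde S i' n * norm (x - y) else 0)"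
    by (intro sum.cong) auto
  then show "norm (p (Unst i') (Psi S \<alpha> x) - p (Unst i') (Psi S \<alpha> y)) \<le> Ptilde S i' n * norm (x - y)"
    using Psi_diff_le[OF i' x y] n by simp
qed

lemma Psi_in_charts:
  assumes le: "\<And>i' n. i' \<in> Iu S \<Longrightarrow> n \<in> Is S \<Longrightarrow> Ptilde S i' n \<le> Pc S i' n"
  shows "Psi S \<alpha> \<in> charts S"
proof -
  \<comment> \<open>Membership in \<open>charts\<close> also asks for a Lipschitz constant in the
    full norm. It is obtained by summing the unstable components and bounding each stable component
    by \<open>pn\<close> times the norm.\<close>
  define K where "K = (\<Sum>i'\<in>Iu S. \<Sum>n\<in>Is S. Ptilde S i' n * pn S (Stb n))"
  have "K-lipschitz_on (Bs S) (Psi S \<alpha>)"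
  proof (rule lipschitz_onI)
    show "0 \<le> K" unfolding K_def by (intro sum_nonneg mult_nonneg_nonneg Ptilde_nonneg pn_nonneg) auto
    fix x y assume x: "x \<in> Bs S" and y: "y \<in> Bs S"
    have "norm (Psi S \<alpha> x - Psi S \<alpha> y) \<le> (\<Sum>i'\<in>Iu S. norm (p (Unst i') (Psi S \<alpha> x - Psi S \<alpha> y)))"
      by (intro norm_le_sum_p_u subspace_diff[OF Xu_subspace] Psi_in_Xu x y)
    also have "\<dots> \<le> (\<Sum>i'\<in>Iu S. \<Sum>n\<in>Is S. Ptilde S i' n * (pn S (Stb n) * norm (x - y)))"
    proof (rule sum_mono)
      fix i' assume i': "i' \<in> Iu S"
      have "norm (p (Unst i') (Psi S \<alpha> x - Psi S \<alpha> y)) \<le> (\<Sum>n\<in>Is S. Ptilde S i' n * norm (p (Stb n) (x - y)))"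
        using Psi_diff_le[OF i' x y] i' by (simp add: linear_diff[OF p_linear])
      also have "\<dots> \<le> (\<Sum>n\<in>Is S. Ptilde S i' n * (pn S (Stb n) * norm (x - y)))"
        by (intro sum_mono mult_left_mono p_norm Ptilde_nonneg i') auto
      finally show "norm (p (Unst i') (Psi S \<alpha> x - Psi S \<alpha> y)) \<le> \<dots>" .
    qed
    finally show "dist (Psi S \<alpha> x) (Psi S \<alpha> y) \<le> K * dist x y"
      by (simp add: dist_norm K_def sum_distrib_right mult.assoc)
  qed
  moreover have "Lip S (Psi S \<alpha>) i' n \<le> ereal (Pc S i' n)" if "i' \<in> Iu S" "n \<in> Is S" for i' n
    using Lip_Psi_le[OF that] le[OF that] by (meson ereal_less_eq(3) order_trans)
  ultimately show ?thesis
    using Psi_in_Xu Psi_zero by (auto simp: charts_def)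
qed

end

end

theorem theorem4p2:
  fixes S :: "'a::banach lp_data"
  \<comment> \<open>the evolution equation and the equilibrium\<close>
  assumes "linear_op_on (domL S) (Lam S)" and "closure (domL S) = UNIV"
    and "has_bounded_inverse (domL S) (Lam S)"
    and "C2_map (Nt S)"
    and "hyperbolic_equilibrium S"
  \<comment> \<open>the splitting and the linear rates\<close>
    and "splitting S"
    and "\<And>i. i \<in> Is S \<Longrightarrow> lam S (Stb i) < 0 \<and>
           exp_bound_on (Xc S (Stb i)) (domL S \<inter> Xc S (Stb i)) (Lam S) 1 (lam S (Stb i))"
    and "\<And>i'. i' \<in> Iu S \<Longrightarrow> lam S (Unst i') > 0 \<and>
           exp_bound_on (Xc S (Unst i')) (domL S \<inter> Xc S (Unst i')) (\<lambda>x. - Lam S x) 1 (- lam S (Unst i'))"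
    and "lam_s S < 0" and "lam_u S > 0" and "C_s S \<ge> 0" and "C_u S \<ge> 0"
    and "exp_bound_on (Xs S) (domL S \<inter> Xs S) (\<lambda>x. Lam S x + proj_s S (Lop S x)) (C_s S) (lam_s S)"
    and "exp_bound_on (Xu S) (domL S \<inter> Xu S) (\<lambda>x. - (Lam S x + proj_u S (Lop S x)))
           (C_u S) (- lam_u S)"
  \<comment> \<open>charts and derivative bounds\<close>
    and "\<And>i. i \<in> Is S \<Longrightarrow> rho S i > 0"
    and "\<And>i' i. i' \<in> Iu S \<Longrightarrow> i \<in> Is S \<Longrightarrow> Pc S i' i \<ge> 0"
    and "\<And>j i. j \<in> Iall S \<Longrightarrow> i \<in> Iall S \<Longrightarrow> Cc S j i \<ge> 0 \<and>
           (\<forall>x\<in>Bs S. \<forall>y\<in>Bu S. \<forall>v\<in>Xc S i.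
              norm (Npartial S j i (x + y) v) \<le> Cc S j i * norm v)"
  \<comment> \<open>rates and the bootstrapped tensor\<close>
    and "\<And>k. k < ms S \<Longrightarrow> gam S k > gam S (k + 1)" and "gam S 0 < 0"
    and "Nboot S \<ge> 1"
    and "\<And>j t. j \<in> Is S \<Longrightarrow> t \<ge> 0 \<Longrightarrow>
           rho S j \<ge> (\<Sum>n\<in>Is S. \<Sum>k\<in>{0..ms S}. exp (gam S k * t) * Gout S j k n * rho S n)"
  shows "(\<forall>\<alpha>\<in>charts S. Psi_defined S \<alpha> \<and>
            (\<forall>i'\<in>Iu S. \<forall>n\<in>Is S. Lip S (Psi S \<alpha>) i' n \<le> ereal (Ptilde S i' n))) \<and>
         ((\<forall>j'\<in>Iu S. \<forall>j\<in>Is S. Ptilde S j' j \<le> Pc S j' j) \<longrightarrow>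
            (\<forall>\<alpha>\<in>charts S. Psi_defined S \<alpha> \<and> Psi S \<alpha> \<in> charts S))"
proof -
  note rates = assms(7)[THEN conjunct1] assms(7)[THEN conjunct2] assms(8)[THEN conjunct1] assms(8)[THEN conjunct2]
    assms(17)[THEN conjunct1] assms(17)[THEN conjunct2, rule_format]
  interpret lp_system S
    by unfold_locales (fact assms rates)+
  show ?thesis
    using Psi_defined_charts Lip_Psi_le Psi_in_charts by simp
qed

end
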